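(* Let $N\ge2$, $p\in(1,+\infty)$, and $m\in\mathbb{N}$. Let $\Lambda$ be a full-rank point lattice in $\mathbb{R}^N$, and let $\Sigma$ be a corresponding fundamental domain (tiling domain), which is a bounded Lipschitz domain. Then the Weyl constant $C_{\mathcal{W}}=C_{\mathcal{W}}(p,N)$ satisfies $$C_{\mathcal{W}}\le|\Sigma|^{p/N}\,\frac{\lambda_m(p;\Sigma)}{m^{p/N}}.$$
   Context: $\mathbb{N}=\{1,2,\dots\}$; $|\cdot|$ is Lebesgue measure. For a bounded Lipschitz domain $\Omega\subset\mathbb{R}^N$ let $\mathcal{S}(\Omega)=\{u\in W_0^{1,p}(\Omega):\int_\Omega|u|^p\,dx=1\}$ and $E(u)=\int_\Omega|\nabla u|^p\,dx$. The cogenus eigenvalues are $\lambda_k(p;\Omega)=\inf_h\max_{u\in h(\mathbb{S}^{k-1})}E(u)$, $k\in\mathbb{N}$, the infimum being over all continuous odd maps $h:\mathbb{S}^{k-1}\to\mathcal{S}(\Omega)$, with $\mathbb{S}^{k-1}$ the unit sphere in $\mathbb{R}^k$. The Weyl constant $C_{\mathcal{W}}=C_{\mathcal{W}}(p,N)>0$ is the constant, depending only on $p$ and $N$, such that $\lim_{k\to+\infty}\lambda_k(p;\Omega)\,k^{-p/N}=C_{\mathcal{W}}|\Omega|^{-p/N}$ for every bounded Lipschitz domain $\Omega\subset\mathbb{R}^N$ (its existence is the Weyl law for the cogenus eigenvalues). A full-rank lattice $\Lambda$ is the image of $\mathbb{Z}^N$ under an invertible linear transformation of $\mathbb{R}^N$.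 A domain $\Sigma\subset\mathbb{R}^N$ is a fundamental domain for $\Lambda$ if $\mathbb{R}^N=\bigcup_{z\in\Lambda}\overline{z+\Sigma}$ and $(z+\Sigma)\cap(z'+\Sigma)=\emptyset$ for distinct $z,z'\in\Lambda$. *)

theory Defs
  imports "HOL-Analysis.Analysis"
begin

section \<open>Domains and lattices\<close>

definition is_domain :: "(real^'n) set \<Rightarrow> bool" where
  "is_domain \<Omega> \<longleftrightarrow> open \<Omega> \<and> connected \<Omega> \<and> \<Omega> \<noteq> {}"

text \<open>Near each boundary point, in the orthonormal coordinates whose last axis is the unit vector
  \<open>e\<close>, the domain is the strict epigraph of a Lipschitz function \<open>\<gamma>\<close> of the remaining coordinates;
  the latter are represented by the orthogonal projection to the hyperplane \<open>{y. y \<bullet> e = 0}\<close>.\<close>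

definition lipschitz_boundary :: "(real^'n) set \<Rightarrow> bool" where
  "lipschitz_boundary \<Omega> \<longleftrightarrow>
     (\<forall>x \<in> frontier \<Omega>. \<exists>r e \<gamma> L. r > 0 \<and> norm e = 1 \<and> L-lipschitz_on {y. y \<bullet> e = 0} \<gamma> \<and>
        \<Omega> \<inter> ball x r = {y \<in> ball x r. \<gamma> (y - (y \<bullet> e) *\<^sub>R e) < y \<bullet> e})"

definition bounded_lipschitz_domain :: "(real^'n) set \<Rightarrow> bool" where
  "bounded_lipschitz_domain \<Omega> \<longleftrightarrow> is_domain \<Omega> \<and> bounded \<Omega> \<and> lipschitz_boundary \<Omega>"

definition full_rank_lattice :: "(real^'n) set \<Rightarrow> bool" where
  "full_rank_lattice \<Lambda> \<longleftrightarrow>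
     (\<exists>T :: real^'n \<Rightarrow> real^'n. linear T \<and> bij T \<and> \<Lambda> = T ` {z. \<forall>i. z $ i \<in> \<int>})"

definition fundamental_domain :: "(real^'n) set \<Rightarrow> (real^'n) set \<Rightarrow> bool" where
  "fundamental_domain \<Lambda> \<Sigma> \<longleftrightarrow>
     is_domain \<Sigma> \<and>
     (\<Union>z\<in>\<Lambda>. closure ((+) z ` \<Sigma>)) = UNIV \<and>
     (\<forall>z\<in>\<Lambda>. \<forall>z'\<in>\<Lambda>. z \<noteq> z' \<longrightarrow> (+) z ` \<Sigma> \<inter> (+) z' ` \<Sigma> = {})"

section \<open>Sobolev spaces\<close>

definition partial_deriv :: "'n \<Rightarrow> (real^'n \<Rightarrow> real) \<Rightarrow> real^'n \<Rightarrow> real" where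
  "partial_deriv i f x = frechet_derivative f (at x) (axis i 1)"

primrec Ck :: "nat \<Rightarrow> (real^'n \<Rightarrow> real) \<Rightarrow> bool" where
  "Ck 0 f \<longleftrightarrow> continuous_on UNIV f"
| "Ck (Suc k) f \<longleftrightarrow> (\<forall>x. f differentiable (at x)) \<and> (\<forall>i. Ck k (partial_deriv i f))"

text \<open>\<open>C\<^sub>c\<^sup>\<infinity>(\<Omega>)\<close>, each function being extended by zero to the whole space.\<close>

definition test_functions :: "(real^'n) set \<Rightarrow> (real^'n \<Rightarrow> real) set" where
  "test_functions \<Omega> =
     {\<phi>. (\<forall>k. Ck k \<phi>) \<and> compact (closure {x. \<phi> x \<noteq> 0}) \<and> closure {x. \<phi> x \<noteq> 0} \<subseteq> \<Omega>}"

text \<open>Elements of Lebesgue and Sobolev spaces on \<open>\<Omega>\<close> are represented by functions on the whole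
  space whose values outside \<open>\<Omega>\<close>, and on null sets, are irrelevant.\<close>

definition L1_loc :: "(real^'n) set \<Rightarrow> (real^'n \<Rightarrow> 'b::euclidean_space) set" where
  "L1_loc \<Omega> = {f. f \<in> borel_measurable (lebesgue_on \<Omega>) \<and>
     (\<forall>K. compact K \<and> K \<subseteq> \<Omega> \<longrightarrow> integrable (lebesgue_on K) f)}"

definition Lp :: "real \<Rightarrow> (real^'n) set \<Rightarrow> (real^'n \<Rightarrow> 'b::euclidean_space) set" where
  "Lp p \<Omega> = {f. f \<in> borel_measurable (lebesgue_on \<Omega>) \<and>
     integrable (lebesgue_on \<Omega>) (\<lambda>x. norm (f x) powr p)}"

definition has_weak_gradient ::
  "(real^'n) set \<Rightarrow> (real^'n \<Rightarrow> real) \<Rightarrow> (real^'n \<Rightarrow> real^'n) \<Rightarrow> bool" where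
  "has_weak_gradient \<Omega> u G \<longleftrightarrow> u \<in> L1_loc \<Omega> \<and> G \<in> L1_loc \<Omega> \<and>
     (\<forall>\<phi> \<in> test_functions \<Omega>. \<forall>i.
        (\<integral>x. u x * partial_deriv i \<phi> x \<partial>lebesgue_on \<Omega>) = - (\<integral>x. G x $ i * \<phi> x \<partial>lebesgue_on \<Omega>))"

text \<open>The weak gradient is unique only up to null sets; any choice will do.\<close>

definition weak_gradient :: "(real^'n) set \<Rightarrow> (real^'n \<Rightarrow> real) \<Rightarrow> real^'n \<Rightarrow> real^'n" where
  "weak_gradient \<Omega> u = (SOME G. has_weak_gradient \<Omega> u G)"

definition W1p :: "real \<Rightarrow> (real^'n) set \<Rightarrow> (real^'n \<Rightarrow> real) set" where
  "W1p p \<Omega> = {u \<in> Lp p \<Omega>. \<exists>G \<in> Lp p \<Omega>. has_weak_gradient \<Omega> u G}"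

definition energy :: "real \<Rightarrow> (real^'n) set \<Rightarrow> (real^'n \<Rightarrow> real) \<Rightarrow> real" where
  "energy p \<Omega> u = (\<integral>x. norm (weak_gradient \<Omega> u x) powr p \<partial>lebesgue_on \<Omega>)"

definition W1p_norm :: "real \<Rightarrow> (real^'n) set \<Rightarrow> (real^'n \<Rightarrow> real) \<Rightarrow> real" where
  "W1p_norm p \<Omega> u = ((\<integral>x. \<bar>u x\<bar> powr p \<partial>lebesgue_on \<Omega>) + energy p \<Omega> u) powr (1 / p)"

definition W1p_dist :: "real \<Rightarrow> (real^'n) set \<Rightarrow> (real^'n \<Rightarrow> real) \<Rightarrow> (real^'n \<Rightarrow> real) \<Rightarrow> real" where
  "W1p_dist p \<Omega> u v = W1p_norm p \<Omega> (\<lambda>x. u x - v x)"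

definition W1p_0 :: "real \<Rightarrow> (real^'n) set \<Rightarrow> (real^'n \<Rightarrow> real) set" where
  "W1p_0 p \<Omega> = {u \<in> W1p p \<Omega>.
     \<exists>\<phi>. (\<forall>n. \<phi> n \<in> test_functions \<Omega>) \<and> (\<lambda>n. W1p_dist p \<Omega> (\<phi> n) u) \<longlonglongrightarrow> 0}"

section \<open>Cogenus eigenvalues and the Weyl constant\<close>

definition unit_Lp_sphere :: "real \<Rightarrow> (real^'n) set \<Rightarrow> (real^'n \<Rightarrow> real) set" where
  "unit_Lp_sphere p \<Omega> = {u \<in> W1p_0 p \<Omega>. (\<integral>x. \<bar>u x\<bar> powr p \<partial>lebesgue_on \<Omega>) = 1}"

text \<open>For \<open>k \<ge> 1\<close> the unit sphere of \<open>\<real>\<^sup>k\<close> is the library's \<open>nsphere (k - 1)\<close>, whose points are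
  sequences supported in \<open>{..<k}\<close>. Continuity is with respect to the \<open>W\<^sup>1\<^sup>,\<^sup>p\<close> distance, and oddness
  is equality in the Sobolev space, that is almost everywhere.\<close>

definition odd_sphere_maps ::
  "real \<Rightarrow> (real^'n) set \<Rightarrow> nat \<Rightarrow> ((nat \<Rightarrow> real) \<Rightarrow> real^'n \<Rightarrow> real) set" where
  "odd_sphere_maps p \<Omega> k = {h.
     h ` topspace (nsphere (k - 1)) \<subseteq> unit_Lp_sphere p \<Omega> \<and>
     (\<forall>\<xi> \<in> topspace (nsphere (k - 1)).
        ((\<lambda>\<eta>. W1p_dist p \<Omega> (h \<eta>) (h \<xi>)) \<longlongrightarrow> 0) (atin (nsphere (k - 1)) \<xi>)) \<and>
     (\<forall>\<xi> \<in> topspace (nsphere (k - 1)).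
        AE x in lebesgue_on \<Omega>. h (\<lambda>i. - \<xi> i) x = - h \<xi> x)}"

text \<open>The supremum is a maximum, since the energy is continuous on the compact image of the
  sphere. The value at \<open>k = 0\<close> is irrelevant.\<close>

definition cogenus_eigenvalue :: "real \<Rightarrow> (real^'n) set \<Rightarrow> nat \<Rightarrow> real" where
  "cogenus_eigenvalue p \<Omega> k =
     (INF h \<in> odd_sphere_maps p \<Omega> k. SUP \<xi> \<in> topspace (nsphere (k - 1)). energy p \<Omega> (h \<xi>))"

text \<open>The dimension \<open>N\<close> is \<open>CARD('n)\<close>. At most one \<open>C\<close> satisfies this predicate; that one exists is
  the Weyl law for the cogenus eigenvalues.\<close>

definition is_weyl_constant :: "'n::finite itself \<Rightarrow> real \<Rightarrow> real \<Rightarrow> bool" where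
  "is_weyl_constant _ p C \<longleftrightarrow> C > 0 \<and>
     (\<forall>\<Omega> :: (real^'n) set. bounded_lipschitz_domain \<Omega> \<longrightarrow>
        (\<lambda>k. cogenus_eigenvalue p \<Omega> k * real k powr (- p / real CARD('n)))
          \<longlonglongrightarrow> C * measure lebesgue \<Omega> powr (- p / real CARD('n)))"

end

(* The energy of a function in W_0^{1,p} of a tile equals that of its extension by zero, and scaling by
   1/K multiplies it by K^p after normalization in L^p. So if n disjoint copies of Sigma/K fit into Sigma and h is
   an odd map from the (m-1)-sphere to S(Sigma), then the map sending (xi_1, ..., xi_n), with xi_j in R^m, to
   the sum of |xi_j|^(2/p) times the copy of h(xi_j/|xi_j|) in the j-th tile is an odd map from the
   (mn-1)-sphere to S(Sigma): the p-th powers of the coefficients add up to 1, whence the energies are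
   averaged and lambda_{mn}(Sigma) <= K^p lambda_m(Sigma). Since Sigma tiles the space and its frontier is a
   null set, n ~ K^N is possible; dividing by (mn)^(p/N) and letting K tend to infinity, the Weyl
   law for Sigma itself gives the claim. *)

theory Submission
  imports Defs
begin

section \<open>Smooth functions\<close>

text \<open>The energy is defined through an arbitrarily chosen weak gradient, so it can be computed
  only once weak gradients are known to be unique almost everywhere; hence the construction of test
  functions and the fundamental lemma. Extension by zero is legitimate because elements of W_0^{1,p}
  are limits of test functions, whose extensions create no singular gradient. The delicate point is
  the continuity of the superposed map: xi_j/|xi_j| has no limit where the block xi_j vanishes.
  There the coefficient tends to 0, while \<open>h\<close> stays bounded in W^{1,p} by compactness
  of the sphere. Oddness holds only almost everywhere and has to be carried through each placement.
  Convergence is handled by p-th powers of norms, for which a quasi-triangle inequality with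
  constant 2^p is enough. Infima and suprema are taken in the reals, so nonemptiness and boundedness
  have to be established. In the final comparison only indices that are multiples of m occur, which
  suffices because the Weyl law provides a limit along all indices.\<close>

lemma Ck_Suc_imp: "Ck (Suc k) f \<Longrightarrow> Ck k f"
proof (induction k arbitrary: f)
  case 0
  then show ?case
    by (simp add: continuous_on_eq_continuous_within differentiable_imp_continuous_within)
next
  case (Suc k)
  then show ?case by (metis Ck.simps(2))
qed

lemma partial_deriv_eqI:
  assumes "(f has_derivative f') (at x)"
  shows "partial_deriv i f x = f' (axis i 1)"
  using assms frechet_derivative_at partial_deriv_def by metis

lemma has_derivative_frechet:
  "f differentiable (at x) \<Longrightarrow> (f has_derivative frechet_derivative f (at x)) (at x)"
  by (simp add: frechet_derivative_works)

lemma partial_deriv_const [simp]: "partial_deriv i (\<lambda>x. c) = (\<lambda>x. 0)"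
  by (rule ext, subst partial_deriv_eqI[where f'="\<lambda>_. 0"]) auto

lemma partial_deriv_add:
  assumes "\<forall>x. f differentiable (at x)" "\<forall>x. g differentiable (at x)"
  shows "partial_deriv i (\<lambda>x. f x + g x) = (\<lambda>x. partial_deriv i f x + partial_deriv i g x)"
proof
  fix x
  have "((\<lambda>x. f x + g x) has_derivative
      (\<lambda>v. frechet_derivative f (at x) v + frechet_derivative g (at x) v)) (at x)"
    using assms by (intro has_derivative_add has_derivative_frechet) auto
  from partial_deriv_eqI[OF this]
  show "partial_deriv i (\<lambda>x. f x + g x) x = partial_deriv i f x + partial_deriv i g x"
    by (simp add: partial_deriv_def)
qed

lemma partial_deriv_mult:
  assumes "\<forall>x. f differentiable (at x)" "\<forall>x. g differentiable (at x)"
  shows "partial_deriv i (\<lambda>x. f x * g x) = (\<lambda>x. f x * partial_deriv i g x + partial_deriv i f x * g x)"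
proof
  fix x
  have "((\<lambda>x. f x * g x) has_derivative
      (\<lambda>v. f x * frechet_derivative g (at x) v + frechet_derivative f (at x) v * g x)) (at x)"
    using assms by (intro has_derivative_mult has_derivative_frechet) auto
  from partial_deriv_eqI[OF this]
  show "partial_deriv i (\<lambda>x. f x * g x) x = f x * partial_deriv i g x + partial_deriv i f x * g x"
    by (simp add: partial_deriv_def)
qed

lemma affine_comp_has_derivative:
  fixes f :: "real^'n \<Rightarrow> real"
  assumes "f differentiable (at (a + s *\<^sub>R x))"
  shows "((\<lambda>x. f (a + s *\<^sub>R x)) has_derivative
          (\<lambda>v. frechet_derivative f (at (a + s *\<^sub>R x)) (s *\<^sub>R v))) (at x)"
proof -
  have 1: "((\<lambda>x. a + s *\<^sub>R x) has_derivative (\<lambda>v. s *\<^sub>R v)) (at x)"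
    by (auto intro!: derivative_eq_intros)
  have "(f has_derivative frechet_derivative f (at (a + s *\<^sub>R x))) (at (a + s *\<^sub>R x))"
    using assms by (rule has_derivative_frechet)
  from has_derivative_compose[OF 1 this] show ?thesis by simp
qed

lemma partial_deriv_affine:
  fixes f :: "real^'n \<Rightarrow> real"
  assumes "\<forall>x. f differentiable (at x)"
  shows "partial_deriv i (\<lambda>x. f (a + s *\<^sub>R x)) = (\<lambda>x. s * partial_deriv i f (a + s *\<^sub>R x))"
proof
  fix x
  have "linear (frechet_derivative f (at (a + s *\<^sub>R x)))"
    using assms linear_frechet_derivative by blast
  then show "partial_deriv i (\<lambda>x. f (a + s *\<^sub>R x)) x = s * partial_deriv i f (a + s *\<^sub>R x)"
    using partial_deriv_eqI[OF affine_comp_has_derivative, of f a s x i] assms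
      linear_cmul[of "frechet_derivative f (at (a + s *\<^sub>R x))" s "axis i 1"]
    by (simp add: partial_deriv_def)
qed

lemma Ck_const: "Ck k (\<lambda>x. c)"
  by (induction k arbitrary: c) auto

lemma Ck_add: "Ck k f \<Longrightarrow> Ck k g \<Longrightarrow> Ck k (\<lambda>x. f x + g x)"
  by (induction k arbitrary: f g) (auto intro: continuous_intros simp: partial_deriv_add)

lemma Ck_mult: "Ck k f \<Longrightarrow> Ck k g \<Longrightarrow> Ck k (\<lambda>x. f x * g x)"
proof (induction k arbitrary: f g)
  case 0 then show ?case by (auto intro: continuous_intros)
next
  case (Suc k)
  then have "Ck k f" "Ck k g" using Ck_Suc_imp by auto
  with Suc show ?case by (auto simp: partial_deriv_mult intro!: Ck_add)
qed

lemma Ck_prod: "finite I \<Longrightarrow> (\<And>i. i \<in> I \<Longrightarrow> Ck k (f i)) \<Longrightarrow> Ck k (\<lambda>x. \<Prod>i\<in>I. f i x)"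
  by (induction I rule: finite_induct) (auto intro: Ck_const Ck_mult)

lemma Ck_affine:
  fixes f :: "real^'n \<Rightarrow> real"
  shows "Ck k f \<Longrightarrow> Ck k (\<lambda>x. f (a + s *\<^sub>R x))"
proof (induction k arbitrary: f)
  case 0
  then show ?case
    by (auto intro!: continuous_intros continuous_on_compose2[of UNIV f])
next
  case (Suc k)
  then have "Ck k (\<lambda>x. s * partial_deriv i f (a + s *\<^sub>R x))" for i
    by (intro Ck_mult Ck_const) auto
  moreover have "(\<lambda>x. f (a + s *\<^sub>R x)) differentiable (at x)" for x
    using Suc affine_comp_has_derivative unfolding differentiable_def by (metis Ck.simps(2) differentiable_def)
  ultimately show ?case
    using Suc by (simp add: partial_deriv_affine)
qed

text \<open>A function vanishes on a whole neighbourhood of each point off its closed support, hence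
  has derivative zero there.\<close>

lemma partial_deriv_outside_closure:
  assumes "x \<notin> closure {x. f x \<noteq> 0}"
  shows "partial_deriv i f x = 0"
proof -
  have "((\<lambda>_. 0) has_derivative (\<lambda>_. 0)) (at x)" by simp
  then have "(f has_derivative (\<lambda>_. 0)) (at x)"
  proof (rule has_derivative_transform_within_open)
    show "open (- closure {x. f x \<noteq> 0})" by auto
    show "0 = f y" if "y \<in> - closure {x. f x \<noteq> 0}" for y
      using that closure_subset[of "{x. f x \<noteq> 0}"] by auto
  qed (use assms in auto)
  then show ?thesis by (rule partial_deriv_eqI)
qed

definition smooth :: "(real^'n \<Rightarrow> real) \<Rightarrow> bool" where
  "smooth f \<longleftrightarrow> (\<forall>k. Ck k f)"

lemma smooth_differentiable: "smooth f \<Longrightarrow> f differentiable (at x)"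
  using Ck.simps(2)[of 0 f] unfolding smooth_def by blast

lemma smooth_continuous: "smooth f \<Longrightarrow> continuous_on UNIV f"
  using Ck.simps(1)[of f] unfolding smooth_def by blast

lemma smooth_partial_deriv: "smooth f \<Longrightarrow> smooth (partial_deriv i f)"
  using Ck.simps(2)[of _ f] unfolding smooth_def by blast

lemma smooth_const: "smooth (\<lambda>x. c)"
  by (simp add: smooth_def Ck_const)

lemma smooth_add: "smooth f \<Longrightarrow> smooth g \<Longrightarrow> smooth (\<lambda>x. f x + g x)"
  by (simp add: smooth_def Ck_add)

lemma smooth_mult: "smooth f \<Longrightarrow> smooth g \<Longrightarrow> smooth (\<lambda>x. f x * g x)"
  by (simp add: smooth_def Ck_mult)

lemma smooth_affine: "smooth f \<Longrightarrow> smooth (\<lambda>x. f (a + s *\<^sub>R x))"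
  by (simp add: smooth_def Ck_affine)

lemma test_functions_iff:
  "\<phi> \<in> test_functions \<Omega> \<longleftrightarrow>
     smooth \<phi> \<and> compact (closure {x. \<phi> x \<noteq> 0}) \<and> closure {x. \<phi> x \<noteq> 0} \<subseteq> \<Omega>"
  by (simp add: test_functions_def smooth_def)

text \<open>Any compact set carrying \<open>\<phi>\<close> is a sufficient witness: the closed
  support lies in it and inherits compactness.\<close>

lemma test_function_intro:
  assumes "smooth \<phi>" "compact K" "K \<subseteq> \<Omega>" "\<And>x. x \<notin> K \<Longrightarrow> \<phi> x = 0"
  shows "\<phi> \<in> test_functions \<Omega>"
proof -
  have *: "closure {x. \<phi> x \<noteq> 0} \<subseteq> K"
    using assms by (intro closure_minimal compact_imp_closed) auto
  then have "compact (closure {x. \<phi> x \<noteq> 0})"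
    using assms(2) bounded_subset[of K "closure {x. \<phi> x \<noteq> 0}"]
    by (simp add: compact_eq_bounded_closed)
  with * assms show ?thesis by (auto simp: test_functions_iff)
qed

lemma test_functionE:
  assumes "\<phi> \<in> test_functions \<Omega>"
  obtains K where "smooth \<phi>" "compact K" "K \<subseteq> \<Omega>" "\<And>x. x \<notin> K \<Longrightarrow> \<phi> x = 0"
    "\<And>x i. x \<notin> K \<Longrightarrow> partial_deriv i \<phi> x = 0"
proof (rule that)
  show "\<phi> x = 0" if "x \<notin> closure {x. \<phi> x \<noteq> 0}" for x
    using that closure_subset[of "{x. \<phi> x \<noteq> 0}"] by auto
qed (use assms partial_deriv_outside_closure in \<open>auto simp: test_functions_iff\<close>)

section \<open>Bump functions\<close>

text \<open>The powers of 1/t are present because differentiating \<open>exp (- 1 / t)\<close>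
  produces them: the family is closed under differentiation up to linear combinations, so one
  induction on the order shows that all members are smooth.\<close>

definition exp_flat :: "nat \<Rightarrow> real \<Rightarrow> real" where
  "exp_flat k t = (if t > 0 then (1 / t) ^ k * exp (- 1 / t) else 0)"

lemma exp_flat_tendsto: "(exp_flat k \<longlongrightarrow> 0) (at_right 0)"
proof -
  have "((\<lambda>y. y ^ k / exp y) \<longlongrightarrow> (0::real)) at_top"
    by (rule tendsto_power_div_exp_0)
  then have "((\<lambda>t. (inverse t) ^ k / exp (inverse t)) \<longlongrightarrow> (0::real)) (at_right 0)"
    using filterlim_compose filterlim_inverse_at_top_right by blast
  then show ?thesis
    by (rule Lim_transform_eventually)
       (auto simp: exp_flat_def eventually_at_right_field exp_minus divide_simps intro!: exI[of _ 1])
qed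

lemma exp_flat_DERIV:
  "(exp_flat k has_real_derivative exp_flat (k + 2) t - k * exp_flat (k + 1) t) (at t)"
proof (cases t "0::real" rule: linorder_cases)
  case less
  have "((\<lambda>_. 0) has_real_derivative 0) (at t)" by simp
  then have "(exp_flat k has_real_derivative 0) (at t)"
    by (rule has_field_derivative_transform_within_open[where S="{..<0}"])
       (use less in \<open>auto simp: exp_flat_def\<close>)
  with less show ?thesis by (simp add: exp_flat_def)
next
  case greater
  have inv: "((\<lambda>t. 1 / t) has_real_derivative - ((1 / t)\<^sup>2)) (at t)"
    using greater by (auto intro!: derivative_eq_intros simp: power2_eq_square)
  have "((\<lambda>t. (1 / t) ^ k) has_real_derivative - (k * (1 / t) ^ (k + 1))) (at t)"
  proof (cases k)
    case (Suc j)
    show ?thesis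
      using DERIV_power[OF inv, of k] by (simp add: Suc power2_eq_square mult_ac)
  qed simp
  moreover have "((\<lambda>t. exp (- 1 / t)) has_real_derivative exp (- 1 / t) * (1 / t)\<^sup>2) (at t)"
    using DERIV_fun_exp[OF DERIV_minus[OF inv]] by simp
  ultimately have "((\<lambda>t. (1 / t) ^ k * exp (- 1 / t)) has_real_derivative
      - (k * (1 / t) ^ (k + 1)) * exp (- 1 / t) + exp (- 1 / t) * (1 / t)\<^sup>2 * (1 / t) ^ k) (at t)"
    by (rule DERIV_mult)
  then have "((\<lambda>t. (1 / t) ^ k * exp (- 1 / t)) has_real_derivative
      (1 / t) ^ (k + 2) * exp (- 1 / t) - k * ((1 / t) ^ (k + 1) * exp (- 1 / t))) (at t)"
    by (simp add: power_add algebra_simps power2_eq_square)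
  then have "(exp_flat k has_real_derivative
      (1 / t) ^ (k + 2) * exp (- 1 / t) - k * ((1 / t) ^ (k + 1) * exp (- 1 / t))) (at t)"
    by (rule has_field_derivative_transform_within_open[where S="{0<..}"])
       (use greater in \<open>auto simp: exp_flat_def\<close>)
  with greater show ?thesis by (simp add: exp_flat_def)
next
  case equal
  \<comment> \<open>The difference quotient at 0 vanishes on the left and is
    \<open>exp_flat (Suc k)\<close> on the right, which tends to 0.\<close>
  have "((\<lambda>h. exp_flat k h / h) \<longlongrightarrow> 0) (at 0)"
    unfolding filterlim_at_split
  proof
    show "((\<lambda>h. exp_flat k h / h) \<longlongrightarrow> 0) (at_left 0)"
      by (rule Lim_transform_eventually[OF tendsto_const])
         (auto simp: exp_flat_def eventually_at_left_field intro!: exI[of _ "-1"])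
    show "((\<lambda>h. exp_flat k h / h) \<longlongrightarrow> 0) (at_right 0)"
      by (rule Lim_transform_eventually[OF exp_flat_tendsto[of "Suc k"]])
         (auto simp: exp_flat_def eventually_at_right_field intro!: exI[of _ 1])
  qed
  then have "(exp_flat k has_real_derivative 0) (at 0)"
    by (simp add: DERIV_def exp_flat_def[of _ 0])
  with equal show ?thesis by (simp add: exp_flat_def)
qed

lemma exp_flat_coord_has_derivative:
  fixes x :: "real^'n"
  shows "((\<lambda>x. exp_flat k (s * x $ i + b)) has_derivative
     (\<lambda>v. (exp_flat (k + 2) (s * x $ i + b) - k * exp_flat (k + 1) (s * x $ i + b)) * (s * v $ i))) (at x)"
proof -
  have "((\<lambda>x. s * x $ i + b) has_derivative (\<lambda>v. s * v $ i)) (at x)"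
    by (auto intro!: derivative_eq_intros bounded_linear_imp_has_derivative)
  from has_derivative_compose[OF this exp_flat_DERIV[unfolded has_field_derivative_def]]
  show ?thesis by simp
qed

lemma Ck_exp_flat: "Ck n (\<lambda>x :: real^'n. exp_flat k (s * x $ i + b))"
proof (induction n arbitrary: k)
  case 0
  have "(\<lambda>x :: real^'n. exp_flat k (s * x $ i + b)) differentiable (at x)" for x
    using exp_flat_coord_has_derivative differentiable_def by blast
  then show ?case
    by (simp add: continuous_on_eq_continuous_within differentiable_imp_continuous_within)
next
  case (Suc n)
  have "partial_deriv j (\<lambda>x :: real^'n. exp_flat k (s * x $ i + b)) =
      (\<lambda>x. (exp_flat (k + 2) (s * x $ i + b) + (- real k) * exp_flat (k + 1) (s * x $ i + b)) *
         (s * axis j 1 $ i))" for j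
    by (rule ext, subst partial_deriv_eqI[OF exp_flat_coord_has_derivative]) simp
  moreover have "Ck n (\<lambda>x :: real^'n. (exp_flat (k + 2) (s * x $ i + b) + (- real k) * exp_flat (k + 1) (s * x $ i + b)) *
         (s * axis j 1 $ i))" for j
    by (intro Ck_add Ck_mult Ck_const Suc)
  moreover have "(\<lambda>x :: real^'n. exp_flat k (s * x $ i + b)) differentiable (at x)" for x
    using exp_flat_coord_has_derivative differentiable_def by blast
  ultimately show ?case by simp
qed

text \<open>The factor \<open>Suc n\<close> steepens the flanks in each coordinate, so that the
  bumps tend to the indicator of the open box while vanishing off it. The affine expressions are
  written out to match the form \<open>s * x $ i + b\<close> in \<open>Ck_exp_flat\<close>.\<close>

definition box_bump :: "real^'n \<Rightarrow> real^'n \<Rightarrow> nat \<Rightarrow> real^'n \<Rightarrow> real" where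
  "box_bump a b n x =
     (\<Prod>i\<in>UNIV. exp_flat 0 (real (Suc n) * x $ i + - real (Suc n) * a $ i) *
                exp_flat 0 (- real (Suc n) * x $ i + real (Suc n) * b $ i))"

lemma smooth_box_bump: "smooth (box_bump a b n)"
  unfolding box_bump_def smooth_def by (intro allI Ck_prod Ck_mult Ck_exp_flat) simp

lemma box_bump_altdef:
  "box_bump a b n x = (if x \<in> box a b then \<Prod>i\<in>UNIV. exp (-1 / (real (Suc n) * (x $ i - a $ i))) *
     exp (-1 / (real (Suc n) * (b $ i - x $ i))) else 0)"
proof (cases "x \<in> box a b")
  case True
  then have pos: "0 < x $ i - a $ i" "0 < b $ i - x $ i" for i
    by (auto simp: mem_box_cart)
  have eq: "real (Suc n) * x $ i + - real (Suc n) * a $ i = real (Suc n) * (x $ i - a $ i)"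
     "- real (Suc n) * x $ i + real (Suc n) * b $ i = real (Suc n) * (b $ i - x $ i)" for i
    by (simp_all add: algebra_simps)
  show ?thesis
    unfolding box_bump_def eq exp_flat_def using True pos by (simp add: zero_less_mult_iff)
next
  case False
  then obtain i where i: "x $ i \<le> a $ i \<or> b $ i \<le> x $ i"
    by (auto simp: mem_box_cart not_less)
  have eq: "real (Suc n) * x $ i + - real (Suc n) * a $ i = real (Suc n) * (x $ i - a $ i)"
     "- real (Suc n) * x $ i + real (Suc n) * b $ i = real (Suc n) * (b $ i - x $ i)" for i
    by (simp_all add: algebra_simps)
  have "exp_flat 0 (real (Suc n) * x $ i + - real (Suc n) * a $ i) *
        exp_flat 0 (- real (Suc n) * x $ i + real (Suc n) * b $ i) = 0"
    unfolding eq exp_flat_def using i by (auto simp: zero_less_mult_iff)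
  then have "box_bump a b n x = 0"
    unfolding box_bump_def by (intro prod_zero) auto
  with False show ?thesis by simp
qed

lemma box_bump_bounds: "0 \<le> box_bump a b n x" "box_bump a b n x \<le> indicator (box a b) x"
proof -
  show "0 \<le> box_bump a b n x"
    unfolding box_bump_altdef by (auto intro!: prod_nonneg)
  have "(\<Prod>i\<in>UNIV. exp (-1 / (real (Suc n) * (x $ i - a $ i))) *
     exp (-1 / (real (Suc n) * (b $ i - x $ i)))) \<le> 1" if "x \<in> box a b"
  proof (rule prod_le_1)
    fix i
    from that have pos: "0 < x $ i - a $ i" "0 < b $ i - x $ i"
      by (auto simp: mem_box_cart)
    then show "0 \<le> exp (-1 / (real (Suc n) * (x $ i - a $ i))) * exp (-1 / (real (Suc n) * (b $ i - x $ i))) \<and>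
       exp (-1 / (real (Suc n) * (x $ i - a $ i))) * exp (-1 / (real (Suc n) * (b $ i - x $ i))) \<le> 1"
      by (intro conjI mult_nonneg_nonneg mult_le_one) auto
  qed
  then show "box_bump a b n x \<le> indicator (box a b) x"
    unfolding box_bump_altdef by (auto simp: indicator_def)
qed

lemma box_bump_tendsto:
  fixes a b x :: "real^'a"
  shows "(\<lambda>n. box_bump a b n x) \<longlonglongrightarrow> indicator (box a b) x"
proof (cases "x \<in> box a b")
  case True
  have *: "(\<lambda>n. exp (-1 / (real (Suc n) * c))) \<longlonglongrightarrow> 1" for c :: real
  proof -
    have "(\<lambda>n. (-1/c) * inverse (real (Suc n))) \<longlonglongrightarrow> (-1/c) * 0"
      by (intro tendsto_intros LIMSEQ_inverse_real_of_nat)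
    then have "(\<lambda>n. exp (-1 / (real (Suc n) * c))) \<longlonglongrightarrow> exp 0"
      by (intro tendsto_exp) (simp add: field_simps)
    then show ?thesis by simp
  qed
  have "(\<lambda>n. \<Prod>i\<in>UNIV. exp (-1 / (real (Suc n) * (x $ i - a $ i))) *
     exp (-1 / (real (Suc n) * (b $ i - x $ i)))) \<longlonglongrightarrow> (\<Prod>i\<in>(UNIV::'a set). 1 * 1)"
    by (intro tendsto_prod tendsto_mult *)
  with True show ?thesis by (simp add: box_bump_altdef)
next
  case False then show ?thesis by (simp add: box_bump_altdef)
qed

lemma box_bump_test_function:
  assumes "cbox a b \<subseteq> \<Omega>"
  shows "box_bump a b n \<in> test_functions \<Omega>"
proof (rule test_function_intro[OF smooth_box_bump compact_cbox assms])
  show "box_bump a b n x = 0" if "x \<notin> cbox a b" for x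
    using that box_subset_cbox[of a b] by (auto simp: box_bump_altdef)
qed

section \<open>Uniqueness of weak gradients\<close>

text \<open>Measurability of the multiplier is enough, so that indicators of boxes are covered as
  well as test functions.\<close>

lemma L1_loc_integrable_mult:
  fixes u :: "real^'n \<Rightarrow> real"
  assumes u: "u \<in> L1_loc \<Omega>" and "\<Omega> \<in> sets lebesgue" and "compact K" "K \<subseteq> \<Omega>"
    and \<psi>: "\<psi> \<in> borel_measurable borel" "\<And>x. \<bar>\<psi> x\<bar> \<le> B" "\<And>x. x \<notin> K \<Longrightarrow> \<psi> x = 0"
  shows "integrable (lebesgue_on \<Omega>) (\<lambda>x. u x * \<psi> x)"
proof -
  have K: "K \<in> sets lebesgue" using assms by (simp add: lmeasurable_compact fmeasurableD)
  have "integrable (lebesgue_on K) u"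
    using assms by (auto simp: L1_loc_def)
  then have "integrable (lebesgue_on K) (\<lambda>x. u x * \<psi> x)"
  proof (rule Bochner_Integration.integrable_bound[where f = "\<lambda>x. B * u x", OF integrable_mult_right])
    have "\<psi> \<in> borel_measurable (lebesgue_on K)"
      using \<psi>(1) by (intro measurable_restrict_space1 measurable_completion) simp
    then show "(\<lambda>x. u x * \<psi> x) \<in> borel_measurable (lebesgue_on K)"
      using \<open>integrable (lebesgue_on K) u\<close> by (intro borel_measurable_times) auto
    have "\<bar>u x * \<psi> x\<bar> \<le> \<bar>B * u x\<bar>" for x
      unfolding abs_mult using \<psi>(2)[of x]
      by (subst mult.commute) (intro mult_right_mono; simp)
    then show "AE x in lebesgue_on K. norm (u x * \<psi> x) \<le> norm (B * u x)" by simp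
  qed
  then have "integrable lebesgue (\<lambda>x. if x \<in> K then u x * \<psi> x else 0)"
    by (subst Lebesgue_Measure.integrable_restrict_UNIV[OF K])
  also have "(\<lambda>x. if x \<in> K then u x * \<psi> x else 0) = (\<lambda>x. if x \<in> \<Omega> then u x * \<psi> x else 0)"
    using assms by (auto simp: fun_eq_iff)
  finally show ?thesis using Lebesgue_Measure.integrable_restrict_UNIV[OF assms(2)] by blast
qed

lemma continuous_compact_support_bounded:
  fixes \<psi> :: "real^'n \<Rightarrow> real"
  assumes "continuous_on UNIV \<psi>" "compact K" "\<And>x. x \<notin> K \<Longrightarrow> \<psi> x = 0"
  obtains B where "B \<ge> 0" "\<And>x. \<bar>\<psi> x\<bar> \<le> B"
proof -
  have "bounded (\<psi> ` K)"
    using assms by (meson compact_continuous_image compact_imp_bounded continuous_on_subset top_greatest)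
  then obtain B where "\<forall>x\<in>K. \<bar>\<psi> x\<bar> \<le> B" by (auto simp: bounded_iff)
  then show thesis
    using assms(3) by (intro that[of "max 0 B"]) (metis abs_zero max.cobounded1 max.coboundedI2, metis abs_zero max.cobounded1 max.coboundedI2)
qed

lemma continuous_borel: "continuous_on UNIV \<psi> \<Longrightarrow> \<psi> \<in> borel_measurable borel"
  by (rule borel_measurable_continuous_onI)

lemma L1_loc_integrable_continuous:
  fixes u :: "real^'n \<Rightarrow> real"
  assumes "u \<in> L1_loc \<Omega>" "open \<Omega>" "compact K" "K \<subseteq> \<Omega>"
    "continuous_on UNIV \<psi>" "\<And>x. x \<notin> K \<Longrightarrow> \<psi> x = 0"
  shows "integrable (lebesgue_on \<Omega>) (\<lambda>x. u x * \<psi> x)"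
proof -
  obtain B where "\<And>x. \<bar>\<psi> x\<bar> \<le> B"
    using continuous_compact_support_bounded assms by metis
  then show ?thesis
    using assms continuous_borel by (intro L1_loc_integrable_mult[where K=K and B=B]) auto
qed

lemma L1_loc_component: "G \<in> L1_loc \<Omega> \<Longrightarrow> (\<lambda>x. G x $ i) \<in> L1_loc \<Omega>"
  for G :: "real^'n \<Rightarrow> real^'n"
proof -
  have b: "bounded_linear (\<lambda>v :: real^'n. v $ i)" by (rule bounded_linear_vec_nth)
  then have "(\<lambda>v :: real^'n. v $ i) \<in> borel_measurable borel"
    by (intro continuous_borel linear_continuous_on)
  then show "G \<in> L1_loc \<Omega> \<Longrightarrow> ?thesis"
    using b by (auto simp: L1_loc_def intro: integrable_bounded_linear measurable_compose)
qed

text \<open>A Dynkin argument: boxes are stable under intersection and generate the Borel sets, and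
  the sets over which \<open>f\<close> integrates to 0 are closed under countable disjoint unions
  and, thanks to the vanishing total integral, under complements. Lebesgue sets differ from Borel
  sets by null sets only.\<close>

lemma integral_box_zero_imp_AE_zero:
  fixes f :: "'a::euclidean_space \<Rightarrow> real"
  assumes f: "integrable lebesgue f"
    and 0: "\<And>c d. (\<integral>x. indicator (box c d) x * f x \<partial>lebesgue) = 0"
    and f0: "integral\<^sup>L lebesgue f = 0"
  shows "AE x in lebesgue. f x = 0"
proof (rule density_unique_real[OF f integrable_zero])
  let ?E = "range (\<lambda>(a, b). box a b::'a set)"
  have Int: "set_integrable lebesgue A f" if "A \<in> sets lebesgue" for A
    using integrable_mult_indicator[OF that f] by (simp add: set_integrable_def)
  have Int_stable: "Int_stable ?E"
    by (auto simp: Int_stable_def box_Int_box)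
  have borel: "A \<in> sets lebesgue \<and> (LINT x:A|lebesgue. f x) = 0" if "A \<in> sigma_sets UNIV ?E" for A
    using Int_stable subset_UNIV[of ?E, folded Pow_UNIV] that
  proof (induction rule: sigma_sets_induct_disjoint)
    case (basic A) then show ?case
      using 0 by (auto simp: set_lebesgue_integral_def)
  next
    case empty then show ?case by (simp add: set_lebesgue_integral_def)
  next
    case (compl A)
    then have A: "A \<in> sets lebesgue" "(LINT x:A|lebesgue. f x) = 0" by auto
    have "(LINT x:(A \<union> (UNIV - A))|lebesgue. f x) = (LINT x:A|lebesgue. f x) + (LINT x:(UNIV - A)|lebesgue. f x)"
      using A by (intro set_integral_Un Int) auto
    then show ?case using A f0 by (auto simp: set_lebesgue_integral_def)
  next
    case (union A)
    then have A: "\<And>i. A i \<in> sets lebesgue" "\<And>i. (LINT x:A i|lebesgue. f x) = 0" by auto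
    have "(LINT x:(\<Union>i. A i)|lebesgue. f x) = (\<Sum>i. (LINT x:(A i)|lebesgue. f x))"
      using A union by (intro lebesgue_integral_countable_add Int) (auto simp: disjoint_family_on_def)
    with A show ?case by auto
  qed
  fix A :: "'a set" assume "A \<in> sets lebesgue"
  then obtain C T where CT: "fsigma C" "T \<in> null_sets lebesgue" "C \<union> T = A" "disjnt C T"
    by (rule lebesgue_set_almost_fsigma)
  have "C \<in> sets borel" using CT(1) by (auto elim!: fsigma.cases)
  then have C: "C \<in> sigma_sets UNIV ?E" by (simp add: borel_eq_box)
  have "set_lebesgue_integral lebesgue A f = set_lebesgue_integral lebesgue C f"
  proof (rule set_integral_null_delta)
    have "A - C \<union> (C - A) = T" using CT by (auto simp: disjnt_def)
    then show "A - C \<union> (C - A) \<in> null_sets lebesgue" using CT by simp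
    show "C \<in> sets lebesgue" using borel[OF C] by simp
  qed (use f \<open>A \<in> sets lebesgue\<close> in auto)
  with borel[OF C] show "set_lebesgue_integral lebesgue A f = (LINT x:A|lebesgue. 0)" by simp
qed

text \<open>The bumps converge to box indicators under a common integrable bound, so the hypothesis
  passes from test functions to all boxes with \<open>cbox a b\<close> inside
  \<open>\<Omega>\<close>. Thus \<open>g\<close> vanishes almost everywhere on each such box, and
  countably many of them exhaust \<open>\<Omega>\<close>.\<close>

lemma fundamental_lemma_variations:
  fixes g :: "real^'n \<Rightarrow> real"
  assumes \<Omega>: "open \<Omega>" and g: "g \<in> L1_loc \<Omega>"
    and 0: "\<And>\<phi>. \<phi> \<in> test_functions \<Omega> \<Longrightarrow> (\<integral>x. g x * \<phi> x \<partial>lebesgue_on \<Omega>) = 0"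
  shows "AE x in lebesgue_on \<Omega>. g x = 0"
proof -
  have \<Omega>': "\<Omega> \<in> sets lebesgue" using \<Omega> by auto
  have box0: "(\<integral>x. g x * indicator (box a b) x \<partial>lebesgue_on \<Omega>) = 0" if ab: "cbox a b \<subseteq> \<Omega>" for a b
  proof -
    have "(\<lambda>n. \<integral>x. g x * box_bump a b n x \<partial>lebesgue_on \<Omega>) \<longlonglongrightarrow>
       (\<integral>x. g x * indicator (box a b) x \<partial>lebesgue_on \<Omega>)"
    proof (rule integral_dominated_convergence)
      have i: "integrable (lebesgue_on \<Omega>) (\<lambda>x. g x * indicator (box a b) x)"
        by (rule L1_loc_integrable_mult[OF g \<Omega>' compact_cbox ab, where B=1])
           (use box_subset_cbox[of a b] in \<open>auto simp: indicator_def\<close>)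
      then show "integrable (lebesgue_on \<Omega>) (\<lambda>x. \<bar>g x * indicator (box a b) x\<bar>)"
        by (rule integrable_abs)
      show "(\<lambda>x. g x * indicator (box a b) x) \<in> borel_measurable (lebesgue_on \<Omega>)"
        using i by auto
      show "(\<lambda>x. g x * box_bump a b n x) \<in> borel_measurable (lebesgue_on \<Omega>)" for n
      proof -
        have "integrable (lebesgue_on \<Omega>) (\<lambda>x. g x * box_bump a b n x)"
        proof (rule L1_loc_integrable_mult[OF g \<Omega>' compact_cbox ab, where B=1])
          show "box_bump a b n \<in> borel_measurable borel"
            by (intro continuous_borel smooth_continuous smooth_box_bump)
          show "\<bar>box_bump a b n x\<bar> \<le> 1" for x
            using box_bump_bounds[of a b n x] by (cases "x \<in> box a b") auto
          show "box_bump a b n x = 0" if "x \<notin> cbox a b" for x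
            using that box_subset_cbox[of a b] by (auto simp: box_bump_altdef)
        qed
        then show ?thesis by auto
      qed
      show "AE x in lebesgue_on \<Omega>. (\<lambda>n. g x * box_bump a b n x) \<longlonglongrightarrow> g x * indicator (box a b) x"
        by (intro always_eventually allI tendsto_mult tendsto_const box_bump_tendsto)
      show "AE x in lebesgue_on \<Omega>. norm (g x * box_bump a b n x) \<le> \<bar>g x * indicator (box a b) x\<bar>" for n
        using box_bump_bounds[of a b n] by (intro always_eventually allI) (auto simp: abs_mult intro!: mult_left_mono)
    qed
    moreover have "(\<integral>x. g x * box_bump a b n x \<partial>lebesgue_on \<Omega>) = 0" for n
      using ab by (intro 0 box_bump_test_function)
    ultimately show ?thesis by (simp add: LIMSEQ_const_iff)
  qed
  have AE_box: "AE x in lebesgue. x \<in> box a b \<longrightarrow> g x = 0" if ab: "cbox a b \<subseteq> \<Omega>" for a b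
  proof -
    \<comment> \<open>Cutting \<open>g\<close> off outside a single box makes it integrable on the
      whole space, where the Dynkin argument takes place.\<close>
    define f where "f = (\<lambda>x. if x \<in> \<Omega> then g x * indicator (box a b) x else 0)"
    have i: "integrable (lebesgue_on \<Omega>) (\<lambda>x. g x * indicator (box a b) x)"
      by (rule L1_loc_integrable_mult[OF g \<Omega>' compact_cbox ab, where B=1])
         (use box_subset_cbox[of a b] in \<open>auto simp: indicator_def\<close>)
    then have "integrable lebesgue f"
      unfolding f_def by (subst Lebesgue_Measure.integrable_restrict_UNIV[OF \<Omega>'])
    moreover have "(\<integral>x. indicator (box c d) x * f x \<partial>lebesgue) = 0" for c d
    proof -
      \<comment> \<open>\<open>e\<close> and \<open>h\<close> are the corners of the intersection of
        the two boxes, a box whose closed version still lies in \<open>cbox a b\<close>.\<close>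
      define e where "e = (\<Sum>i\<in>Basis. max (a\<bullet>i) (c\<bullet>i) *\<^sub>R i)"
      define h where "h = (\<Sum>i\<in>Basis. min (b\<bullet>i) (d\<bullet>i) *\<^sub>R i)"
      have eq: "box a b \<inter> box c d = box e h" by (simp add: box_Int_box e_def h_def)
      have "cbox e h \<subseteq> cbox a b"
        by (auto simp: mem_box e_def h_def)
      with ab have "cbox e h \<subseteq> \<Omega>" by blast
      then have "(\<integral>x. g x * indicator (box e h) x \<partial>lebesgue_on \<Omega>) = 0" by (rule box0)
      also have "(\<integral>x. g x * indicator (box e h) x \<partial>lebesgue_on \<Omega>) =
         (\<integral>x. (if x \<in> \<Omega> then g x * indicator (box e h) x else 0) \<partial>lebesgue)"
        by (subst Lebesgue_Measure.integral_restrict_UNIV[OF \<Omega>']) simp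
      also have "(\<lambda>x. if x \<in> \<Omega> then g x * indicator (box e h) x else 0) = (\<lambda>x. indicator (box c d) x * f x)"
        unfolding eq[symmetric] f_def by (auto simp: fun_eq_iff indicator_def)
      finally show ?thesis .
    qed
    moreover have "integral\<^sup>L lebesgue f = 0"
      using box0[OF ab] unfolding f_def by (subst Lebesgue_Measure.integral_restrict_UNIV[OF \<Omega>']) simp
    ultimately have "AE x in lebesgue. f x = 0"
      by (rule integral_box_zero_imp_AE_zero)
    then show ?thesis
      using ab box_subset_cbox[of a b] by (elim eventually_mono) (auto simp: f_def indicator_def)
  qed
  have AE_cbox: "AE x in lebesgue. x \<in> cbox a b \<longrightarrow> g x = 0" if "cbox a b \<subseteq> \<Omega>" for a b
  proof -
    \<comment> \<open>The faces are null, so open boxes may be replaced by the closed ones that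
      exhaust the open set.\<close>
    have "AE x in lebesgue. x \<notin> cbox a b - box a b"
      using negligible_frontier_interval[of a b] unfolding negligible_iff_null_sets by (rule AE_not_in)
    with AE_box[OF that] show ?thesis by eventually_elim auto
  qed
  obtain D where D: "countable D" "D \<subseteq> Pow \<Omega>"
    "\<And>X. X \<in> D \<Longrightarrow> \<exists>a b. X = cbox a b" "\<Union>D = \<Omega>"
    using open_countable_Union_open_cbox[OF \<Omega>] by metis
  have "AE x in lebesgue. \<forall>X\<in>D. x \<in> X \<longrightarrow> g x = 0"
    using AE_cbox D by (intro AE_ball_countable[THEN iffD2]) blast+
  then have "AE x in lebesgue. x \<in> \<Omega> \<longrightarrow> g x = 0"
    by (rule eventually_mono) (use D in blast)
  then show ?thesis by (simp add: AE_restrict_space_iff \<Omega>')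
qed

lemma has_weak_gradientD:
  assumes "has_weak_gradient \<Omega> u G"
  shows "u \<in> L1_loc \<Omega>" "G \<in> L1_loc \<Omega>"
    "\<phi> \<in> test_functions \<Omega> \<Longrightarrow>
       (\<integral>x. u x * partial_deriv i \<phi> x \<partial>lebesgue_on \<Omega>) = - (\<integral>x. G x $ i * \<phi> x \<partial>lebesgue_on \<Omega>)"
  using assms by (auto simp: has_weak_gradient_def)

text \<open>Each component of the difference of two weak gradients integrates to 0 against all test
  functions.\<close>

lemma weak_gradient_unique:
  assumes \<Omega>: "open \<Omega>" and "has_weak_gradient \<Omega> u G" "has_weak_gradient \<Omega> u G'"
  shows "AE x in lebesgue_on \<Omega>. G x = G' x"
proof -
  have G: "G \<in> L1_loc \<Omega>" "G' \<in> L1_loc \<Omega>"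
    using has_weak_gradientD(2) assms by auto
  have "AE x in lebesgue_on \<Omega>. G x $ i - G' x $ i = 0" for i
  proof (rule fundamental_lemma_variations[OF \<Omega>])
    show "(\<lambda>x. G x $ i - G' x $ i) \<in> L1_loc \<Omega>"
      using L1_loc_component[OF G(1), of i] L1_loc_component[OF G(2), of i]
      unfolding L1_loc_def by (intro CollectI conjI allI impI borel_measurable_diff
        Bochner_Integration.integrable_diff) blast+
    fix \<phi> assume \<phi>: "\<phi> \<in> test_functions \<Omega>"
    then obtain K where K: "smooth \<phi>" "compact K" "K \<subseteq> \<Omega>" "\<And>x. x \<notin> K \<Longrightarrow> \<phi> x = 0"
      by (rule test_functionE) blast
    have "(\<integral>x. (G x $ i - G' x $ i) * \<phi> x \<partial>lebesgue_on \<Omega>) =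
       (\<integral>x. G x $ i * \<phi> x \<partial>lebesgue_on \<Omega>) - (\<integral>x. G' x $ i * \<phi> x \<partial>lebesgue_on \<Omega>)"
      unfolding left_diff_distrib
      using L1_loc_integrable_continuous[OF L1_loc_component[OF G(1)] \<Omega> K(2,3) smooth_continuous[OF K(1)] K(4)]
        L1_loc_integrable_continuous[OF L1_loc_component[OF G(2)] \<Omega> K(2,3) smooth_continuous[OF K(1)] K(4)]
      by (rule Bochner_Integration.integral_diff)
    also have "\<dots> = 0"
    proof -
      have "- (\<integral>x. G x $ i * \<phi> x \<partial>lebesgue_on \<Omega>) = - (\<integral>x. G' x $ i * \<phi> x \<partial>lebesgue_on \<Omega>)"
        using has_weak_gradientD(3)[OF assms(2) \<phi>, of i] has_weak_gradientD(3)[OF assms(3) \<phi>, of i]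
        by simp
      then show ?thesis by simp
    qed
    finally show "(\<integral>x. (G x $ i - G' x $ i) * \<phi> x \<partial>lebesgue_on \<Omega>) = 0" .
  qed
  then have "AE x in lebesgue_on \<Omega>. \<forall>i\<in>UNIV. G x $ i - G' x $ i = 0"
    by (intro AE_finite_allI) auto
  then show ?thesis by (rule eventually_mono) (simp add: vec_eq_iff)
qed

section \<open>Integration by parts\<close>

lemma
  fixes f :: "real^'n \<Rightarrow> 'b::euclidean_space"
  assumes s: "s \<noteq> 0" and f: "f \<in> borel_measurable lebesgue"
  shows lebesgue_measurable_affine: "(\<lambda>x. f (a + s *\<^sub>R x)) \<in> borel_measurable lebesgue"
    and lebesgue_integrable_affine_iff: "integrable lebesgue (\<lambda>x. f (a + s *\<^sub>R x)) \<longleftrightarrow> integrable lebesgue f"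
    and lebesgue_integral_affine: "(\<integral>x. f (a + s *\<^sub>R x) \<partial>lebesgue) = (1 / \<bar>s\<bar> ^ CARD('n)) *\<^sub>R (\<integral>x. f x \<partial>lebesgue)"
proof -
  define T where "T = (\<lambda>x :: real^'n. a + s *\<^sub>R x)"
  have T_eq: "T = (\<lambda>x. a + (\<Sum>j\<in>Basis. (s * (x \<bullet> j)) *\<^sub>R j))"
    unfolding T_def scaleR_scaleR[symmetric] scaleR_sum_right[symmetric] euclidean_representation ..
  have T: "T \<in> lebesgue \<rightarrow>\<^sub>M lebesgue"
    unfolding T_eq using s by (intro lebesgue_affine_measurable) auto
  have leb: "lebesgue = density (distr lebesgue lebesgue T) (\<lambda>_. ennreal (\<bar>s\<bar> ^ CARD('n)))"
    using lebesgue_affine_euclidean[of "\<lambda>_. s" a] s unfolding T_eq by simp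
  show "(\<lambda>x. f (a + s *\<^sub>R x)) \<in> borel_measurable lebesgue"
    using measurable_compose[OF T f] by (simp add: T_def)
  have f': "f \<in> borel_measurable (distr lebesgue lebesgue T)" using f by simp
  have "integrable lebesgue f \<longleftrightarrow> integrable (distr lebesgue lebesgue T) f"
    using s integrable_scaleR_right[of "1 / \<bar>s\<bar> ^ CARD('n)" "distr lebesgue lebesgue T"
        "\<lambda>x. \<bar>s\<bar> ^ CARD('n) *\<^sub>R f x"]
    by (subst leb, subst integrable_density[OF f']) auto
  also have "\<dots> \<longleftrightarrow> integrable lebesgue (\<lambda>x. f (T x))"
    by (rule integrable_distr_eq[OF T f])
  finally show "integrable lebesgue (\<lambda>x. f (a + s *\<^sub>R x)) \<longleftrightarrow> integrable lebesgue f"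
    by (simp add: T_def)
  have "(\<integral>x. f x \<partial>lebesgue) = (\<integral>x. \<bar>s\<bar> ^ CARD('n) *\<^sub>R f x \<partial>distr lebesgue lebesgue T)"
    by (subst leb, subst integral_density[OF f']) auto
  also have "\<dots> = (\<integral>x. \<bar>s\<bar> ^ CARD('n) *\<^sub>R f (T x) \<partial>lebesgue)"
    using f by (intro integral_distr[OF T]) auto
  finally show "(\<integral>x. f (a + s *\<^sub>R x) \<partial>lebesgue) = (1 / \<bar>s\<bar> ^ CARD('n)) *\<^sub>R (\<integral>x. f x \<partial>lebesgue)"
    using s by (simp add: T_def)
qed

lemma continuous_lebesgue_measurable:
  "continuous_on UNIV f \<Longrightarrow> f \<in> borel_measurable lebesgue"
  for f :: "'a::euclidean_space \<Rightarrow> 'b::euclidean_space"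
  by (intro measurable_completion) (simp add: borel_measurable_continuous_onI)

lemma continuous_L1_loc:
  fixes f :: "real^'n \<Rightarrow> 'b::euclidean_space"
  assumes "continuous_on UNIV f"
  shows "f \<in> L1_loc \<Omega>"
  unfolding L1_loc_def
proof (intro CollectI conjI allI impI)
  have m: "f \<in> borel_measurable lebesgue" using assms by (rule continuous_lebesgue_measurable)
  then show "f \<in> borel_measurable (lebesgue_on \<Omega>)" by (rule measurable_restrict_space1)
  fix K assume "compact K \<and> K \<subseteq> \<Omega>"
  then have K: "compact K" by simp
  interpret finite_measure "lebesgue_on K"
    using K by (intro finite_measure_lebesgue_on lmeasurable_compact)
  have "bounded (f ` K)"
    using assms K by (meson compact_continuous_image compact_imp_bounded continuous_on_subset top_greatest)
  then obtain B where "\<forall>x\<in>K. norm (f x) \<le> B" by (auto simp: bounded_iff)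
  then show "integrable (lebesgue_on K) f"
    using m by (intro integrable_const_bound[where B=B] measurable_restrict_space1 AE_I2) simp_all
qed

lemma integrable_compact_support:
  fixes \<psi> :: "real^'n \<Rightarrow> real"
  assumes "compact K" "\<psi> \<in> borel_measurable borel" "\<And>x. \<bar>\<psi> x\<bar> \<le> B" "\<And>x. x \<notin> K \<Longrightarrow> \<psi> x = 0"
  shows "integrable lebesgue \<psi>"
proof -
  have "(\<lambda>_::real^'n. 1 :: real) \<in> L1_loc UNIV" by (rule continuous_L1_loc) simp
  from L1_loc_integrable_mult[OF this _ assms(1) _ assms(2-4)] show ?thesis
    by (simp add: lebesgue_on_UNIV_eq)
qed

lemma integrable_continuous_compact_support:
  fixes \<psi> :: "real^'n \<Rightarrow> real"
  assumes "compact K" "continuous_on UNIV \<psi>" "\<And>x. x \<notin> K \<Longrightarrow> \<psi> x = 0"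
  shows "integrable lebesgue \<psi>"
proof -
  obtain B where "\<And>x. \<bar>\<psi> x\<bar> \<le> B"
    using continuous_compact_support_bounded[OF assms(2,1,3)] by blast
  with assms show ?thesis
    by (intro integrable_compact_support[where K=K and B=B] continuous_borel) auto
qed

text \<open>Difference quotients integrate to zero by translation invariance, and dominated convergence
  applies since they are bounded with uniformly bounded support.\<close>

lemma integral_partial_deriv_eq_zero:
  fixes f :: "real^'n \<Rightarrow> real"
  assumes f: "smooth f" and K: "compact K" and f0: "\<And>x. x \<notin> K \<Longrightarrow> f x = 0"
    and pf0: "\<And>x. x \<notin> K \<Longrightarrow> partial_deriv i f x = 0"
  shows "(\<integral>x. partial_deriv i f x \<partial>lebesgue) = 0"
proof -
  define e :: "real^'n" where "e = axis i 1"
  define q where "q = (\<lambda>n x. (f (x + (1 / real (Suc n)) *\<^sub>R e) - f x) / (1 / real (Suc n)))"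
  have cont: "continuous_on UNIV f" and cont': "continuous_on UNIV (partial_deriv i f)"
    using f smooth_continuous smooth_partial_deriv by auto
  obtain B where B: "B \<ge> 0" "\<And>x. \<bar>partial_deriv i f x\<bar> \<le> B"
    using continuous_compact_support_bounded[OF cont' K pf0] by blast
  \<comment> \<open>\<open>K'\<close> is \<open>K\<close> swept backwards along a unit segment in
    direction \<open>e\<close>. It contains the support of every difference quotient, since all step
    sizes are at most 1.\<close>
  define K' where "K' = (\<lambda>(x, t). x - t *\<^sub>R e) ` (K \<times> {0..1::real})"
  have K': "compact K'"
    unfolding K'_def using K by (intro compact_continuous_image compact_Times)
      (auto intro!: continuous_intros simp: split_beta)
  have deriv: "((\<lambda>t. f (x + t *\<^sub>R e)) has_real_derivative partial_deriv i f (x + t *\<^sub>R e)) (at t)" for x t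
  proof -
    have "((\<lambda>t. x + t *\<^sub>R e) has_derivative (\<lambda>h. h *\<^sub>R e)) (at t)"
      by (auto intro!: derivative_eq_intros)
    from has_derivative_compose[OF this has_derivative_frechet[OF smooth_differentiable[OF f]]]
    have "((\<lambda>t. f (x + t *\<^sub>R e)) has_derivative
       (\<lambda>h. frechet_derivative f (at (x + t *\<^sub>R e)) (h *\<^sub>R e))) (at t)" .
    moreover have "frechet_derivative f (at (x + t *\<^sub>R e)) (h *\<^sub>R e) = partial_deriv i f (x + t *\<^sub>R e) * h" for h
      using linear_cmul[OF linear_frechet_derivative[OF smooth_differentiable[OF f]]]
      by (simp add: partial_deriv_def e_def mult.commute)
    ultimately show ?thesis by (simp add: has_field_derivative_def)
  qed
  have q_bound: "\<bar>q n x\<bar> \<le> B * indicator K' x" for n x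
  proof (cases "x \<in> K'")
    case True
    \<comment> \<open>By the mean value theorem the quotient is a value of the partial derivative,
      hence bounded by \<open>B\<close>.\<close>
    have "\<exists>z>0. z < 1 / real (Suc n) \<and> f (x + (1 / real (Suc n)) *\<^sub>R e) - f (x + 0 *\<^sub>R e) =
      (1 / real (Suc n) - 0) * partial_deriv i f (x + z *\<^sub>R e)"
      by (rule MVT2) (auto intro: deriv)
    then obtain z where "f (x + (1 / real (Suc n)) *\<^sub>R e) - f x =
      (1 / real (Suc n)) * partial_deriv i f (x + z *\<^sub>R e)" by auto
    then have "q n x = partial_deriv i f (x + z *\<^sub>R e)" by (simp add: q_def del: of_nat_Suc)
    with B True show ?thesis by simp
  next
    case False
    have "x + t *\<^sub>R e \<notin> K" if "t \<in> {0..1}" for t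
    proof
      assume "x + t *\<^sub>R e \<in> K"
      then have "(x + t *\<^sub>R e) - t *\<^sub>R e \<in> K'" unfolding K'_def using that by force
      with False show False by simp
    qed
    from this[of 0] this[of "1 / real (Suc n)"] have "f x = 0" "f (x + (1 / real (Suc n)) *\<^sub>R e) = 0"
      using f0 by auto
    then show ?thesis by (simp add: q_def False)
  qed
  have K'm: "K' \<in> sets lebesgue" "emeasure lebesgue K' < \<infinity>"
    using lmeasurable_compact[OF K'] by (auto simp: fmeasurable_def)
  have q_cont: "continuous_on UNIV (q n)" for n
    unfolding q_def by (intro continuous_intros continuous_on_compose2[OF cont]) auto
  have "(\<lambda>n. \<integral>x. q n x \<partial>lebesgue) \<longlonglongrightarrow> (\<integral>x. partial_deriv i f x \<partial>lebesgue)"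
  proof (rule integral_dominated_convergence)
    show "partial_deriv i f \<in> borel_measurable lebesgue" "\<And>n. q n \<in> borel_measurable lebesgue"
      using cont' q_cont by (auto intro: continuous_lebesgue_measurable)
    show "integrable lebesgue (\<lambda>x. B * indicator K' x)"
      using K'm by (intro integrable_mult_right integrable_real_indicator)
    show "AE x in lebesgue. norm (q n x) \<le> B * indicator K' x" for n
      using q_bound by simp
    have "(\<lambda>n. q n x) \<longlonglongrightarrow> partial_deriv i f x" for x
    proof -
      have "((\<lambda>h. (f (x + h *\<^sub>R e) - f x) / h) \<longlongrightarrow> partial_deriv i f x) (at 0)"
        using deriv[of x 0] by (simp add: DERIV_def)
      moreover have "filterlim (\<lambda>n. 1 / real (Suc n)) (at 0) sequentially"
        unfolding filterlim_at using LIMSEQ_inverse_real_of_nat by (simp add: inverse_eq_divide)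
      ultimately show ?thesis
        unfolding q_def by (rule filterlim_compose)
    qed
    then show "AE x in lebesgue. (\<lambda>n. q n x) \<longlonglongrightarrow> partial_deriv i f x" by simp
  qed
  moreover have "(\<integral>x. q n x \<partial>lebesgue) = 0" for n
  proof -
    let ?h = "1 / real (Suc n)"
    have fm: "f \<in> borel_measurable lebesgue" using cont by (rule continuous_lebesgue_measurable)
    have fi: "integrable lebesgue f" using integrable_continuous_compact_support[OF K cont f0] .
    have "integrable lebesgue (\<lambda>x. f (x + ?h *\<^sub>R e))"
      using lebesgue_integrable_affine_iff[of 1 f "?h *\<^sub>R e"] fm fi by (simp add: add.commute)
    moreover have "(\<integral>x. f (x + ?h *\<^sub>R e) \<partial>lebesgue) = (\<integral>x. f x \<partial>lebesgue)"
      using lebesgue_integral_affine[of 1 f "?h *\<^sub>R e"] fm by (simp add: add.commute)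
    ultimately show ?thesis
      unfolding q_def using fi by (simp del: of_nat_Suc)
  qed
  ultimately show ?thesis by (simp add: LIMSEQ_const_iff)
qed

text \<open>The product rule, integrated: the product of \<open>f\<close> and \<open>g\<close> has
  compact support as soon as \<open>f\<close> has.\<close>

lemma integration_by_parts:
  fixes f g :: "real^'n \<Rightarrow> real"
  assumes f: "smooth f" and g: "smooth g" and K: "compact K" and f0: "\<And>x. x \<notin> K \<Longrightarrow> f x = 0"
    and pf0: "\<And>x. x \<notin> K \<Longrightarrow> partial_deriv i f x = 0"
  shows "(\<integral>x. f x * partial_deriv i g x \<partial>lebesgue) = - (\<integral>x. partial_deriv i f x * g x \<partial>lebesgue)"
proof -
  have eq: "partial_deriv i (\<lambda>x. f x * g x) = (\<lambda>x. f x * partial_deriv i g x + partial_deriv i f x * g x)"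
    using f g by (intro partial_deriv_mult allI smooth_differentiable)
  have "(\<integral>x. partial_deriv i (\<lambda>x. f x * g x) x \<partial>lebesgue) = 0"
  proof (rule integral_partial_deriv_eq_zero[OF smooth_mult[OF f g] K])
    show "f x * g x = 0" "partial_deriv i (\<lambda>x. f x * g x) x = 0" if "x \<notin> K" for x
      unfolding eq using f0[OF that] pf0[OF that] by auto
  qed
  moreover have "integrable lebesgue (\<lambda>x. f x * partial_deriv i g x)"
    by (rule integrable_continuous_compact_support[OF K])
       (auto intro!: smooth_continuous smooth_mult smooth_partial_deriv f g simp: f0)
  moreover have "integrable lebesgue (\<lambda>x. partial_deriv i f x * g x)"
    by (rule integrable_continuous_compact_support[OF K])
       (auto intro!: smooth_continuous smooth_mult smooth_partial_deriv f g simp: pf0)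
  ultimately show ?thesis unfolding eq by simp
qed

section \<open>Weak gradients of smooth functions, restriction and linear combinations\<close>

definition gradient :: "(real^'n \<Rightarrow> real) \<Rightarrow> real^'n \<Rightarrow> real^'n" where
  "gradient f x = (\<chi> i. partial_deriv i f x)"

lemma gradient_nth [simp]: "gradient f x $ i = partial_deriv i f x"
  by (simp add: gradient_def)

lemma continuous_gradient: "smooth f \<Longrightarrow> continuous_on UNIV (gradient f)"
  unfolding gradient_def by (intro continuous_on_vec_lambda smooth_continuous smooth_partial_deriv)

lemma integral_lebesgue_on_support:
  fixes f :: "'a::euclidean_space \<Rightarrow> 'b::euclidean_space"
  assumes "S \<in> sets lebesgue" "\<And>x. x \<notin> S \<Longrightarrow> f x = 0"
  shows "integral\<^sup>L (lebesgue_on S) f = integral\<^sup>L lebesgue f"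
proof -
  have "integral\<^sup>L lebesgue f = integral\<^sup>L lebesgue (\<lambda>x. if x \<in> S then f x else 0)"
    using assms(2) by (intro Bochner_Integration.integral_cong) auto
  then show ?thesis using Lebesgue_Measure.integral_restrict_UNIV[OF assms(1), of f] by simp
qed

text \<open>Taking \<open>\<phi>\<close> on the whole space covers the test functions of every
  subset. No boundary term arises, because \<open>\<psi>\<close> is supported inside
  \<open>\<Omega>\<close> and all integrals may be taken over the whole space.\<close>

lemma test_function_weak_gradient:
  assumes \<phi>: "\<phi> \<in> test_functions UNIV" and \<Omega>: "open \<Omega>"
  shows "has_weak_gradient \<Omega> \<phi> (gradient \<phi>)"
  unfolding has_weak_gradient_def
proof (intro conjI ballI allI)
  obtain K where K: "smooth \<phi>" "compact K" "\<And>x. x \<notin> K \<Longrightarrow> \<phi> x = 0"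
      "\<And>x i. x \<notin> K \<Longrightarrow> partial_deriv i \<phi> x = 0"
    using \<phi> by (rule test_functionE) blast
  show "\<phi> \<in> L1_loc \<Omega>" "gradient \<phi> \<in> L1_loc \<Omega>"
    using K by (auto intro: continuous_L1_loc smooth_continuous continuous_gradient)
  fix \<psi> i assume "\<psi> \<in> test_functions \<Omega>"
  then obtain L where L: "smooth \<psi>" "compact L" "L \<subseteq> \<Omega>" "\<And>x. x \<notin> L \<Longrightarrow> \<psi> x = 0"
    "\<And>x i. x \<notin> L \<Longrightarrow> partial_deriv i \<psi> x = 0"
    by (rule test_functionE) blast
  have \<Omega>': "\<Omega> \<in> sets lebesgue" using \<Omega> by auto
  have "(\<integral>x. \<phi> x * partial_deriv i \<psi> x \<partial>lebesgue_on \<Omega>) = (\<integral>x. \<phi> x * partial_deriv i \<psi> x \<partial>lebesgue)"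
    using L by (intro integral_lebesgue_on_support \<Omega>') auto
  also have "\<dots> = - (\<integral>x. partial_deriv i \<phi> x * \<psi> x \<partial>lebesgue)"
    by (rule integration_by_parts[OF K(1) L(1) K(2-4)])
  also have "(\<integral>x. partial_deriv i \<phi> x * \<psi> x \<partial>lebesgue) = (\<integral>x. gradient \<phi> x $ i * \<psi> x \<partial>lebesgue_on \<Omega>)"
    unfolding gradient_nth
    by (rule integral_lebesgue_on_support[symmetric, OF \<Omega>']) (use L in auto)
  finally show "(\<integral>x. \<phi> x * partial_deriv i \<psi> x \<partial>lebesgue_on \<Omega>) =
      - (\<integral>x. gradient \<phi> x $ i * \<psi> x \<partial>lebesgue_on \<Omega>)" .
qed

lemma test_functions_mono: "\<phi> \<in> test_functions \<Omega> \<Longrightarrow> \<Omega> \<subseteq> \<Omega>' \<Longrightarrow> \<phi> \<in> test_functions \<Omega>'"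
  by (auto simp: test_functions_iff)

lemma L1_loc_mono: "u \<in> L1_loc \<Omega> \<Longrightarrow> \<Omega>' \<subseteq> \<Omega> \<Longrightarrow> u \<in> L1_loc \<Omega>'"
  unfolding L1_loc_def by (auto intro: measurable_restrict_mono)

text \<open>Test functions of the smaller set are test functions of the larger one, and their
  support makes the integrals over both sets agree.\<close>

lemma weak_gradient_restrict:
  assumes w: "has_weak_gradient \<Omega> u G" and o: "open \<Omega>" "open \<Omega>'" "\<Omega>' \<subseteq> \<Omega>"
  shows "has_weak_gradient \<Omega>' u G"
  unfolding has_weak_gradient_def
proof (intro conjI ballI allI)
  show "u \<in> L1_loc \<Omega>'" "G \<in> L1_loc \<Omega>'"
    using has_weak_gradientD(1,2)[OF w] L1_loc_mono o(3) by auto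
  fix \<psi> i assume \<psi>: "\<psi> \<in> test_functions \<Omega>'"
  then obtain L where L: "L \<subseteq> \<Omega>'" "\<And>x. x \<notin> L \<Longrightarrow> \<psi> x = 0" "\<And>x i. x \<notin> L \<Longrightarrow> partial_deriv i \<psi> x = 0"
    by (rule test_functionE) blast
  have m: "\<Omega> \<in> sets lebesgue" "\<Omega>' \<in> sets lebesgue" using o by auto
  have eq: "integral\<^sup>L (lebesgue_on \<Omega>') f = integral\<^sup>L (lebesgue_on \<Omega>) f"
    if "\<And>x. x \<notin> L \<Longrightarrow> f x = 0" for f :: "_ \<Rightarrow> real"
  proof -
    have "\<And>x. x \<notin> \<Omega> \<Longrightarrow> f x = 0" "\<And>x. x \<notin> \<Omega>' \<Longrightarrow> f x = 0" using that L(1) o(3) by blast+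
    then show ?thesis using integral_lebesgue_on_support m by metis
  qed
  show "(\<integral>x. u x * partial_deriv i \<psi> x \<partial>lebesgue_on \<Omega>') = - (\<integral>x. G x $ i * \<psi> x \<partial>lebesgue_on \<Omega>')"
    using has_weak_gradientD(3)[OF w test_functions_mono[OF \<psi> o(3)], of i] L(2,3)
    by (simp add: eq)
qed

lemma L1_loc_linear:
  fixes f g :: "real^'n \<Rightarrow> 'b::euclidean_space"
  assumes "f \<in> L1_loc \<Omega>" "g \<in> L1_loc \<Omega>"
  shows "(\<lambda>x. a *\<^sub>R f x + b *\<^sub>R g x) \<in> L1_loc \<Omega>"
  using assms unfolding L1_loc_def by auto

lemma weak_gradient_linear:
  assumes u: "has_weak_gradient \<Omega> u G" and v: "has_weak_gradient \<Omega> v H" and \<Omega>: "open \<Omega>"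
  shows "has_weak_gradient \<Omega> (\<lambda>x. a * u x + b * v x) (\<lambda>x. a *\<^sub>R G x + b *\<^sub>R H x)"
  unfolding has_weak_gradient_def
proof (intro conjI ballI allI)
  note L1 = has_weak_gradientD(1,2)[OF u] has_weak_gradientD(1,2)[OF v]
  show "(\<lambda>x. a * u x + b * v x) \<in> L1_loc \<Omega>"
    using L1_loc_linear[OF L1(1,3), of a b] by simp
  show "(\<lambda>x. a *\<^sub>R G x + b *\<^sub>R H x) \<in> L1_loc \<Omega>"
    using L1_loc_linear[OF L1(2,4)] .
  fix \<psi> i assume \<psi>: "\<psi> \<in> test_functions \<Omega>"
  then obtain K where K: "smooth \<psi>" "compact K" "K \<subseteq> \<Omega>" "\<And>x. x \<notin> K \<Longrightarrow> \<psi> x = 0"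
    "\<And>x i. x \<notin> K \<Longrightarrow> partial_deriv i \<psi> x = 0"
    by (rule test_functionE) blast
  note int = L1_loc_integrable_continuous[OF _ \<Omega> K(2,3)]
  have i1: "integrable (lebesgue_on \<Omega>) (\<lambda>x. w x * partial_deriv i \<psi> x)" if "w \<in> L1_loc \<Omega>" for w
    using K by (intro int[OF that] smooth_continuous smooth_partial_deriv) auto
  have i2: "integrable (lebesgue_on \<Omega>) (\<lambda>x. W x $ i * \<psi> x)" if "W \<in> L1_loc \<Omega>" for W :: "real^'a \<Rightarrow> real^'a"
    by (rule int[OF L1_loc_component[OF that] smooth_continuous[OF K(1)] K(4)])
  have "(\<integral>x. (a * u x + b * v x) * partial_deriv i \<psi> x \<partial>lebesgue_on \<Omega>) =
     (\<integral>x. a * (u x * partial_deriv i \<psi> x) + b * (v x * partial_deriv i \<psi> x) \<partial>lebesgue_on \<Omega>)"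
    by (simp add: algebra_simps)
  also have "\<dots> = a * (\<integral>x. u x * partial_deriv i \<psi> x \<partial>lebesgue_on \<Omega>)
      + b * (\<integral>x. v x * partial_deriv i \<psi> x \<partial>lebesgue_on \<Omega>)"
    using i1[OF L1(1)] i1[OF L1(3)] by simp
  also have "\<dots> = - (a * (\<integral>x. G x $ i * \<psi> x \<partial>lebesgue_on \<Omega>) + b * (\<integral>x. H x $ i * \<psi> x \<partial>lebesgue_on \<Omega>))"
    using has_weak_gradientD(3)[OF u \<psi>, of i] has_weak_gradientD(3)[OF v \<psi>, of i] by simp
  also have "\<dots> = - (\<integral>x. a * (G x $ i * \<psi> x) + b * (H x $ i * \<psi> x) \<partial>lebesgue_on \<Omega>)"
    using i2[OF L1(2)] i2[OF L1(4)] by simp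
  also have "(\<lambda>x. a * (G x $ i * \<psi> x) + b * (H x $ i * \<psi> x)) = (\<lambda>x. (a *\<^sub>R G x + b *\<^sub>R H x) $ i * \<psi> x)"
    by (simp add: algebra_simps)
  finally show "(\<integral>x. (a * u x + b * v x) * partial_deriv i \<psi> x \<partial>lebesgue_on \<Omega>) =
     - (\<integral>x. (a *\<^sub>R G x + b *\<^sub>R H x) $ i * \<psi> x \<partial>lebesgue_on \<Omega>)" .
qed

text \<open>Frees the energy from the choice made in \<open>weak_gradient\<close>: any weak gradient
  at hand agrees almost everywhere with the chosen one.\<close>

lemma energy_eq:
  assumes \<Omega>: "open \<Omega>" and u: "has_weak_gradient \<Omega> u G"
  shows "energy p \<Omega> u = (\<integral>x. norm (G x) powr p \<partial>lebesgue_on \<Omega>)"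
proof -
  have w: "has_weak_gradient \<Omega> u (weak_gradient \<Omega> u)"
    unfolding weak_gradient_def by (rule someI[of "has_weak_gradient \<Omega> u", OF u])
  have m: "G \<in> borel_measurable (lebesgue_on \<Omega>)" "weak_gradient \<Omega> u \<in> borel_measurable (lebesgue_on \<Omega>)"
    using has_weak_gradientD(2)[OF u] has_weak_gradientD(2)[OF w] by (auto simp: L1_loc_def)
  have "AE x in lebesgue_on \<Omega>. weak_gradient \<Omega> u x = G x"
    by (rule weak_gradient_unique[OF \<Omega> w u])
  then show ?thesis
    unfolding energy_def using m by (intro integral_cong_AE) (auto elim: eventually_mono)
qed

section \<open>The Sobolev modular\<close>

text \<open>The norm of the sum is at most twice the larger norm. This crude bound stands in for the
  triangle inequality in L^p, as only convergence to 0, boundedness and membership are derived from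
  it.\<close>

lemma norm_add_powr_le:
  fixes x y :: "'a::real_normed_vector"
  assumes "p \<ge> 0"
  shows "norm (x + y) powr p \<le> 2 powr p * (norm x powr p + norm y powr p)"
proof -
  have "norm (x + y) powr p \<le> (2 * max (norm x) (norm y)) powr p"
    using norm_triangle_ineq[of x y] assms by (intro powr_mono2) auto
  also have "\<dots> = 2 powr p * max (norm x) (norm y) powr p" by (simp add: powr_mult)
  also have "max (norm x) (norm y) powr p \<le> norm x powr p + norm y powr p"
    by (simp add: max_def)
  finally show ?thesis by simp
qed

lemma
  fixes f g :: "real^'n \<Rightarrow> 'b::euclidean_space"
  assumes p: "p \<ge> 0" and f: "f \<in> Lp p \<Omega>" and g: "g \<in> Lp p \<Omega>"
  shows Lp_linear: "(\<lambda>x. a *\<^sub>R f x + b *\<^sub>R g x) \<in> Lp p \<Omega>"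
    and Lp_linear_integral_le: "(\<integral>x. norm (a *\<^sub>R f x + b *\<^sub>R g x) powr p \<partial>lebesgue_on \<Omega>) \<le>
      2 powr p * (\<bar>a\<bar> powr p * (\<integral>x. norm (f x) powr p \<partial>lebesgue_on \<Omega>)
         + \<bar>b\<bar> powr p * (\<integral>x. norm (g x) powr p \<partial>lebesgue_on \<Omega>))"
proof -
  have m: "f \<in> borel_measurable (lebesgue_on \<Omega>)" "g \<in> borel_measurable (lebesgue_on \<Omega>)"
    and i: "integrable (lebesgue_on \<Omega>) (\<lambda>x. norm (f x) powr p)"
       "integrable (lebesgue_on \<Omega>) (\<lambda>x. norm (g x) powr p)"
    using f g by (auto simp: Lp_def)
  have le: "norm (a *\<^sub>R f x + b *\<^sub>R g x) powr p \<le>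
      2 powr p * (\<bar>a\<bar> powr p * norm (f x) powr p + \<bar>b\<bar> powr p * norm (g x) powr p)" for x
    using norm_add_powr_le[OF p, of "a *\<^sub>R f x" "b *\<^sub>R g x"] by (simp add: powr_mult)
  have i': "integrable (lebesgue_on \<Omega>) (\<lambda>x. 2 powr p * (\<bar>a\<bar> powr p * norm (f x) powr p + \<bar>b\<bar> powr p * norm (g x) powr p))"
    using i by simp
  have i'': "integrable (lebesgue_on \<Omega>) (\<lambda>x. norm (a *\<^sub>R f x + b *\<^sub>R g x) powr p)"
    by (rule Bochner_Integration.integrable_bound[OF i'])
       (use m le in \<open>auto intro!: order_trans[OF le]\<close>)
  then show "(\<lambda>x. a *\<^sub>R f x + b *\<^sub>R g x) \<in> Lp p \<Omega>"
    using m by (auto simp: Lp_def)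
  have "(\<integral>x. norm (a *\<^sub>R f x + b *\<^sub>R g x) powr p \<partial>lebesgue_on \<Omega>) \<le>
     (\<integral>x. 2 powr p * (\<bar>a\<bar> powr p * norm (f x) powr p + \<bar>b\<bar> powr p * norm (g x) powr p) \<partial>lebesgue_on \<Omega>)"
    by (rule integral_mono[OF i'' i' le])
  then show "(\<integral>x. norm (a *\<^sub>R f x + b *\<^sub>R g x) powr p \<partial>lebesgue_on \<Omega>) \<le>
      2 powr p * (\<bar>a\<bar> powr p * (\<integral>x. norm (f x) powr p \<partial>lebesgue_on \<Omega>)
         + \<bar>b\<bar> powr p * (\<integral>x. norm (g x) powr p \<partial>lebesgue_on \<Omega>))"
    using i by simp
qed

text \<open>The p-th power of \<open>W1p_norm\<close>. Dropping the root leaves convergence to 0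
  unchanged and lets estimates of the two integrals simply be added.\<close>

definition sobolev_modular :: "real \<Rightarrow> (real^'n) set \<Rightarrow> (real^'n \<Rightarrow> real) \<Rightarrow> real" where
  "sobolev_modular p \<Omega> u = (\<integral>x. \<bar>u x\<bar> powr p \<partial>lebesgue_on \<Omega>) + energy p \<Omega> u"

lemma energy_nonneg: "energy p \<Omega> u \<ge> 0"
  unfolding energy_def by simp

lemma sobolev_modular_nonneg: "sobolev_modular p \<Omega> u \<ge> 0"
  unfolding sobolev_modular_def by (intro add_nonneg_nonneg energy_nonneg) simp

lemma energy_le_sobolev_modular: "energy p \<Omega> u \<le> sobolev_modular p \<Omega> u"
  unfolding sobolev_modular_def by simp

text \<open>Transfers the limits in the definitions of \<open>W1p_0\<close> and
  \<open>odd_sphere_maps\<close> to the modular; the powers with exponents p and 1/p both preserve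
  convergence to 0.\<close>

lemma W1p_dist_tendsto_0_iff:
  assumes p: "p > 0"
  shows "((\<lambda>z. W1p_dist p \<Omega> (f z) (g z)) \<longlongrightarrow> 0) F \<longleftrightarrow>
         ((\<lambda>z. sobolev_modular p \<Omega> (\<lambda>x. f z x - g z x)) \<longlongrightarrow> 0) F"
    (is "?L \<longleftrightarrow> ?R")
proof -
  let ?m = "\<lambda>z. sobolev_modular p \<Omega> (\<lambda>x. f z x - g z x)"
  have eq: "(\<lambda>z. W1p_dist p \<Omega> (f z) (g z)) = (\<lambda>z. ?m z powr (1 / p))"
    by (simp add: W1p_dist_def W1p_norm_def sobolev_modular_def)
  have eq': "?m = (\<lambda>z. (?m z powr (1 / p)) powr p)"
    using p by (simp add: powr_powr sobolev_modular_nonneg)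
  show ?thesis
  proof
    assume ?R then show ?L unfolding eq
      using p by (intro tendsto_zero_powrI[where b="1/p"]) (auto simp: sobolev_modular_nonneg)
  next
    assume ?L
    then have "((\<lambda>z. (?m z powr (1 / p)) powr p) \<longlongrightarrow> 0) F"
      unfolding eq by (rule tendsto_zero_powrI[OF _ tendsto_const]) (use p in auto)
    then show ?R using eq' by simp
  qed
qed

lemma W1pE:
  assumes "u \<in> W1p p \<Omega>" "open \<Omega>"
  obtains G where "u \<in> Lp p \<Omega>" "G \<in> Lp p \<Omega>" "has_weak_gradient \<Omega> u G"
    "energy p \<Omega> u = (\<integral>x. norm (G x) powr p \<partial>lebesgue_on \<Omega>)"
proof -
  from assms(1) obtain G where G: "u \<in> Lp p \<Omega>" "G \<in> Lp p \<Omega>" "has_weak_gradient \<Omega> u G"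
    by (auto simp: W1p_def)
  with energy_eq[OF assms(2) G(3)] that show thesis by blast
qed

lemma
  assumes p: "p \<ge> 0" and \<Omega>: "open \<Omega>" and u: "u \<in> W1p p \<Omega>" and v: "v \<in> W1p p \<Omega>"
  shows W1p_linear: "(\<lambda>x. a * u x + b * v x) \<in> W1p p \<Omega>"
    and sobolev_modular_linear_le: "sobolev_modular p \<Omega> (\<lambda>x. a * u x + b * v x) \<le>
       2 powr p * (\<bar>a\<bar> powr p * sobolev_modular p \<Omega> u + \<bar>b\<bar> powr p * sobolev_modular p \<Omega> v)"
proof -
  obtain G where G: "u \<in> Lp p \<Omega>" "G \<in> Lp p \<Omega>" "has_weak_gradient \<Omega> u G"
    "energy p \<Omega> u = (\<integral>x. norm (G x) powr p \<partial>lebesgue_on \<Omega>)"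
    using u \<Omega> by (rule W1pE)
  obtain H where H: "v \<in> Lp p \<Omega>" "H \<in> Lp p \<Omega>" "has_weak_gradient \<Omega> v H"
    "energy p \<Omega> v = (\<integral>x. norm (H x) powr p \<partial>lebesgue_on \<Omega>)"
    using v \<Omega> by (rule W1pE)
  have w: "has_weak_gradient \<Omega> (\<lambda>x. a * u x + b * v x) (\<lambda>x. a *\<^sub>R G x + b *\<^sub>R H x)"
    by (rule weak_gradient_linear[OF G(3) H(3) \<Omega>])
  then show "(\<lambda>x. a * u x + b * v x) \<in> W1p p \<Omega>"
    using Lp_linear[OF p G(1) H(1), of a b] Lp_linear[OF p G(2) H(2), of a b] by (auto simp: W1p_def)
  have "energy p \<Omega> (\<lambda>x. a * u x + b * v x) \<le>
      2 powr p * (\<bar>a\<bar> powr p * energy p \<Omega> u + \<bar>b\<bar> powr p * energy p \<Omega> v)"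
    unfolding energy_eq[OF \<Omega> w] G(4) H(4) by (rule Lp_linear_integral_le[OF p G(2) H(2)])
  moreover have "(\<integral>x. \<bar>a * u x + b * v x\<bar> powr p \<partial>lebesgue_on \<Omega>) \<le>
      2 powr p * (\<bar>a\<bar> powr p * (\<integral>x. \<bar>u x\<bar> powr p \<partial>lebesgue_on \<Omega>)
         + \<bar>b\<bar> powr p * (\<integral>x. \<bar>v x\<bar> powr p \<partial>lebesgue_on \<Omega>))"
    using Lp_linear_integral_le[OF p G(1) H(1), of a b] by simp
  ultimately show "sobolev_modular p \<Omega> (\<lambda>x. a * u x + b * v x) \<le>
       2 powr p * (\<bar>a\<bar> powr p * sobolev_modular p \<Omega> u + \<bar>b\<bar> powr p * sobolev_modular p \<Omega> v)"
    unfolding sobolev_modular_def by (simp add: algebra_simps)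
qed

lemma integrable_lebesgue_imp_on:
  fixes f :: "'a::euclidean_space \<Rightarrow> 'b::euclidean_space"
  assumes "integrable lebesgue f" "S \<in> sets lebesgue"
  shows "integrable (lebesgue_on S) f"
  using integrable_mult_indicator[OF assms(2,1)] assms(2) by (simp add: integrable_restrict_space)

lemma continuous_compact_support_Lp:
  fixes f :: "real^'n \<Rightarrow> 'b::euclidean_space"
  assumes p: "p > 0" and f: "continuous_on UNIV f" "compact K" "\<And>x. x \<notin> K \<Longrightarrow> f x = 0" and \<Omega>: "open \<Omega>"
  shows "f \<in> Lp p \<Omega>"
  unfolding Lp_def
proof (intro CollectI conjI)
  show "f \<in> borel_measurable (lebesgue_on \<Omega>)"
    by (intro measurable_restrict_space1 continuous_lebesgue_measurable f)
  have "integrable lebesgue (\<lambda>x. norm (f x) powr p)"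
    using f p by (intro integrable_continuous_compact_support[of K] continuous_on_powr' continuous_intros) auto
  then show "integrable (lebesgue_on \<Omega>) (\<lambda>x. norm (f x) powr p)"
    using \<Omega> by (intro integrable_lebesgue_imp_on) auto
qed

lemma test_function_W1p:
  assumes p: "p > 0" and \<phi>: "\<phi> \<in> test_functions UNIV" and \<Omega>: "open \<Omega>"
  shows "\<phi> \<in> W1p p \<Omega>" "gradient \<phi> \<in> Lp p \<Omega>"
proof -
  obtain K where K: "smooth \<phi>" "compact K" "\<And>x. x \<notin> K \<Longrightarrow> \<phi> x = 0"
      "\<And>x i. x \<notin> K \<Longrightarrow> partial_deriv i \<phi> x = 0"
    using \<phi> by (rule test_functionE) blast
  have "\<phi> \<in> Lp p \<Omega>"
    using K by (intro continuous_compact_support_Lp[OF p _ _ _ \<Omega>, of _ K] smooth_continuous) auto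
  moreover show g: "gradient \<phi> \<in> Lp p \<Omega>"
    using K by (intro continuous_compact_support_Lp[OF p _ _ _ \<Omega>, of _ K] continuous_gradient)
      (auto simp: vec_eq_iff)
  ultimately show "\<phi> \<in> W1p p \<Omega>"
    using test_function_weak_gradient[OF \<phi> \<Omega>] by (auto simp: W1p_def)
qed

lemma W1p_0E:
  assumes "u \<in> W1p_0 p \<Omega>" "p > 0"
  obtains \<phi> where "u \<in> W1p p \<Omega>" "\<And>n. \<phi> n \<in> test_functions \<Omega>"
    "(\<lambda>n. sobolev_modular p \<Omega> (\<lambda>x. \<phi> n x - u x)) \<longlonglongrightarrow> 0"
  using assms W1p_dist_tendsto_0_iff[where F=sequentially and g="\<lambda>_. u", OF assms(2)]
  by (auto simp: W1p_0_def)

lemma W1p_0I: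
  assumes "u \<in> W1p p \<Omega>" "p > 0" "\<And>n. \<phi> n \<in> test_functions \<Omega>"
    "(\<lambda>n. sobolev_modular p \<Omega> (\<lambda>x. \<phi> n x - u x)) \<longlonglongrightarrow> 0"
  shows "u \<in> W1p_0 p \<Omega>"
  using assms W1p_dist_tendsto_0_iff[where F=sequentially and g="\<lambda>_. u", OF assms(2)]
  by (auto simp: W1p_0_def)

lemma sobolev_modular_zero:
  assumes "p > 0" "open \<Omega>" shows "sobolev_modular p \<Omega> (\<lambda>x. 0) = 0"
proof -
  have "(\<lambda>x. 0) \<in> test_functions UNIV"
    by (rule test_function_intro[of _ "{}"]) (auto simp: smooth_const)
  from energy_eq[OF assms(2) test_function_weak_gradient[OF this assms(2)], of p]
  have "energy p \<Omega> (\<lambda>x. 0) = 0"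
    using assms by (simp add: gradient_def zero_vec_def[symmetric])
  then show ?thesis by (simp add: sobolev_modular_def)
qed

lemma test_function_W1p_0:
  assumes "p > 0" "\<phi> \<in> test_functions \<Omega>" "open \<Omega>"
  shows "\<phi> \<in> W1p_0 p \<Omega>"
proof (rule W1p_0I[where \<phi> = "\<lambda>_. \<phi>"])
  show "\<phi> \<in> W1p p \<Omega>" using assms test_function_W1p test_functions_mono by blast
  show "(\<lambda>n. sobolev_modular p \<Omega> (\<lambda>x. \<phi> x - \<phi> x)) \<longlonglongrightarrow> 0"
    using sobolev_modular_zero[OF assms(1,3)] by simp
qed (use assms in auto)

lemma test_functions_linear:
  assumes "\<phi> \<in> test_functions \<Omega>" "\<psi> \<in> test_functions \<Omega>"
  shows "(\<lambda>x. a * \<phi> x + b * \<psi> x) \<in> test_functions \<Omega>"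
proof -
  obtain K where K: "smooth \<phi>" "compact K" "K \<subseteq> \<Omega>" "\<And>x. x \<notin> K \<Longrightarrow> \<phi> x = 0"
    using assms(1) by (rule test_functionE) blast
  obtain L where L: "smooth \<psi>" "compact L" "L \<subseteq> \<Omega>" "\<And>x. x \<notin> L \<Longrightarrow> \<psi> x = 0"
    using assms(2) by (rule test_functionE) blast
  show ?thesis
    by (rule test_function_intro[of _ "K \<union> L"])
       (use K L in \<open>auto intro!: smooth_add smooth_mult smooth_const compact_Un\<close>)
qed

text \<open>The same linear combination of the approximating test functions approximates, by the
  quasi-triangle inequality.\<close>

lemma W1p_0_linear:
  assumes p: "p > 0" and \<Omega>: "open \<Omega>" and u: "u \<in> W1p_0 p \<Omega>" and v: "v \<in> W1p_0 p \<Omega>"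
  shows "(\<lambda>x. a * u x + b * v x) \<in> W1p_0 p \<Omega>"
proof -
  obtain \<phi> where \<phi>: "u \<in> W1p p \<Omega>" "\<And>n. \<phi> n \<in> test_functions \<Omega>"
    "(\<lambda>n. sobolev_modular p \<Omega> (\<lambda>x. \<phi> n x - u x)) \<longlonglongrightarrow> 0"
    using u p by (rule W1p_0E) blast
  obtain \<psi> where \<psi>: "v \<in> W1p p \<Omega>" "\<And>n. \<psi> n \<in> test_functions \<Omega>"
    "(\<lambda>n. sobolev_modular p \<Omega> (\<lambda>x. \<psi> n x - v x)) \<longlonglongrightarrow> 0"
    using v p by (rule W1p_0E) blast
  have p0: "p \<ge> 0" using p by simp
  have W: "\<phi> n \<in> W1p p \<Omega>" "\<psi> n \<in> W1p p \<Omega>" for n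
    using test_function_W1p_0[OF p \<phi>(2) \<Omega>, of n] test_function_W1p_0[OF p \<psi>(2) \<Omega>, of n]
    by (simp_all add: W1p_0_def)
  have W': "(\<lambda>x. \<phi> n x - u x) \<in> W1p p \<Omega>" "(\<lambda>x. \<psi> n x - v x) \<in> W1p p \<Omega>" for n
    using W1p_linear[OF p0 \<Omega> W(1) \<phi>(1), where a=1 and b="-1"] W1p_linear[OF p0 \<Omega> W(2) \<psi>(1), where a=1 and b="-1"]
    by simp_all
  show ?thesis
  proof (rule W1p_0I[where \<phi>="\<lambda>n x. a * \<phi> n x + b * \<psi> n x"])
    show "(\<lambda>x. a * u x + b * v x) \<in> W1p p \<Omega>"
      by (rule W1p_linear[OF p0 \<Omega> \<phi>(1) \<psi>(1)])
    show "(\<lambda>x. a * \<phi> n x + b * \<psi> n x) \<in> test_functions \<Omega>" for n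
      by (rule test_functions_linear[OF \<phi>(2) \<psi>(2)])
    show "(\<lambda>n. sobolev_modular p \<Omega> (\<lambda>x. a * \<phi> n x + b * \<psi> n x - (a * u x + b * v x))) \<longlonglongrightarrow> 0"
    proof (rule tendsto_sandwich[OF _ _ tendsto_const])
      show "\<forall>\<^sub>F n in sequentially. 0 \<le> sobolev_modular p \<Omega> (\<lambda>x. a * \<phi> n x + b * \<psi> n x - (a * u x + b * v x))"
        by (simp add: sobolev_modular_nonneg)
      have eq: "(\<lambda>x. a * \<phi> n x + b * \<psi> n x - (a * u x + b * v x)) =
          (\<lambda>x. a * (\<phi> n x - u x) + b * (\<psi> n x - v x))" for n
        by (simp add: algebra_simps)
      show "\<forall>\<^sub>F n in sequentially. sobolev_modular p \<Omega> (\<lambda>x. a * \<phi> n x + b * \<psi> n x - (a * u x + b * v x)) \<le>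
         2 powr p * (\<bar>a\<bar> powr p * sobolev_modular p \<Omega> (\<lambda>x. \<phi> n x - u x) +
            \<bar>b\<bar> powr p * sobolev_modular p \<Omega> (\<lambda>x. \<psi> n x - v x))"
        unfolding eq using sobolev_modular_linear_le[OF p0 \<Omega> W'] by simp
      have "(\<lambda>n. 2 powr p * (\<bar>a\<bar> powr p * sobolev_modular p \<Omega> (\<lambda>x. \<phi> n x - u x) +
            \<bar>b\<bar> powr p * sobolev_modular p \<Omega> (\<lambda>x. \<psi> n x - v x))) \<longlonglongrightarrow>
           2 powr p * (\<bar>a\<bar> powr p * 0 + \<bar>b\<bar> powr p * 0)"
        by (intro tendsto_intros \<phi>(3) \<psi>(3))
      then show "(\<lambda>n. 2 powr p * (\<bar>a\<bar> powr p * sobolev_modular p \<Omega> (\<lambda>x. \<phi> n x - u x) +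
            \<bar>b\<bar> powr p * sobolev_modular p \<Omega> (\<lambda>x. \<psi> n x - v x))) \<longlonglongrightarrow> 0" by simp
    qed
  qed (rule p)
qed

section \<open>Extension by zero\<close>

text \<open>Beyond \<open>\<delta>\<close> the power \<open>t powr (1 - p)\<close> is at most
  \<open>\<delta> powr (1 - p)\<close>. Integrated over a set of finite measure, this does the work
  of Hoelder's inequality: it bounds the L^1 norm by a multiple of the p-th power integral plus an
  arbitrarily small constant.\<close>

lemma le_add_powr:
  fixes t \<delta> p :: real
  assumes "t \<ge> 0" "\<delta> > 0" "p \<ge> 1"
  shows "t \<le> \<delta> + \<delta> powr (1 - p) * t powr p"
proof (cases "t \<le> \<delta>")
  case False
  then have t: "t > 0" using assms by simp
  have "t = t powr (1 - p) * t powr p" using t by (simp add: powr_add[symmetric])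
  also have "\<dots> \<le> \<delta> powr (1 - p) * t powr p"
    using False assms by (intro mult_right_mono powr_mono2') auto
  finally show ?thesis using assms by linarith
qed (use assms in \<open>simp add: add_increasing2\<close>)

lemma
  fixes f :: "real^'n \<Rightarrow> 'b::euclidean_space"
  assumes D: "D \<in> lmeasurable" and p: "p \<ge> 1" and f: "f \<in> Lp p D"
  shows Lp_integrable: "integrable (lebesgue_on D) f"
    and integral_norm_le_powr: "\<delta> > 0 \<Longrightarrow> (\<integral>x. norm (f x) \<partial>lebesgue_on D) \<le>
      \<delta> * measure lebesgue D + \<delta> powr (1 - p) * (\<integral>x. norm (f x) powr p \<partial>lebesgue_on D)"
proof -
  interpret finite_measure "lebesgue_on D" using D by (rule finite_measure_lebesgue_on)
  have m: "f \<in> borel_measurable (lebesgue_on D)"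
    and i: "integrable (lebesgue_on D) (\<lambda>x. norm (f x) powr p)"
    using f by (auto simp: Lp_def)
  have i': "integrable (lebesgue_on D) (\<lambda>x. \<delta> + \<delta> powr (1 - p) * norm (f x) powr p)" for \<delta> :: real
    using i by simp
  have le: "norm (f x) \<le> \<delta> + \<delta> powr (1 - p) * norm (f x) powr p" if "\<delta> > 0" for \<delta> x
    using that p by (intro le_add_powr) auto
  show int: "integrable (lebesgue_on D) f"
    by (rule Bochner_Integration.integrable_bound[OF i'[of 1] m])
       (use le[of 1] in \<open>auto intro!: order_trans[OF le[of 1]]\<close>)
  assume \<delta>: "\<delta> > 0"
  have "(\<integral>x. norm (f x) \<partial>lebesgue_on D) \<le> (\<integral>x. \<delta> + \<delta> powr (1 - p) * norm (f x) powr p \<partial>lebesgue_on D)"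
    using int by (intro integral_mono i' le \<delta>) auto
  also have "\<dots> = \<delta> * measure lebesgue D + \<delta> powr (1 - p) * (\<integral>x. norm (f x) powr p \<partial>lebesgue_on D)"
    using i D by (simp add: measure_restrict_space)
  finally show "(\<integral>x. norm (f x) \<partial>lebesgue_on D) \<le>
      \<delta> * measure lebesgue D + \<delta> powr (1 - p) * (\<integral>x. norm (f x) powr p \<partial>lebesgue_on D)" .
qed

lemma Lp_tendsto_imp_L1_tendsto:
  fixes f :: "nat \<Rightarrow> real^'n \<Rightarrow> 'b::euclidean_space"
  assumes D: "D \<in> lmeasurable" and p: "p \<ge> 1" and f: "\<And>n. f n \<in> Lp p D"
    and lim: "(\<lambda>n. \<integral>x. norm (f n x) powr p \<partial>lebesgue_on D) \<longlonglongrightarrow> 0"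
  shows "(\<lambda>n. \<integral>x. norm (f n x) \<partial>lebesgue_on D) \<longlonglongrightarrow> 0"
proof (rule LIMSEQ_I)
  fix r :: real assume r: "r > 0"
  \<comment> \<open>Chosen to make \<open>\<delta> * measure lebesgue D\<close> less than half of
    \<open>r\<close>; adding 1 keeps the denominator positive for null sets.\<close>
  define \<delta> where "\<delta> = r / (2 * (measure lebesgue D + 1))"
  have M: "measure lebesgue D + 1 > 0" by (simp add: add_nonneg_pos)
  then have \<delta>: "\<delta> > 0" using r by (simp add: \<delta>_def)
  have 1: "\<delta> * measure lebesgue D < r / 2"
    using M r by (simp add: \<delta>_def field_simps)
  have "(\<lambda>n. \<delta> powr (1 - p) * (\<integral>x. norm (f n x) powr p \<partial>lebesgue_on D)) \<longlonglongrightarrow> \<delta> powr (1 - p) * 0"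
    by (intro tendsto_intros lim)
  then have "\<forall>\<^sub>F n in sequentially. \<delta> powr (1 - p) * (\<integral>x. norm (f n x) powr p \<partial>lebesgue_on D) < r / 2"
    using r by (intro order_tendstoD(2)) auto
  then obtain N where N: "\<And>n. n \<ge> N \<Longrightarrow> \<delta> powr (1 - p) * (\<integral>x. norm (f n x) powr p \<partial>lebesgue_on D) < r / 2"
    by (auto simp: eventually_sequentially)
  show "\<exists>N. \<forall>n\<ge>N. norm ((\<integral>x. norm (f n x) \<partial>lebesgue_on D) - 0) < r"
  proof (intro exI allI impI)
    fix n assume "n \<ge> N"
    from N[OF this] 1 integral_norm_le_powr[OF D p f \<delta>, of n]
    show "norm ((\<integral>x. norm (f n x) \<partial>lebesgue_on D) - 0) < r" by simp
  qed
qed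

definition zero_extension :: "'a set \<Rightarrow> ('a \<Rightarrow> 'b::zero) \<Rightarrow> 'a \<Rightarrow> 'b" where
  "zero_extension D f x = (if x \<in> D then f x else 0)"

lemma integrable_bounded_mult:
  fixes f :: "'a::euclidean_space \<Rightarrow> real"
  assumes f: "integrable (lebesgue_on D) f"
    and B: "\<And>x. \<bar>g x\<bar> \<le> B" and g: "g \<in> borel_measurable (lebesgue_on D)"
  shows "integrable (lebesgue_on D) (\<lambda>x. f x * g x)"
proof -
  have le: "\<bar>f x * g x\<bar> \<le> \<bar>B * f x\<bar>" for x
    unfolding abs_mult using B[of x] by (subst mult.commute) (intro mult_right_mono; simp)
  have "integrable (lebesgue_on D) (\<lambda>x. B * f x)"
    using f by simp
  then show ?thesis
    by (rule Bochner_Integration.integrable_bound) (use f g le in auto)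
qed

lemma integral_bounded_mult_tendsto_0:
  fixes f :: "nat \<Rightarrow> 'a::euclidean_space \<Rightarrow> real"
  assumes f: "\<And>n. integrable (lebesgue_on D) (f n)" and lim: "(\<lambda>n. \<integral>x. \<bar>f n x\<bar> \<partial>lebesgue_on D) \<longlonglongrightarrow> 0"
    and B: "\<And>x. \<bar>g x\<bar> \<le> B" and g: "g \<in> borel_measurable (lebesgue_on D)"
  shows "(\<lambda>n. \<integral>x. f n x * g x \<partial>lebesgue_on D) \<longlonglongrightarrow> 0"
proof -
  have le: "\<bar>f n x * g x\<bar> \<le> B * \<bar>f n x\<bar>" for n x
    unfolding abs_mult using B[of x] by (subst mult.commute) (intro mult_right_mono; simp)
  have i: "integrable (lebesgue_on D) (\<lambda>x. B * \<bar>f n x\<bar>)" for n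
    using f by simp
  have int: "integrable (lebesgue_on D) (\<lambda>x. f n x * g x)" for n
    by (rule integrable_bounded_mult[OF f B g])
  have "(\<lambda>n. B * (\<integral>x. \<bar>f n x\<bar> \<partial>lebesgue_on D)) \<longlonglongrightarrow> B * 0"
    by (intro tendsto_intros lim)
  then have lim': "(\<lambda>n. B * (\<integral>x. \<bar>f n x\<bar> \<partial>lebesgue_on D)) \<longlonglongrightarrow> 0" by simp
  show "(\<lambda>n. \<integral>x. f n x * g x \<partial>lebesgue_on D) \<longlonglongrightarrow> 0"
  proof (rule Lim_null_comparison[OF _ lim'], intro always_eventually allI)
    fix n
    have "norm (\<integral>x. f n x * g x \<partial>lebesgue_on D) \<le> (\<integral>x. norm (f n x * g x) \<partial>lebesgue_on D)"
      by (rule integral_norm_bound)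
    also have "\<dots> \<le> (\<integral>x. B * \<bar>f n x\<bar> \<partial>lebesgue_on D)"
      using le int by (intro integral_mono i) auto
    finally show "norm (\<integral>x. f n x * g x \<partial>lebesgue_on D) \<le> B * (\<integral>x. \<bar>f n x\<bar> \<partial>lebesgue_on D)" by simp
  qed
qed

lemma zero_extension_L1_loc:
  fixes f :: "real^'n \<Rightarrow> 'b::euclidean_space"
  assumes D: "D \<in> sets lebesgue" and f: "integrable (lebesgue_on D) f"
  shows "zero_extension D f \<in> L1_loc UNIV" "integrable lebesgue (zero_extension D f)"
proof -
  show i: "integrable lebesgue (zero_extension D f)"
    using f by (simp add: zero_extension_def[abs_def] Lebesgue_Measure.integrable_restrict_UNIV[OF D])
  have "integrable (lebesgue_on K) (zero_extension D f)" if "compact K" for K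
    using i that by (intro integrable_lebesgue_imp_on) (auto intro: lmeasurable_compact fmeasurableD)
  with i show "zero_extension D f \<in> L1_loc UNIV"
    by (auto simp: L1_loc_def lebesgue_on_UNIV_eq)
qed

text \<open>Vanishing boundary values: the gradient of the extension has no singular part because this is
  so for the approximating test functions.\<close>

lemma zero_extension_weak_gradient:
  fixes D :: "(real^'n) set"
  assumes D: "open D" "bounded D" and p: "p \<ge> 1" and u: "u \<in> W1p_0 p D"
    and G: "has_weak_gradient D u G" "G \<in> Lp p D"
  shows "has_weak_gradient UNIV (zero_extension D u) (zero_extension D G)"
  unfolding has_weak_gradient_def
proof (intro conjI ballI allI)
  have p0: "p \<ge> 0" "p > 0" using p by auto
  have Dm: "D \<in> lmeasurable" and D': "D \<in> sets lebesgue"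
    using D by (auto simp: lmeasurable_open)
  obtain \<phi> where \<phi>: "u \<in> W1p p D" "\<And>n. \<phi> n \<in> test_functions D"
    "(\<lambda>n. sobolev_modular p D (\<lambda>x. \<phi> n x - u x)) \<longlonglongrightarrow> 0"
    using u p0(2) by (rule W1p_0E) blast
  have \<phi>': "\<phi> n \<in> test_functions UNIV" for n using \<phi>(2) test_functions_mono by blast
  have uL: "u \<in> Lp p D" using \<phi>(1) by (simp add: W1p_def)
  show "zero_extension D u \<in> L1_loc UNIV" "zero_extension D G \<in> L1_loc UNIV"
    by (intro zero_extension_L1_loc D' Lp_integrable[OF Dm p] uL G)+
  define d where "d = (\<lambda>n x. \<phi> n x - u x)"
  define g where "g = (\<lambda>n x. gradient (\<phi> n) x - G x)"
  have \<phi>L: "\<phi> n \<in> Lp p D" "gradient (\<phi> n) \<in> Lp p D" for n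
    using test_function_W1p[OF p0(2) \<phi>' D(1)] by (auto simp: W1p_def)
  have dL: "d n \<in> Lp p D" and gL: "g n \<in> Lp p D" for n
    unfolding d_def g_def
    using Lp_linear[OF p0(1) \<phi>L(1) uL, where a=1 and b="-1"] Lp_linear[OF p0(1) \<phi>L(2) G(2), where a=1 and b="-1"] by simp_all
  have dg: "has_weak_gradient D (d n) (g n)" for n
    using weak_gradient_linear[OF test_function_weak_gradient[OF \<phi>' D(1)] G(1) D(1), where a=1 and b="-1"]
    by (simp add: d_def g_def)
  have mod: "sobolev_modular p D (d n) = (\<integral>x. \<bar>d n x\<bar> powr p \<partial>lebesgue_on D) + (\<integral>x. norm (g n x) powr p \<partial>lebesgue_on D)" for n
    unfolding sobolev_modular_def energy_eq[OF D(1) dg] ..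
  have lim: "(\<lambda>n. sobolev_modular p D (d n)) \<longlonglongrightarrow> 0" using \<phi>(3) by (simp add: d_def)
  have "(\<lambda>n. \<integral>x. norm (d n x) powr p \<partial>lebesgue_on D) \<longlonglongrightarrow> 0"
    by (rule tendsto_sandwich[OF _ _ tendsto_const lim]) (simp_all add: mod)
  then have d1: "(\<lambda>n. \<integral>x. \<bar>d n x\<bar> \<partial>lebesgue_on D) \<longlonglongrightarrow> 0"
    using Lp_tendsto_imp_L1_tendsto[OF Dm p dL] by simp
  have "(\<lambda>n. \<integral>x. norm (g n x) powr p \<partial>lebesgue_on D) \<longlonglongrightarrow> 0"
    by (rule tendsto_sandwich[OF _ _ tendsto_const lim]) (simp_all add: mod)
  then have g1: "(\<lambda>n. \<integral>x. norm (g n x) \<partial>lebesgue_on D) \<longlonglongrightarrow> 0"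
    by (rule Lp_tendsto_imp_L1_tendsto[OF Dm p gL])
  fix \<psi> i assume \<psi>: "\<psi> \<in> test_functions (UNIV :: (real^'n) set)"
  then obtain K where K: "smooth \<psi>" "compact K" "\<And>x. x \<notin> K \<Longrightarrow> \<psi> x = 0"
      "\<And>x i. x \<notin> K \<Longrightarrow> partial_deriv i \<psi> x = 0"
    by (rule test_functionE) blast
  have c: "continuous_on UNIV \<psi>" "continuous_on UNIV (partial_deriv i \<psi>)"
    using K by (auto intro: smooth_continuous smooth_partial_deriv)
  obtain B where B: "\<And>x. \<bar>\<psi> x\<bar> \<le> B"
    using continuous_compact_support_bounded[OF c(1) K(2,3)] by blast
  obtain B' where B': "\<And>x. \<bar>partial_deriv i \<psi> x\<bar> \<le> B'"
    using continuous_compact_support_bounded[OF c(2) K(2) K(4)] by blast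
  have m: "\<psi> \<in> borel_measurable (lebesgue_on D)" "partial_deriv i \<psi> \<in> borel_measurable (lebesgue_on D)"
    using c by (auto intro!: measurable_restrict_space1 continuous_lebesgue_measurable)
  have gi: "integrable (lebesgue_on D) (g n)" for n by (rule Lp_integrable[OF Dm p gL])
  have gi': "integrable (lebesgue_on D) (\<lambda>x. g n x $ i)" for n
    by (rule integrable_bounded_linear[OF bounded_linear_vec_nth gi])
  have g1': "(\<lambda>n. \<integral>x. \<bar>g n x $ i\<bar> \<partial>lebesgue_on D) \<longlonglongrightarrow> 0"
  proof (rule tendsto_sandwich[OF _ _ tendsto_const g1])
    show "\<forall>\<^sub>F n in sequentially. (\<integral>x. \<bar>g n x $ i\<bar> \<partial>lebesgue_on D) \<le> (\<integral>x. norm (g n x) \<partial>lebesgue_on D)"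
      using gi gi' by (intro always_eventually allI integral_mono integrable_norm integrable_abs component_le_norm_cart)
  qed simp
  note Td = integrable_bounded_mult[OF Lp_integrable[OF Dm p dL] B' m(2)]
    integral_bounded_mult_tendsto_0[OF Lp_integrable[OF Dm p dL] d1 B' m(2)]
  note Tg = integrable_bounded_mult[OF gi' B m(1)]
    integral_bounded_mult_tendsto_0[OF gi' g1' B m(1)]
  have ui: "integrable (lebesgue_on D) (\<lambda>x. u x * partial_deriv i \<psi> x)"
    by (rule integrable_bounded_mult[OF Lp_integrable[OF Dm p uL] B' m(2)])
  have Gi: "integrable (lebesgue_on D) (\<lambda>x. G x $ i * \<psi> x)"
    by (rule integrable_bounded_mult[OF _ B m(1)])
       (rule integrable_bounded_linear[OF bounded_linear_vec_nth Lp_integrable[OF Dm p G(2)]])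
  \<comment> \<open>\<open>I\<close> is the defect in the integration by parts formula for
    \<open>u\<close> and \<open>G\<close>. The formula is exact for every \<open>\<phi> n\<close>,
    so the defect of \<open>d n\<close> and \<open>g n\<close> is \<open>- I\<close> for all
    \<open>n\<close>; since both tend to 0 in L^1, \<open>I\<close> must be 0.\<close>
  define I where "I = (\<integral>x. u x * partial_deriv i \<psi> x \<partial>lebesgue_on D) + (\<integral>x. G x $ i * \<psi> x \<partial>lebesgue_on D)"
  have "(\<integral>x. d n x * partial_deriv i \<psi> x \<partial>lebesgue_on D) + (\<integral>x. g n x $ i * \<psi> x \<partial>lebesgue_on D) = - I" for n
  proof -
    obtain L where L: "smooth (\<phi> n)" "compact L" "L \<subseteq> D" "\<And>x. x \<notin> L \<Longrightarrow> \<phi> n x = 0"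
      "\<And>x i. x \<notin> L \<Longrightarrow> partial_deriv i (\<phi> n) x = 0"
      using \<phi>(2)[of n] by (rule test_functionE) blast
    have "(\<integral>x. \<phi> n x * partial_deriv i \<psi> x \<partial>lebesgue_on D) = (\<integral>x. \<phi> n x * partial_deriv i \<psi> x \<partial>lebesgue)"
      by (rule integral_lebesgue_on_support[OF D']) (use L in auto)
    also have "\<dots> = - (\<integral>x. partial_deriv i (\<phi> n) x * \<psi> x \<partial>lebesgue)"
      by (rule integration_by_parts[OF L(1) K(1) L(2) L(4) L(5)])
    also have "(\<integral>x. partial_deriv i (\<phi> n) x * \<psi> x \<partial>lebesgue) = (\<integral>x. gradient (\<phi> n) x $ i * \<psi> x \<partial>lebesgue_on D)"
      unfolding gradient_nth by (rule integral_lebesgue_on_support[symmetric, OF D']) (use L in auto)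
    finally have 1: "(\<integral>x. \<phi> n x * partial_deriv i \<psi> x \<partial>lebesgue_on D) =
       - (\<integral>x. gradient (\<phi> n) x $ i * \<psi> x \<partial>lebesgue_on D)" .
    have "(\<integral>x. \<phi> n x * partial_deriv i \<psi> x \<partial>lebesgue_on D) =
       (\<integral>x. d n x * partial_deriv i \<psi> x + u x * partial_deriv i \<psi> x \<partial>lebesgue_on D)"
      by (simp add: d_def algebra_simps)
    also have "\<dots> = (\<integral>x. d n x * partial_deriv i \<psi> x \<partial>lebesgue_on D) + (\<integral>x. u x * partial_deriv i \<psi> x \<partial>lebesgue_on D)"
      using Td(1) ui by simp
    finally have 2: "(\<integral>x. \<phi> n x * partial_deriv i \<psi> x \<partial>lebesgue_on D) = \<dots>" .
    have "(\<integral>x. gradient (\<phi> n) x $ i * \<psi> x \<partial>lebesgue_on D) =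
       (\<integral>x. g n x $ i * \<psi> x + G x $ i * \<psi> x \<partial>lebesgue_on D)"
      by (simp add: g_def algebra_simps)
    also have "\<dots> = (\<integral>x. g n x $ i * \<psi> x \<partial>lebesgue_on D) + (\<integral>x. G x $ i * \<psi> x \<partial>lebesgue_on D)"
      using Tg(1) Gi by simp
    finally show ?thesis using 1 2 by (simp add: I_def)
  qed
  then have "(\<lambda>n. - I) \<longlonglongrightarrow> 0 + 0"
    using tendsto_add[OF Td(2) Tg(2)] by simp
  then have "I = 0" by (simp add: LIMSEQ_const_iff)
  moreover have "(\<integral>x. zero_extension D u x * partial_deriv i \<psi> x \<partial>lebesgue_on UNIV) =
      (\<integral>x. u x * partial_deriv i \<psi> x \<partial>lebesgue_on D)"
    unfolding lebesgue_on_UNIV_eq Lebesgue_Measure.integral_restrict_UNIV[OF D', symmetric]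
    by (intro Bochner_Integration.integral_cong) (auto simp: zero_extension_def)
  moreover have "(\<integral>x. zero_extension D G x $ i * \<psi> x \<partial>lebesgue_on UNIV) =
      (\<integral>x. G x $ i * \<psi> x \<partial>lebesgue_on D)"
    unfolding lebesgue_on_UNIV_eq Lebesgue_Measure.integral_restrict_UNIV[OF D', symmetric]
    by (intro Bochner_Integration.integral_cong) (auto simp: zero_extension_def)
  ultimately show "(\<integral>x. zero_extension D u x * partial_deriv i \<psi> x \<partial>lebesgue_on UNIV) =
     - (\<integral>x. zero_extension D G x $ i * \<psi> x \<partial>lebesgue_on UNIV)"
    by (simp add: I_def)
qed

section \<open>Placing functions on scaled translates\<close>

lemma integrable_imp_L1_loc:
  fixes f :: "real^'n \<Rightarrow> 'b::euclidean_space"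
  assumes "integrable lebesgue f"
  shows "f \<in> L1_loc \<Omega>"
proof -
  have "integrable (lebesgue_on K) f" if "compact K" for K
    using assms that by (intro integrable_lebesgue_imp_on) (auto intro: lmeasurable_compact fmeasurableD)
  moreover have "f \<in> borel_measurable lebesgue" using assms by auto
  ultimately show ?thesis by (auto simp: L1_loc_def intro: measurable_restrict_space1)
qed

text \<open>The test function is transported by the inverse affine map. Its derivative yields the
  factor \<open>s\<close>, and both sides of the formula acquire the same Jacobian.\<close>

lemma weak_gradient_affine:
  fixes v :: "real^'n \<Rightarrow> real"
  assumes w: "has_weak_gradient UNIV v H" and s: "s \<noteq> 0"
    and i: "integrable lebesgue v" "integrable lebesgue H"
  shows "has_weak_gradient UNIV (\<lambda>y. v (b + s *\<^sub>R y)) (\<lambda>y. s *\<^sub>R H (b + s *\<^sub>R y))"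
  unfolding has_weak_gradient_def
proof (intro conjI ballI allI)
  have m: "v \<in> borel_measurable lebesgue" "H \<in> borel_measurable lebesgue" using i by auto
  show "(\<lambda>y. v (b + s *\<^sub>R y)) \<in> L1_loc UNIV"
    using i m s by (intro integrable_imp_L1_loc) (simp add: lebesgue_integrable_affine_iff)
  show "(\<lambda>y. s *\<^sub>R H (b + s *\<^sub>R y)) \<in> L1_loc UNIV"
    using i m s by (intro integrable_imp_L1_loc integrable_scaleR_right) (simp add: lebesgue_integrable_affine_iff)
  fix \<psi> k assume \<psi>: "\<psi> \<in> test_functions (UNIV :: (real^'n) set)"
  then obtain K where K: "smooth \<psi>" "compact K" "\<And>x. x \<notin> K \<Longrightarrow> \<psi> x = 0"
    by (rule test_functionE) blast
  define \<psi>' where "\<psi>' = (\<lambda>x. \<psi> ((- (1 / s)) *\<^sub>R b + (1 / s) *\<^sub>R x))"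
  have \<psi>'A: "\<psi>' (b + s *\<^sub>R y) = \<psi> y" for y
    using s by (simp add: \<psi>'_def algebra_simps)
  have "\<psi>' \<in> test_functions UNIV"
  proof (rule test_function_intro)
    show "smooth \<psi>'" unfolding \<psi>'_def by (rule smooth_affine[OF K(1)])
    show "compact ((\<lambda>y. b + s *\<^sub>R y) ` K)"
      using K(2) by (intro compact_continuous_image continuous_intros)
    show "\<psi>' x = 0" if "x \<notin> (\<lambda>y. b + s *\<^sub>R y) ` K" for x
    proof -
      have "x = b + s *\<^sub>R ((- (1 / s)) *\<^sub>R b + (1 / s) *\<^sub>R x)" using s by (simp add: algebra_simps)
      with that have "(- (1 / s)) *\<^sub>R b + (1 / s) *\<^sub>R x \<notin> K" by blast
      then show ?thesis unfolding \<psi>'_def by (rule K(3))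
    qed
  qed simp
  note by_parts = has_weak_gradientD(3)[OF w this, of k]
  have pd: "partial_deriv k \<psi> y = s * partial_deriv k \<psi>' (b + s *\<^sub>R y)" for y
    using s unfolding \<psi>'_def
    by (subst partial_deriv_affine) (auto intro: smooth_differentiable K simp: algebra_simps)
  have sm: "smooth \<psi>'" unfolding \<psi>'_def by (rule smooth_affine[OF K(1)])
  have m': "\<psi>' \<in> borel_measurable lebesgue" "partial_deriv k \<psi>' \<in> borel_measurable lebesgue"
    using sm by (auto intro: continuous_lebesgue_measurable smooth_continuous smooth_partial_deriv)
  have mH: "(\<lambda>x. H x $ k) \<in> borel_measurable lebesgue"
    by (rule measurable_compose[OF m(2)]) (intro continuous_borel linear_continuous_on bounded_linear_vec_nth)
  have "(\<integral>y. v (b + s *\<^sub>R y) * partial_deriv k \<psi> y \<partial>lebesgue) =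
      s * (\<integral>y. v (b + s *\<^sub>R y) * partial_deriv k \<psi>' (b + s *\<^sub>R y) \<partial>lebesgue)"
    unfolding pd by (simp add: mult.left_commute)
  also have "\<dots> = s / \<bar>s\<bar> ^ CARD('n) * (\<integral>x. v x * partial_deriv k \<psi>' x \<partial>lebesgue)"
    using lebesgue_integral_affine[OF s, of "\<lambda>x. v x * partial_deriv k \<psi>' x" b] m m' by simp
  also have "\<dots> = - (s / \<bar>s\<bar> ^ CARD('n) * (\<integral>x. H x $ k * \<psi>' x \<partial>lebesgue))"
    using by_parts by (simp add: lebesgue_on_UNIV_eq)
  also have "\<dots> = - (s * (\<integral>y. H (b + s *\<^sub>R y) $ k * \<psi>' (b + s *\<^sub>R y) \<partial>lebesgue))"
    using lebesgue_integral_affine[OF s, of "\<lambda>x. H x $ k * \<psi>' x" b] mH m' by simp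
  also have "\<dots> = - (\<integral>y. (s *\<^sub>R H (b + s *\<^sub>R y)) $ k * \<psi> y \<partial>lebesgue)"
    unfolding \<psi>'A by (simp add: mult.assoc)
  finally show "(\<integral>y. v (b + s *\<^sub>R y) * partial_deriv k \<psi> y \<partial>lebesgue_on UNIV) =
     - (\<integral>y. (s *\<^sub>R H (b + s *\<^sub>R y)) $ k * \<psi> y \<partial>lebesgue_on UNIV)"
    by (simp add: lebesgue_on_UNIV_eq)
qed

text \<open>The factor makes the placement isometric for the \<open>L\<^sup>p\<close> norm.\<close>

definition place :: "real \<Rightarrow> (real^'n) set \<Rightarrow> real \<Rightarrow> real^'n \<Rightarrow> (real^'n \<Rightarrow> real) \<Rightarrow> real^'n \<Rightarrow> real" where
  "place p D s b u y = s powr (real CARD('n) / p) * zero_extension D u (b + s *\<^sub>R y)"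

lemma place_linear: "place p D s b (\<lambda>x. \<alpha> * u x + \<beta> * v x) y = \<alpha> * place p D s b u y + \<beta> * place p D s b v y"
  by (simp add: place_def zero_extension_def algebra_simps)

text \<open>The free factor \<open>c\<close> lets one computation serve both a function and its
  gradient, which are rescaled differently. The denominator \<open>s ^ CARD('n)\<close> is the
  Jacobian.\<close>

lemma integral_norm_powr_affine:
  fixes f :: "real^'n \<Rightarrow> 'b::euclidean_space"
  assumes D: "D \<in> sets lebesgue" and f: "f \<in> Lp p D" and s: "s > 0"
    and \<Omega>: "\<Omega> \<in> sets lebesgue" "\<And>y. b + s *\<^sub>R y \<in> D \<Longrightarrow> y \<in> \<Omega>"
  shows "(\<lambda>y. c *\<^sub>R zero_extension D f (b + s *\<^sub>R y)) \<in> Lp p \<Omega>"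
    and "(\<integral>y. norm (c *\<^sub>R zero_extension D f (b + s *\<^sub>R y)) powr p \<partial>lebesgue_on \<Omega>) =
       \<bar>c\<bar> powr p / s ^ CARD('n) * (\<integral>x. norm (f x) powr p \<partial>lebesgue_on D)"
proof -
  let ?g = "\<lambda>x. norm (zero_extension D f x) powr p"
  have fm: "f \<in> borel_measurable (lebesgue_on D)"
    and fi: "integrable (lebesgue_on D) (\<lambda>x. norm (f x) powr p)" using f by (auto simp: Lp_def)
  have em: "zero_extension D f \<in> borel_measurable lebesgue"
    unfolding zero_extension_def[abs_def] using fm D by (rule borel_measurable_if_I)
  have g_eq: "?g = (\<lambda>x. if x \<in> D then norm (f x) powr p else 0)"
    by (auto simp: zero_extension_def)
  have gi: "integrable lebesgue ?g" "(\<integral>x. ?g x \<partial>lebesgue) = (\<integral>x. norm (f x) powr p \<partial>lebesgue_on D)"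
    unfolding g_eq using fi by (simp_all add: Lebesgue_Measure.integrable_restrict_UNIV[OF D]
      Lebesgue_Measure.integral_restrict_UNIV[OF D])
  have gm: "?g \<in> borel_measurable lebesgue" using gi by auto
  have eq: "norm (c *\<^sub>R zero_extension D f z) powr p = \<bar>c\<bar> powr p * ?g z" for z
    by (simp add: powr_mult)
  have gi': "integrable lebesgue (\<lambda>y. ?g (b + s *\<^sub>R y))"
    using lebesgue_integrable_affine_iff[of s ?g b] s gm gi(1) by simp
  have "(\<lambda>y. c *\<^sub>R zero_extension D f (b + s *\<^sub>R y)) \<in> borel_measurable lebesgue"
    using lebesgue_measurable_affine[of s "zero_extension D f" b] s em by simp
  moreover have "integrable (lebesgue_on \<Omega>) (\<lambda>y. \<bar>c\<bar> powr p * ?g (b + s *\<^sub>R y))"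
    using gi' by (intro integrable_mult_right integrable_lebesgue_imp_on \<Omega>)
  ultimately show "(\<lambda>y. c *\<^sub>R zero_extension D f (b + s *\<^sub>R y)) \<in> Lp p \<Omega>"
    unfolding Lp_def by (simp only: eq mem_Collect_eq) (auto intro: measurable_restrict_space1)
  have "(\<integral>y. \<bar>c\<bar> powr p * ?g (b + s *\<^sub>R y) \<partial>lebesgue_on \<Omega>) =
     (\<integral>y. \<bar>c\<bar> powr p * ?g (b + s *\<^sub>R y) \<partial>lebesgue)"
    using \<Omega>(2) by (intro integral_lebesgue_on_support \<Omega>(1)) (auto simp: zero_extension_def)
  also have "\<dots> = \<bar>c\<bar> powr p / s ^ CARD('n) * (\<integral>x. norm (f x) powr p \<partial>lebesgue_on D)"
    using lebesgue_integral_affine[of s ?g b] s gm gi(2) by simp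
  finally show "(\<integral>y. norm (c *\<^sub>R zero_extension D f (b + s *\<^sub>R y)) powr p \<partial>lebesgue_on \<Omega>) =
       \<bar>c\<bar> powr p / s ^ CARD('n) * (\<integral>x. norm (f x) powr p \<partial>lebesgue_on D)"
    unfolding eq .
qed

text \<open>The map sending y to \<open>b + s *\<^sub>R y\<close> carries a translated copy of
  \<open>D\<close>, scaled by 1/s, onto \<open>D\<close>; \<open>tile\<close> says that this copy
  lies in \<open>\<Omega>\<close>.\<close>

locale placement =
  fixes p s :: real and D \<Omega> :: "(real^'n) set" and b :: "real^'n"
  assumes p: "p > 1" and s: "s > 0" and D: "open D" "bounded D" and \<Omega>: "open \<Omega>"
    and tile: "\<And>y. b + s *\<^sub>R y \<in> D \<Longrightarrow> y \<in> \<Omega>"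
begin

lemma place_Lp_integral:
  assumes u: "u \<in> W1p_0 p D"
  shows "(\<integral>y. \<bar>place p D s b u y\<bar> powr p \<partial>lebesgue_on \<Omega>) = (\<integral>x. \<bar>u x\<bar> powr p \<partial>lebesgue_on D)"
    and "place p D s b u \<in> Lp p \<Omega>"
proof -
  have m: "D \<in> sets lebesgue" "\<Omega> \<in> sets lebesgue" using D \<Omega> by auto
  have uL: "u \<in> Lp p D" using u by (auto simp: W1p_0_def W1p_def)
  note * = integral_norm_powr_affine[OF m(1) uL s m(2) tile, where c="s powr (real CARD('n) / p)"]
  have c: "(s powr (real CARD('n) / p)) powr p = s ^ CARD('n)"
    using p s by (simp add: powr_powr powr_realpow)
  show "(\<integral>y. \<bar>place p D s b u y\<bar> powr p \<partial>lebesgue_on \<Omega>) = (\<integral>x. \<bar>u x\<bar> powr p \<partial>lebesgue_on D)"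
    using *(2) c s unfolding place_def by simp
  show "place p D s b u \<in> Lp p \<Omega>"
    using *(1) by (simp add: place_def[abs_def])
qed

text \<open>The gradient is produced explicitly so that it vanishes at every point off the tile,
  which is not known of the one picked by \<open>weak_gradient\<close>; gradients on disjoint tiles
  then never overlap. The factor \<open>s powr p\<close> comes from the chain rule, while the
  normalizing factor of \<open>place\<close> cancels the Jacobian.\<close>

lemma place_weak_gradient:
  assumes u: "u \<in> W1p_0 p D"
  obtains H where "has_weak_gradient \<Omega> (place p D s b u) H" "H \<in> Lp p \<Omega>"
    "\<And>y. b + s *\<^sub>R y \<notin> D \<Longrightarrow> H y = 0"
    "(\<integral>y. norm (H y) powr p \<partial>lebesgue_on \<Omega>) = s powr p * energy p D u"
proof -
  have m: "D \<in> sets lebesgue" "\<Omega> \<in> sets lebesgue" and lm: "D \<in> lmeasurable"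
    using D \<Omega> by (auto simp: lmeasurable_open)
  have uW: "u \<in> W1p p D" using u by (auto simp: W1p_0_def)
  then obtain G where G: "u \<in> Lp p D" "G \<in> Lp p D" "has_weak_gradient D u G"
    "energy p D u = (\<integral>x. norm (G x) powr p \<partial>lebesgue_on D)"
    using D(1) by (rule W1pE)
  have p1: "p \<ge> 1" using p by simp
  let ?k = "s powr (real CARD('n) / p)"
  define H where "H = (\<lambda>y. (?k * s) *\<^sub>R zero_extension D G (b + s *\<^sub>R y))"
  \<comment> \<open>Extension by zero and affine substitution both take place on the whole space;
    the restriction to \<open>\<Omega>\<close> comes last.\<close>
  have "has_weak_gradient UNIV (\<lambda>y. zero_extension D u (b + s *\<^sub>R y)) (\<lambda>y. s *\<^sub>R zero_extension D G (b + s *\<^sub>R y))"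
    using s by (intro weak_gradient_affine zero_extension_weak_gradient[OF D p1 u G(3,2)]
      zero_extension_L1_loc(2) m Lp_integrable[OF lm p1] G) auto
  from weak_gradient_linear[OF this this open_UNIV, of ?k 0]
  have "has_weak_gradient UNIV (place p D s b u) H"
    by (simp add: place_def[abs_def] H_def)
  then have "has_weak_gradient \<Omega> (place p D s b u) H"
    by (rule weak_gradient_restrict) (use \<Omega> in auto)
  moreover have "H y = 0" if "b + s *\<^sub>R y \<notin> D" for y
    using that by (simp add: H_def zero_extension_def)
  moreover note * = integral_norm_powr_affine[OF m(1) G(2) s m(2) tile, where c="?k * s"]
  have "H \<in> Lp p \<Omega>" using *(1) by (simp add: H_def)
  moreover have c: "\<bar>?k * s\<bar> powr p = s ^ CARD('n) * s powr p"
    using p s by (simp add: powr_powr powr_realpow powr_mult abs_mult)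
  have "(\<integral>y. norm (H y) powr p \<partial>lebesgue_on \<Omega>) = s powr p * energy p D u"
    using *(2) s by (simp only: c G(4) H_def) simp
  ultimately show thesis using that by blast
qed

lemma place_energy:
  assumes u: "u \<in> W1p_0 p D"
  shows "energy p \<Omega> (place p D s b u) = s powr p * energy p D u"
    and "place p D s b u \<in> W1p p \<Omega>"
proof -
  obtain H where H: "has_weak_gradient \<Omega> (place p D s b u) H" "H \<in> Lp p \<Omega>"
    "(\<integral>y. norm (H y) powr p \<partial>lebesgue_on \<Omega>) = s powr p * energy p D u"
    using u by (rule place_weak_gradient)
  then show "energy p \<Omega> (place p D s b u) = s powr p * energy p D u"
    using energy_eq[OF \<Omega> H(1)] by simp
  show "place p D s b u \<in> W1p p \<Omega>"
    using place_Lp_integral(2)[OF u] H by (auto simp: W1p_def)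
qed

text \<open>Placement keeps the L^p part and multiplies the energy by \<open>s powr p\<close>;
  \<open>1 + s powr p\<close> dominates both factors. As placement is linear, this estimate
  expresses its continuity.\<close>

lemma place_sobolev_modular_le:
  assumes u: "u \<in> W1p_0 p D"
  shows "sobolev_modular p \<Omega> (place p D s b u) \<le> (1 + s powr p) * sobolev_modular p D u"
proof -
  have "(\<integral>x. \<bar>u x\<bar> powr p \<partial>lebesgue_on D) \<ge> 0" by simp
  then have "0 \<le> s powr p * (\<integral>x. \<bar>u x\<bar> powr p \<partial>lebesgue_on D)" by simp
  moreover have "0 \<le> energy p D u" by (rule energy_nonneg)
  ultimately show ?thesis
    unfolding sobolev_modular_def place_energy[OF u] place_Lp_integral[OF u]
    by (simp add: algebra_simps)
qed

lemma place_test_function: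
  assumes "\<phi> \<in> test_functions D"
  shows "place p D s b \<phi> \<in> test_functions \<Omega>"
proof -
  obtain K where K: "smooth \<phi>" "compact K" "K \<subseteq> D" "\<And>x. x \<notin> K \<Longrightarrow> \<phi> x = 0"
    using assms by (rule test_functionE) blast
  have eq: "place p D s b \<phi> = (\<lambda>y. s powr (real CARD('n) / p) * \<phi> (b + s *\<^sub>R y))"
    using K by (auto simp: place_def zero_extension_def fun_eq_iff)
  have inv: "y = (- (1 / s)) *\<^sub>R b + (1 / s) *\<^sub>R (b + s *\<^sub>R y)" "b + s *\<^sub>R ((- (1 / s)) *\<^sub>R b + (1 / s) *\<^sub>R y) = y" for y
    using s by (simp_all add: algebra_simps)
  show ?thesis
  proof (rule test_function_intro)
    show "smooth (place p D s b \<phi>)"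
      unfolding eq by (intro smooth_mult smooth_const smooth_affine K)
    show "compact ((\<lambda>x. (- (1 / s)) *\<^sub>R b + (1 / s) *\<^sub>R x) ` K)"
      using K(2) by (intro compact_continuous_image continuous_intros)
    show "(\<lambda>x. (- (1 / s)) *\<^sub>R b + (1 / s) *\<^sub>R x) ` K \<subseteq> \<Omega>"
    proof
      fix y assume "y \<in> (\<lambda>x. (- (1 / s)) *\<^sub>R b + (1 / s) *\<^sub>R x) ` K"
      then have "b + s *\<^sub>R y \<in> K" using inv(2) by auto
      with K(3) tile show "y \<in> \<Omega>" by blast
    qed
    show "place p D s b \<phi> y = 0" if "y \<notin> (\<lambda>x. (- (1 / s)) *\<^sub>R b + (1 / s) *\<^sub>R x) ` K" for y
    proof -
      have "b + s *\<^sub>R y \<notin> K" using that inv(1)[of y] by blast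
      then show ?thesis using K(4) by (simp add: eq)
    qed
  qed
qed

text \<open>Placement maps the approximating test functions to test functions and is continuous for
  the modular.\<close>

lemma place_W1p_0:
  assumes u: "u \<in> W1p_0 p D"
  shows "place p D s b u \<in> W1p_0 p \<Omega>"
proof -
  have p0: "p > 0" using p by simp
  obtain \<phi> where \<phi>: "u \<in> W1p p D" "\<And>n. \<phi> n \<in> test_functions D"
    "(\<lambda>n. sobolev_modular p D (\<lambda>x. \<phi> n x - u x)) \<longlonglongrightarrow> 0"
    using u p0 by (rule W1p_0E) blast
  have W: "(\<lambda>x. \<phi> n x - u x) \<in> W1p_0 p D" for n
    using W1p_0_linear[OF p0 D(1) test_function_W1p_0[OF p0 \<phi>(2) D(1)] u, where a=1 and b="-1"] by simp
  have eq: "(\<lambda>y. place p D s b (\<phi> n) y - place p D s b u y) = place p D s b (\<lambda>x. \<phi> n x - u x)" for n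
    using place_linear[of p D s b 1 "\<phi> n" "-1" u] by (simp add: fun_eq_iff)
  show ?thesis
  proof (rule W1p_0I[OF place_energy(2)[OF u] p0])
    show "place p D s b (\<phi> n) \<in> test_functions \<Omega>" for n by (rule place_test_function[OF \<phi>(2)])
    have lim: "(\<lambda>n. (1 + s powr p) * sobolev_modular p D (\<lambda>x. \<phi> n x - u x)) \<longlonglongrightarrow> 0"
      using tendsto_mult_left[OF \<phi>(3), of "1 + s powr p"] by simp
    show "(\<lambda>n. sobolev_modular p \<Omega> (\<lambda>y. place p D s b (\<phi> n) y - place p D s b u y)) \<longlonglongrightarrow> 0"
      unfolding eq
      by (rule tendsto_sandwich[OF _ _ tendsto_const lim])
         (simp_all add: sobolev_modular_nonneg place_sobolev_modular_le[OF W])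
  qed
qed

end

section \<open>Superposition of functions with disjoint supports\<close>

lemma sum_disjoint_support_norm_powr:
  fixes f :: "'j \<Rightarrow> 'a \<Rightarrow> 'b::real_normed_vector"
  assumes J: "finite J" and disj: "\<And>i j. i \<in> J \<Longrightarrow> j \<in> J \<Longrightarrow> i \<noteq> j \<Longrightarrow> T i \<inter> T j = {}"
    and supp: "\<And>j y. j \<in> J \<Longrightarrow> y \<notin> T j \<Longrightarrow> f j y = 0"
  shows "norm (\<Sum>j\<in>J. t j *\<^sub>R f j y) powr p = (\<Sum>j\<in>J. \<bar>t j\<bar> powr p * norm (f j y) powr p)"
proof (cases "\<exists>j\<in>J. y \<in> T j")
  case True
  then obtain j where j: "j \<in> J" "y \<in> T j" by blast
  have 0: "f i y = 0" if "i \<in> J - {j}" for i using that disj[of i j] j supp[of i y] by auto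
  have "(\<Sum>j\<in>J. t j *\<^sub>R f j y) = t j *\<^sub>R f j y"
    using J j 0 by (subst sum.remove[of _ j]) auto
  moreover have "(\<Sum>j\<in>J. \<bar>t j\<bar> powr p * norm (f j y) powr p) = \<bar>t j\<bar> powr p * norm (f j y) powr p"
    using J j 0 by (subst sum.remove[of _ j]) auto
  ultimately show ?thesis by (simp add: powr_mult)
next
  case False
  then show ?thesis using supp by simp
qed

lemma Lp_integral_disjoint_sum:
  fixes f :: "'j \<Rightarrow> real^'n \<Rightarrow> 'b::euclidean_space"
  assumes J: "finite J" and disj: "\<And>i j. i \<in> J \<Longrightarrow> j \<in> J \<Longrightarrow> i \<noteq> j \<Longrightarrow> T i \<inter> T j = {}"
    and supp: "\<And>j y. j \<in> J \<Longrightarrow> y \<notin> T j \<Longrightarrow> f j y = 0" and f: "\<And>j. j \<in> J \<Longrightarrow> f j \<in> Lp p \<Omega>"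
  shows "(\<integral>y. norm (\<Sum>j\<in>J. t j *\<^sub>R f j y) powr p \<partial>lebesgue_on \<Omega>) =
     (\<Sum>j\<in>J. \<bar>t j\<bar> powr p * (\<integral>y. norm (f j y) powr p \<partial>lebesgue_on \<Omega>))"
proof -
  have "integrable (lebesgue_on \<Omega>) (\<lambda>y. \<bar>t j\<bar> powr p * norm (f j y) powr p)" if "j \<in> J" for j
    using f[OF that] by (simp add: Lp_def)
  then have "(\<integral>y. (\<Sum>j\<in>J. \<bar>t j\<bar> powr p * norm (f j y) powr p) \<partial>lebesgue_on \<Omega>) =
      (\<Sum>j\<in>J. \<integral>y. \<bar>t j\<bar> powr p * norm (f j y) powr p \<partial>lebesgue_on \<Omega>)"
    by (rule Bochner_Integration.integral_sum)
  moreover have "(\<integral>y. norm (\<Sum>j\<in>J. t j *\<^sub>R f j y) powr p \<partial>lebesgue_on \<Omega>) =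
      (\<integral>y. (\<Sum>j\<in>J. \<bar>t j\<bar> powr p * norm (f j y) powr p) \<partial>lebesgue_on \<Omega>)"
    by (intro Bochner_Integration.integral_cong refl sum_disjoint_support_norm_powr[OF J disj supp])
  ultimately show ?thesis by simp
qed

lemma weak_gradient_zero: "open \<Omega> \<Longrightarrow> has_weak_gradient \<Omega> (\<lambda>x. 0) (\<lambda>x. 0)"
proof -
  have "(\<lambda>x. 0) \<in> test_functions UNIV"
    by (rule test_function_intro[of _ "{}"]) (auto simp: smooth_const)
  moreover have "gradient (\<lambda>x::real^'a. 0) = (\<lambda>x. 0)" by (simp add: gradient_def fun_eq_iff vec_eq_iff)
  ultimately show "open \<Omega> \<Longrightarrow> ?thesis" using test_function_weak_gradient by metis
qed

lemma weak_gradient_sum: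
  assumes \<Omega>: "open \<Omega>" and J: "finite J" and w: "\<And>j. j \<in> J \<Longrightarrow> has_weak_gradient \<Omega> (f j) (G j)"
  shows "has_weak_gradient \<Omega> (\<lambda>y. \<Sum>j\<in>J. t j * f j y) (\<lambda>y. \<Sum>j\<in>J. t j *\<^sub>R G j y)"
  using J w
proof (induction rule: finite_induct)
  case empty then show ?case using weak_gradient_zero[OF \<Omega>] by simp
next
  case (insert i I)
  then have "has_weak_gradient \<Omega> (f i) (G i)"
    "has_weak_gradient \<Omega> (\<lambda>y. \<Sum>j\<in>I. t j * f j y) (\<lambda>y. \<Sum>j\<in>I. t j *\<^sub>R G j y)" by auto
  from weak_gradient_linear[OF this \<Omega>, of "t i" 1] insert show ?case by simp
qed

lemma W1p_0_sum:
  assumes p: "p > 0" and \<Omega>: "open \<Omega>" and J: "finite J" and f: "\<And>j. j \<in> J \<Longrightarrow> f j \<in> W1p_0 p \<Omega>"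
  shows "(\<lambda>y. \<Sum>j\<in>J. t j * f j y) \<in> W1p_0 p \<Omega>"
  using J f
proof (induction rule: finite_induct)
  case empty
  have "(\<lambda>x. 0) \<in> test_functions \<Omega>"
    by (rule test_function_intro[of _ "{}"]) (auto simp: smooth_const)
  then show ?case using test_function_W1p_0[OF p _ \<Omega>] by simp
next
  case (insert i I)
  then have "f i \<in> W1p_0 p \<Omega>" "(\<lambda>y. \<Sum>j\<in>I. t j * f j y) \<in> W1p_0 p \<Omega>" by auto
  from W1p_0_linear[OF p \<Omega> this, of "t i" 1] insert show ?case by simp
qed

text \<open>There are no cross terms: at each point at most one summand, and at most one of the
  explicit gradients, is nonzero.\<close>

lemma placed_sum:
  fixes D \<Omega> :: "(real^'n) set"
  assumes J: "finite J" and pl: "\<And>j. j \<in> J \<Longrightarrow> placement p s D \<Omega> (b j)"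
    and disj: "\<And>i j y. i \<in> J \<Longrightarrow> j \<in> J \<Longrightarrow> i \<noteq> j \<Longrightarrow> b i + s *\<^sub>R y \<in> D \<Longrightarrow> b j + s *\<^sub>R y \<notin> D"
    and u: "\<And>j. j \<in> J \<Longrightarrow> u j \<in> W1p_0 p D" and p: "p > 0" and \<Omega>: "open \<Omega>"
  shows "(\<lambda>y. \<Sum>j\<in>J. t j * place p D s (b j) (u j) y) \<in> W1p_0 p \<Omega>"
    and "(\<integral>y. \<bar>\<Sum>j\<in>J. t j * place p D s (b j) (u j) y\<bar> powr p \<partial>lebesgue_on \<Omega>) =
       (\<Sum>j\<in>J. \<bar>t j\<bar> powr p * (\<integral>x. \<bar>u j x\<bar> powr p \<partial>lebesgue_on D))"
    and "energy p \<Omega> (\<lambda>y. \<Sum>j\<in>J. t j * place p D s (b j) (u j) y) =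
       s powr p * (\<Sum>j\<in>J. \<bar>t j\<bar> powr p * energy p D (u j))"
proof -
  let ?T = "\<lambda>j. {y. b j + s *\<^sub>R y \<in> D}"
  have disj': "?T i \<inter> ?T j = {}" if "i \<in> J" "j \<in> J" "i \<noteq> j" for i j
    using disj[OF that] by blast
  show "(\<lambda>y. \<Sum>j\<in>J. t j * place p D s (b j) (u j) y) \<in> W1p_0 p \<Omega>"
    by (intro W1p_0_sum p \<Omega> J placement.place_W1p_0 pl u)
  have "(\<integral>y. norm (\<Sum>j\<in>J. t j *\<^sub>R place p D s (b j) (u j) y) powr p \<partial>lebesgue_on \<Omega>) =
     (\<Sum>j\<in>J. \<bar>t j\<bar> powr p * (\<integral>y. norm (place p D s (b j) (u j) y) powr p \<partial>lebesgue_on \<Omega>))"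
  proof (rule Lp_integral_disjoint_sum[OF J disj'])
    show "place p D s (b j) (u j) \<in> Lp p \<Omega>" if "j \<in> J" for j
      by (rule placement.place_Lp_integral(2)[OF pl u]) (fact that)+
  qed (auto simp: place_def zero_extension_def)
  also have "\<dots> = (\<Sum>j\<in>J. \<bar>t j\<bar> powr p * (\<integral>x. \<bar>u j x\<bar> powr p \<partial>lebesgue_on D))"
    using placement.place_Lp_integral(1)[OF pl u] by (intro sum.cong) simp_all
  finally show "(\<integral>y. \<bar>\<Sum>j\<in>J. t j * place p D s (b j) (u j) y\<bar> powr p \<partial>lebesgue_on \<Omega>) =
       (\<Sum>j\<in>J. \<bar>t j\<bar> powr p * (\<integral>x. \<bar>u j x\<bar> powr p \<partial>lebesgue_on D))" by simp
  have "\<exists>H. has_weak_gradient \<Omega> (place p D s (b j) (u j)) H \<and> H \<in> Lp p \<Omega> \<and>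
      (\<forall>y. b j + s *\<^sub>R y \<notin> D \<longrightarrow> H y = 0) \<and>
      (\<integral>y. norm (H y) powr p \<partial>lebesgue_on \<Omega>) = s powr p * energy p D (u j)" if "j \<in> J" for j
    using placement.place_weak_gradient[OF pl[OF that] u[OF that]] by metis
  then obtain H where H: "\<And>j. j \<in> J \<Longrightarrow> has_weak_gradient \<Omega> (place p D s (b j) (u j)) (H j)"
    "\<And>j. j \<in> J \<Longrightarrow> H j \<in> Lp p \<Omega>" "\<And>j y. j \<in> J \<Longrightarrow> b j + s *\<^sub>R y \<notin> D \<Longrightarrow> H j y = 0"
    "\<And>j. j \<in> J \<Longrightarrow> (\<integral>y. norm (H j y) powr p \<partial>lebesgue_on \<Omega>) = s powr p * energy p D (u j)"
    by metis
  have "energy p \<Omega> (\<lambda>y. \<Sum>j\<in>J. t j * place p D s (b j) (u j) y) =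
      (\<integral>y. norm (\<Sum>j\<in>J. t j *\<^sub>R H j y) powr p \<partial>lebesgue_on \<Omega>)"
    by (intro energy_eq \<Omega> weak_gradient_sum J H)
  also have "\<dots> = (\<Sum>j\<in>J. \<bar>t j\<bar> powr p * (\<integral>y. norm (H j y) powr p \<partial>lebesgue_on \<Omega>))"
    by (rule Lp_integral_disjoint_sum[OF J disj']) (auto intro: H)
  also have "\<dots> = (\<Sum>j\<in>J. s powr p * (\<bar>t j\<bar> powr p * energy p D (u j)))"
    by (intro sum.cong) (simp_all add: H)
  finally show "energy p \<Omega> (\<lambda>y. \<Sum>j\<in>J. t j * place p D s (b j) (u j) y) =
       s powr p * (\<Sum>j\<in>J. \<bar>t j\<bar> powr p * energy p D (u j))"
    by (simp add: sum_distrib_left)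
qed

section \<open>Odd maps on spheres\<close>

text \<open>Indexed by the dimension k of the surrounding space, as the eigenvalues are; hence the
  shift by one.\<close>

definition unit_sphere :: "nat \<Rightarrow> (nat \<Rightarrow> real) set" where
  "unit_sphere k = topspace (nsphere (k - 1))"

lemma nsphere_euclidean: "nsphere n = top_of_set (topspace (nsphere n))"
  unfolding nsphere by (simp add: euclidean_product_topology)

lemma unit_sphere_iff:
  assumes "k \<ge> 1"
  shows "x \<in> unit_sphere k \<longleftrightarrow> (\<Sum>i<k. (x i)\<^sup>2) = 1 \<and> (\<forall>i\<ge>k. x i = 0)"
proof -
  have *: "{..k - 1} = {..<k}" "\<And>i. i > k - 1 \<longleftrightarrow> i \<ge> k" using assms by auto
  show ?thesis unfolding unit_sphere_def nsphere by (simp add: * del: One_nat_def)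
qed

text \<open>The points are infinite sequences, so compactness comes from Tychonoff's theorem: the
  sphere is a closed subset of a product of intervals.\<close>

lemma compact_unit_sphere:
  assumes "k \<ge> 1" shows "compact (unit_sphere k)"
proof -
  let ?C = "PiE UNIV (\<lambda>_::nat. {-1..1::real})"
  have "compactin (powertop_real (UNIV :: nat set)) ?C"
    by (subst compactin_PiE) simp
  then have C: "compact ?C" by (simp add: euclidean_product_topology)
  have sub: "unit_sphere k \<subseteq> ?C"
  proof
    fix x assume "x \<in> unit_sphere k"
    then have x: "(\<Sum>i<k. (x i)\<^sup>2) = 1" "\<forall>i\<ge>k. x i = 0" using unit_sphere_iff[OF assms] by auto
    have "\<bar>x i\<bar> \<le> 1" for i
    proof (cases "i < k")
      case True
      then have "(x i)\<^sup>2 \<le> (\<Sum>i<k. (x i)\<^sup>2)" by (intro member_le_sum) auto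
      with x have "(x i)\<^sup>2 \<le> 1" by simp
      then show ?thesis by (simp add: abs_square_le_1)
    qed (use x in auto)
    then show "x \<in> ?C" by (auto simp: abs_le_iff minus_le_iff)
  qed
  have "closed (unit_sphere k)"
  proof -
    have "unit_sphere k = {x. (\<Sum>i<k. (x i)\<^sup>2) = 1} \<inter> (\<Inter>i\<in>{k..}. {x. x i = 0})"
      using unit_sphere_iff[OF assms] by auto
    also have "closed \<dots>"
      by (intro closed_Int closed_INT ballI closed_Collect_eq continuous_intros continuous_on_product_coordinates)
    finally show ?thesis .
  qed
  then have "compact (?C \<inter> unit_sphere k)" using C by (simp add: compact_Int_closed)
  moreover have "?C \<inter> unit_sphere k = unit_sphere k" using sub by blast
  ultimately show ?thesis by simp
qed

text \<open>The product topology on sequences is the one of the type class, so the abstract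
  punctured filter turns into the usual \<open>at\<close> filter and the ordinary limit lemmas
  apply.\<close>

lemma atin_nsphere:
  assumes "\<xi> \<in> topspace (nsphere n)"
  shows "atin (nsphere n) \<xi> = at \<xi> within topspace (nsphere n)"
proof -
  have "eventually P (atin (nsphere n) \<xi>) \<longleftrightarrow> eventually P (at \<xi> within topspace (nsphere n))" for P
  proof -
    have "openin (nsphere n) T \<longleftrightarrow> (\<exists>U. open U \<and> T = topspace (nsphere n) \<inter> U)" for T
      by (subst nsphere_euclidean) (simp add: openin_open)
    then have "eventually P (atin (nsphere n) \<xi>) \<longleftrightarrow>
       (\<exists>U. open U \<and> \<xi> \<in> U \<and> (\<forall>x\<in>topspace (nsphere n) \<inter> U. x \<noteq> \<xi> \<longrightarrow> P x))"
      unfolding eventually_atin_within using assms by auto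
    also have "\<dots> \<longleftrightarrow> eventually P (at \<xi> within topspace (nsphere n))"
      unfolding eventually_at_topological by (intro ex_cong1 conj_cong refl) auto
    finally show ?thesis .
  qed
  then show ?thesis by (simp add: filter_eq_iff)
qed

lemma odd_sphere_maps_iff:
  assumes "p > 0"
  shows "h \<in> odd_sphere_maps p \<Omega> k \<longleftrightarrow>
    (\<forall>\<xi>\<in>unit_sphere k. h \<xi> \<in> unit_Lp_sphere p \<Omega>) \<and>
    (\<forall>\<xi>\<in>unit_sphere k. ((\<lambda>\<eta>. sobolev_modular p \<Omega> (\<lambda>x. h \<eta> x - h \<xi> x)) \<longlongrightarrow> 0) (at \<xi> within unit_sphere k)) \<and>
    (\<forall>\<xi>\<in>unit_sphere k. AE x in lebesgue_on \<Omega>. h (\<lambda>i. - \<xi> i) x = - h \<xi> x)"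
  unfolding odd_sphere_maps_def
  using W1p_dist_tendsto_0_iff[OF assms, where f=h and g="\<lambda>_. h \<xi>" for \<xi>]
  by (simp add: atin_nsphere image_subset_iff unit_sphere_def)

lemma unit_Lp_sphereD:
  assumes "u \<in> unit_Lp_sphere p \<Omega>"
  shows "u \<in> W1p_0 p \<Omega>" "u \<in> W1p p \<Omega>" "(\<integral>x. \<bar>u x\<bar> powr p \<partial>lebesgue_on \<Omega>) = 1"
  using assms by (auto simp: unit_Lp_sphere_def W1p_0_def)

text \<open>Continuity bounds the modular near each point, and compactness leaves finitely many of
  these bounds. This makes the suprema of energies meaningful and controls the superposed map where
  a block vanishes.\<close>

lemma odd_sphere_map_bounded:
  assumes p: "p > 0" and \<Omega>: "open \<Omega>" and k: "k \<ge> 1" and h: "h \<in> odd_sphere_maps p \<Omega> k"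
  obtains B where "B \<ge> 0" "\<And>\<xi>. \<xi> \<in> unit_sphere k \<Longrightarrow> sobolev_modular p \<Omega> (h \<xi>) \<le> B"
proof -
  note hD = h[unfolded odd_sphere_maps_iff[OF p]]
  have W: "h \<xi> \<in> W1p p \<Omega>" if "\<xi> \<in> unit_sphere k" for \<xi>
    using hD that unit_Lp_sphereD(2) by blast
  \<comment> \<open>Near \<xi> the modular of the difference from \<open>h \<xi>\<close> is at most
    1; the quasi-triangle inequality turns this into the bound \<open>B \<xi>\<close>.\<close>
  define B where "B = (\<lambda>\<xi>. 2 powr p * (1 + sobolev_modular p \<Omega> (h \<xi>)))"
  have "\<exists>U. open U \<and> \<xi> \<in> U \<and> (\<forall>\<eta>\<in>U \<inter> unit_sphere k. sobolev_modular p \<Omega> (h \<eta>) \<le> B \<xi>)"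
    if \<xi>: "\<xi> \<in> unit_sphere k" for \<xi>
  proof -
    have "((\<lambda>\<eta>. sobolev_modular p \<Omega> (\<lambda>x. h \<eta> x - h \<xi> x)) \<longlongrightarrow> 0) (at \<xi> within unit_sphere k)"
      using hD \<xi> by blast
    then have "\<forall>\<^sub>F \<eta> in at \<xi> within unit_sphere k. sobolev_modular p \<Omega> (\<lambda>x. h \<eta> x - h \<xi> x) < 1"
      by (rule order_tendstoD(2)) simp
    then obtain U where U: "open U" "\<xi> \<in> U"
      "\<And>\<eta>. \<eta> \<in> U \<Longrightarrow> \<eta> \<noteq> \<xi> \<Longrightarrow> \<eta> \<in> unit_sphere k \<Longrightarrow> sobolev_modular p \<Omega> (\<lambda>x. h \<eta> x - h \<xi> x) < 1"
      unfolding eventually_at_topological by blast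
    have "sobolev_modular p \<Omega> (h \<eta>) \<le> B \<xi>" if \<eta>: "\<eta> \<in> U \<inter> unit_sphere k" for \<eta>
    proof -
      have lt: "sobolev_modular p \<Omega> (\<lambda>x. h \<eta> x - h \<xi> x) \<le> 1"
        using U(3)[of \<eta>] \<eta> sobolev_modular_zero[OF p \<Omega>] by (cases "\<eta> = \<xi>") auto
      have p0: "p \<ge> 0" using p by simp
      have "(\<lambda>x. h \<eta> x - h \<xi> x) \<in> W1p p \<Omega>"
        using W1p_linear[OF p0 \<Omega> W W, where a=1 and b="-1"] \<eta> \<xi> by simp
      from sobolev_modular_linear_le[OF p0 \<Omega> this W[OF \<xi>], of 1 1]
      have "sobolev_modular p \<Omega> (h \<eta>) \<le>
          2 powr p * (sobolev_modular p \<Omega> (\<lambda>x. h \<eta> x - h \<xi> x) + sobolev_modular p \<Omega> (h \<xi>))" by simp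
      also have "\<dots> \<le> B \<xi>" unfolding B_def using lt by (intro mult_left_mono) auto
      finally show ?thesis .
    qed
    with U show ?thesis by blast
  qed
  then obtain U where U: "\<And>\<xi>. \<xi> \<in> unit_sphere k \<Longrightarrow> open (U \<xi>) \<and> \<xi> \<in> U \<xi> \<and>
      (\<forall>\<eta>\<in>U \<xi> \<inter> unit_sphere k. sobolev_modular p \<Omega> (h \<eta>) \<le> B \<xi>)"
    by metis
  have "unit_sphere k \<subseteq> (\<Union>\<xi>\<in>unit_sphere k. U \<xi>)" using U by blast
  then obtain C where C: "C \<subseteq> unit_sphere k" "finite C" "unit_sphere k \<subseteq> (\<Union>\<xi>\<in>C. U \<xi>)"
    using compactE_image[OF compact_unit_sphere[OF k], of "unit_sphere k" U] U by auto
  have B0: "B \<xi> \<ge> 0" for \<xi> unfolding B_def using sobolev_modular_nonneg[of p \<Omega> "h \<xi>"] by simp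
  show thesis
  proof (rule that)
    show "(\<Sum>\<xi>\<in>C. B \<xi>) \<ge> 0" by (intro sum_nonneg B0)
    fix \<eta> assume \<eta>: "\<eta> \<in> unit_sphere k"
    then obtain \<xi> where \<xi>: "\<xi> \<in> C" "\<eta> \<in> U \<xi>" using C(3) by blast
    then have "sobolev_modular p \<Omega> (h \<eta>) \<le> B \<xi>" using U[of \<xi>] C(1) \<eta> by auto
    also have "\<dots> \<le> (\<Sum>\<xi>\<in>C. B \<xi>)" using \<xi> C(2) B0 by (intro member_le_sum) auto
    finally show "sobolev_modular p \<Omega> (h \<eta>) \<le> (\<Sum>\<xi>\<in>C. B \<xi>)" .
  qed
qed

text \<open>Membership of the partial sums in \<open>W1p\<close> is carried along in the conclusion,
  because the quasi-triangle inequality in the induction step requires it.\<close>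

lemma sobolev_modular_sum_tendsto_0:
  assumes p: "p \<ge> 0" "p > 0" and \<Omega>: "open \<Omega>" and J: "finite J"
    and W: "\<And>j \<eta>. j \<in> J \<Longrightarrow> f j \<eta> \<in> W1p p \<Omega>"
    and lim: "\<And>j. j \<in> J \<Longrightarrow> ((\<lambda>\<eta>. sobolev_modular p \<Omega> (f j \<eta>)) \<longlongrightarrow> 0) F"
  shows "(\<forall>\<eta>. (\<lambda>x. \<Sum>j\<in>J. f j \<eta> x) \<in> W1p p \<Omega>) \<and>
    ((\<lambda>\<eta>. sobolev_modular p \<Omega> (\<lambda>x. \<Sum>j\<in>J. f j \<eta> x)) \<longlongrightarrow> 0) F"
  using J W lim
proof (induction rule: finite_induct)
  case empty
  have "(\<lambda>x. 0) \<in> test_functions \<Omega>"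
    by (rule test_function_intro[of _ "{}"]) (auto simp: smooth_const)
  then have "(\<lambda>x. 0) \<in> W1p p \<Omega>" using test_function_W1p_0[OF p(2) _ \<Omega>] by (auto simp: W1p_0_def)
  then show ?case by (simp add: sobolev_modular_zero[OF p(2) \<Omega>])
next
  case (insert i I)
  then have 1: "\<And>\<eta>. f i \<eta> \<in> W1p p \<Omega>" "((\<lambda>\<eta>. sobolev_modular p \<Omega> (f i \<eta>)) \<longlongrightarrow> 0) F"
    and 2: "\<And>\<eta>. (\<lambda>x. \<Sum>j\<in>I. f j \<eta> x) \<in> W1p p \<Omega>"
      "((\<lambda>\<eta>. sobolev_modular p \<Omega> (\<lambda>x. \<Sum>j\<in>I. f j \<eta> x)) \<longlongrightarrow> 0) F"
    by auto
  have "((\<lambda>\<eta>. 2 powr p * (sobolev_modular p \<Omega> (f i \<eta>) + sobolev_modular p \<Omega> (\<lambda>x. \<Sum>j\<in>I. f j \<eta> x)))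
      \<longlongrightarrow> 2 powr p * (0 + 0)) F"
    by (intro tendsto_intros 1 2)
  then have l: "((\<lambda>\<eta>. 2 powr p * (sobolev_modular p \<Omega> (f i \<eta>) + sobolev_modular p \<Omega> (\<lambda>x. \<Sum>j\<in>I. f j \<eta> x)))
      \<longlongrightarrow> 0) F" by simp
  have "((\<lambda>\<eta>. sobolev_modular p \<Omega> (\<lambda>x. f i \<eta> x + (\<Sum>j\<in>I. f j \<eta> x))) \<longlongrightarrow> 0) F"
  proof (rule tendsto_sandwich[OF _ _ tendsto_const l])
    show "\<forall>\<^sub>F \<eta> in F. sobolev_modular p \<Omega> (\<lambda>x. f i \<eta> x + (\<Sum>j\<in>I. f j \<eta> x)) \<le>
       2 powr p * (sobolev_modular p \<Omega> (f i \<eta>) + sobolev_modular p \<Omega> (\<lambda>x. \<Sum>j\<in>I. f j \<eta> x))"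
      using sobolev_modular_linear_le[OF p(1) \<Omega> 1(1) 2(1), where a=1 and b=1] by simp
  qed (simp add: sobolev_modular_nonneg)
  moreover have "(\<lambda>x. f i \<eta> x + (\<Sum>j\<in>I. f j \<eta> x)) \<in> W1p p \<Omega>" for \<eta>
    using W1p_linear[OF p(1) \<Omega> 1(1) 2(1), where a=1 and b=1] by simp
  ultimately show ?case using insert by simp
qed

section \<open>Blocks of coordinates and the superposed map\<close>

definition block_norm :: "nat \<Rightarrow> nat \<Rightarrow> (nat \<Rightarrow> real) \<Rightarrow> real" where
  "block_norm m j \<xi> = sqrt (\<Sum>i<m. (\<xi> (j * m + i))\<^sup>2)"

text \<open>Where the block vanishes, the first unit vector serves as a default that stays on the
  sphere; in \<open>placed_map\<close> the coefficient of such a block is 0.\<close>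

definition block_direction :: "nat \<Rightarrow> nat \<Rightarrow> (nat \<Rightarrow> real) \<Rightarrow> nat \<Rightarrow> real" where
  "block_direction m j \<xi> =
    (if block_norm m j \<xi> = 0 then (\<lambda>i. if i = 0 then 1 else 0)
     else (\<lambda>i. if i < m then \<xi> (j * m + i) / block_norm m j \<xi> else 0))"

lemma block_norm_nonneg: "block_norm m j \<xi> \<ge> 0"
  by (simp add: block_norm_def sum_nonneg)

lemma block_norm_power2: "(block_norm m j \<xi>)\<^sup>2 = (\<Sum>i<m. (\<xi> (j * m + i))\<^sup>2)"
  by (simp add: block_norm_def sum_nonneg)

lemma block_direction_in_sphere:
  assumes "m \<ge> 1" shows "block_direction m j \<xi> \<in> unit_sphere m"
proof (cases "block_norm m j \<xi> = 0")
  case True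
  have "(\<lambda>n. if n = 0 then 1 else 0 :: real) \<in> unit_sphere m" unfolding unit_sphere_def by (rule in_topspace_nsphere)
  with True show ?thesis by (simp add: block_direction_def)
next
  case False
  have "(\<Sum>i<m. (\<xi> (j * m + i) / block_norm m j \<xi>)\<^sup>2) = (block_norm m j \<xi>)\<^sup>2 / (block_norm m j \<xi>)\<^sup>2"
    by (simp add: power_divide sum_divide_distrib[symmetric] block_norm_power2[symmetric])
  with False show ?thesis
    by (simp add: unit_sphere_iff[OF assms] block_direction_def)
qed

lemma sum_block_norm_power2:
  assumes "m * n \<ge> 1" "\<xi> \<in> unit_sphere (m * n)"
  shows "(\<Sum>j<n. (block_norm m j \<xi>)\<^sup>2) = 1"
proof -
  have "(\<Sum>j<n. (block_norm m j \<xi>)\<^sup>2) = (\<Sum>j<n. \<Sum>i=j * m..<j * m + m. (\<xi> i)\<^sup>2)"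
  proof (intro sum.cong refl)
    fix j
    show "(block_norm m j \<xi>)\<^sup>2 = (\<Sum>i=j * m..<j * m + m. (\<xi> i)\<^sup>2)"
      unfolding block_norm_power2 using sum.shift_bounds_nat_ivl[of "\<lambda>i. (\<xi> i)\<^sup>2" 0 "j * m" m]
      by (simp add: add.commute lessThan_atLeast0)
  qed
  also have "\<dots> = (\<Sum>i<n * m. (\<xi> i)\<^sup>2)" by (rule sum.nat_group)
  finally show ?thesis using assms by (simp add: unit_sphere_iff mult.commute)
qed

lemma block_norm_minus: "block_norm m j (\<lambda>i. - \<xi> i) = block_norm m j \<xi>"
  by (simp add: block_norm_def)

lemma block_direction_minus:
  "block_norm m j \<xi> \<noteq> 0 \<Longrightarrow> block_direction m j (\<lambda>i. - \<xi> i) = (\<lambda>i. - block_direction m j \<xi> i)"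
  by (auto simp: block_direction_def block_norm_minus fun_eq_iff)

lemma continuous_on_block_norm: "continuous_on A (block_norm m j)"
  unfolding block_norm_def
  by (intro continuous_intros continuous_on_subset[OF continuous_on_product_coordinates]) auto

lemma continuous_on_block_direction: "continuous_on {\<xi>. block_norm m j \<xi> \<noteq> 0} (block_direction m j)"
proof (rule continuous_on_coordinatewise_then_product)
  fix i
  have "continuous_on {\<xi>. block_norm m j \<xi> \<noteq> 0} (\<lambda>\<xi>. if i < m then \<xi> (j * m + i) / block_norm m j \<xi> else 0)"
    by (cases "i < m") (auto intro!: continuous_intros continuous_on_block_norm
      continuous_on_subset[OF continuous_on_product_coordinates])
  then show "continuous_on {\<xi>. block_norm m j \<xi> \<noteq> 0} (\<lambda>\<xi>. block_direction m j \<xi> i)"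
    by (rule continuous_on_eq) (simp add: block_direction_def)
qed

text \<open>Unlike \<open>at\<close>, the filter in the conclusion includes the point itself, so that it can be composed with
  maps that are not injective.\<close>

lemma tendsto_inf_nhds_principal:
  assumes "(f \<longlongrightarrow> f \<xi>) (at \<xi> within S)"
  shows "(f \<longlongrightarrow> f \<xi>) (inf (nhds \<xi>) (principal S))"
proof (rule topological_tendstoI)
  fix T assume T: "open T" "f \<xi> \<in> T"
  have "\<forall>\<^sub>F x in at \<xi> within S. f x \<in> T" by (rule topological_tendstoD[OF assms T])
  then have "\<forall>\<^sub>F x in nhds \<xi>. x \<noteq> \<xi> \<longrightarrow> x \<in> S \<longrightarrow> f x \<in> T" by (simp add: eventually_at_filter)
  then have "\<forall>\<^sub>F x in nhds \<xi>. x \<in> S \<longrightarrow> f x \<in> T"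
    by (rule eventually_mono) (use T in auto)
  then show "\<forall>\<^sub>F x in inf (nhds \<xi>) (principal S). f x \<in> T"
    by (simp add: eventually_inf_principal)
qed

text \<open>In topological terms an n-fold join of \<open>h\<close> with itself, the sphere of
  dimension mn - 1 being the join of n spheres of dimension m - 1.\<close>

definition placed_map ::
  "real \<Rightarrow> (real^'n) set \<Rightarrow> real \<Rightarrow> nat \<Rightarrow> nat \<Rightarrow> (nat \<Rightarrow> real^'n) \<Rightarrow>
    ((nat \<Rightarrow> real) \<Rightarrow> real^'n \<Rightarrow> real) \<Rightarrow> (nat \<Rightarrow> real) \<Rightarrow> real^'n \<Rightarrow> real" where
  "placed_map p D s m n b h \<xi> y =
     (\<Sum>j<n. block_norm m j \<xi> powr (2 / p) * place p D s (b j) (h (block_direction m j \<xi>)) y)"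

locale placed_tiles =
  fixes p s :: real and D \<Omega> :: "(real^'n) set" and n :: nat and b :: "nat \<Rightarrow> real^'n"
    and m :: nat and h :: "(nat \<Rightarrow> real) \<Rightarrow> real^'n \<Rightarrow> real"
  assumes pl: "\<And>j. j < n \<Longrightarrow> placement p s D \<Omega> (b j)"
    and disj: "\<And>i j y. i < n \<Longrightarrow> j < n \<Longrightarrow> i \<noteq> j \<Longrightarrow> b i + s *\<^sub>R y \<in> D \<Longrightarrow> b j + s *\<^sub>R y \<notin> D"
    and p: "p > 1" and D: "open D" and \<Omega>: "open \<Omega>" and m: "m \<ge> 1" and n: "n \<ge> 1"
    and h: "h \<in> odd_sphere_maps p D m"
begin

lemma p0: "p > 0" "p \<ge> 0"
  using p by auto

lemma h_unit: "\<zeta> \<in> unit_sphere m \<Longrightarrow> h \<zeta> \<in> unit_Lp_sphere p D"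
  using h unfolding odd_sphere_maps_iff[OF p0(1)] by blast

lemma h_dir: "h (block_direction m j \<xi>) \<in> W1p_0 p D"
  using h_unit block_direction_in_sphere[OF m] unit_Lp_sphereD(1) by blast

lemma coeff_powr: "\<bar>block_norm m j \<xi> powr (2 / p)\<bar> powr p = (block_norm m j \<xi>)\<^sup>2"
  using p by (simp add: powr_powr block_norm_nonneg)

lemma placed_map_W1p_0: "placed_map p D s m n b h \<xi> \<in> W1p_0 p \<Omega>"
  unfolding placed_map_def[abs_def]
  by (rule placed_sum(1)[OF _ pl disj]) (auto intro: h_dir p0 \<Omega>)

lemma placed_map_integral:
  assumes "\<xi> \<in> unit_sphere (m * n)"
  shows "(\<integral>y. \<bar>placed_map p D s m n b h \<xi> y\<bar> powr p \<partial>lebesgue_on \<Omega>) = 1"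
proof -
  have "(\<integral>y. \<bar>placed_map p D s m n b h \<xi> y\<bar> powr p \<partial>lebesgue_on \<Omega>) =
     (\<Sum>j<n. \<bar>block_norm m j \<xi> powr (2 / p)\<bar> powr p * (\<integral>x. \<bar>h (block_direction m j \<xi>) x\<bar> powr p \<partial>lebesgue_on D))"
    unfolding placed_map_def by (rule placed_sum(2)[OF _ pl disj]) (auto intro: h_dir p0 \<Omega>)
  also have "\<dots> = (\<Sum>j<n. (block_norm m j \<xi>)\<^sup>2)"
    unfolding coeff_powr using unit_Lp_sphereD(3)[OF h_unit[OF block_direction_in_sphere[OF m]]] by simp
  also have "\<dots> = 1" using m n assms by (intro sum_block_norm_power2) auto
  finally show ?thesis .
qed

lemma placed_map_energy:
  assumes "\<xi> \<in> unit_sphere (m * n)" and E: "\<And>\<zeta>. \<zeta> \<in> unit_sphere m \<Longrightarrow> energy p D (h \<zeta>) \<le> E"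
  shows "energy p \<Omega> (placed_map p D s m n b h \<xi>) \<le> s powr p * E"
proof -
  have "energy p \<Omega> (placed_map p D s m n b h \<xi>) =
     s powr p * (\<Sum>j<n. \<bar>block_norm m j \<xi> powr (2 / p)\<bar> powr p * energy p D (h (block_direction m j \<xi>)))"
    unfolding placed_map_def[abs_def] by (rule placed_sum(3)[OF _ pl disj]) (auto intro: h_dir p0 \<Omega>)
  also have "\<dots> \<le> s powr p * (\<Sum>j<n. (block_norm m j \<xi>)\<^sup>2 * E)"
    unfolding coeff_powr
    by (intro mult_left_mono sum_mono E block_direction_in_sphere[OF m]) auto
  also have "\<dots> = s powr p * E"
    using sum_block_norm_power2[of m n \<xi>] m n assms(1) by (simp add: sum_distrib_right[symmetric])
  finally show ?thesis .
qed

text \<open>Oddness of \<open>h\<close> holds up to null sets that depend on the direction. It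
  passes through the placement by way of integrals: the sum of the values of \<open>h\<close> at
  antipodal points has L^p norm 0, placement preserves this norm, and norm 0 means zero almost
  everywhere.\<close>

lemma placed_map_odd:
  shows "AE y in lebesgue_on \<Omega>. placed_map p D s m n b h (\<lambda>i. - \<xi> i) y = - placed_map p D s m n b h \<xi> y"
proof -
  have "AE y in lebesgue_on \<Omega>. block_norm m j (\<lambda>i. - \<xi> i) powr (2 / p) *
        place p D s (b j) (h (block_direction m j (\<lambda>i. - \<xi> i))) y =
      - (block_norm m j \<xi> powr (2 / p) * place p D s (b j) (h (block_direction m j \<xi>)) y)"
    if j: "j < n" for j
  proof (cases "block_norm m j \<xi> = 0")
    \<comment> \<open>The default direction is not odd, but its coefficient is 0.\<close>
    case True then show ?thesis by (simp add: block_norm_minus)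
  next
    case False
    let ?d = "block_direction m j \<xi>"
    let ?w = "\<lambda>x. h (\<lambda>i. - ?d i) x + h ?d x"
    have d: "?d \<in> unit_sphere m" by (rule block_direction_in_sphere[OF m])
    have eqd: "block_direction m j (\<lambda>i. - \<xi> i) = (\<lambda>i. - ?d i)" by (rule block_direction_minus[OF False])
    have W: "?w \<in> W1p_0 p D"
      using W1p_0_linear[OF p0(1) D h_dir[of j "\<lambda>i. - \<xi> i"] h_dir[of j \<xi>], where a=1 and b=1]
      by (simp add: eqd)
    have ae: "AE x in lebesgue_on D. h (\<lambda>i. - ?d i) x = - h ?d x"
      using h d unfolding odd_sphere_maps_iff[OF p0(1)] by blast
    have "(\<integral>x. \<bar>?w x\<bar> powr p \<partial>lebesgue_on D) = 0"
      using ae by (intro integral_eq_zero_AE) (auto elim!: eventually_mono)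
    then have "(\<integral>y. \<bar>place p D s (b j) ?w y\<bar> powr p \<partial>lebesgue_on \<Omega>) = 0"
      using placement.place_Lp_integral(1)[OF pl[OF j] W] by simp
    moreover have "integrable (lebesgue_on \<Omega>) (\<lambda>y. \<bar>place p D s (b j) ?w y\<bar> powr p)"
      using placement.place_Lp_integral(2)[OF pl[OF j] W] by (simp add: Lp_def)
    ultimately have "AE y in lebesgue_on \<Omega>. \<bar>place p D s (b j) ?w y\<bar> powr p = 0"
      by (subst (asm) integral_nonneg_eq_0_iff_AE) auto
    then show ?thesis
    proof eventually_elim
      case (elim y)
      have "place p D s (b j) ?w y = place p D s (b j) (h (\<lambda>i. - ?d i)) y + place p D s (b j) (h ?d) y"
        using place_linear[of p D s "b j" 1 "h (\<lambda>i. - ?d i)" 1 "h ?d" y] by simp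
      with elim have "place p D s (b j) (h (\<lambda>i. - ?d i)) y = - place p D s (b j) (h ?d) y" by simp
      then show ?case by (simp add: block_norm_minus eqd)
    qed
  qed
  then have "AE y in lebesgue_on \<Omega>. \<forall>j\<in>{..<n}. block_norm m j (\<lambda>i. - \<xi> i) powr (2 / p) *
        place p D s (b j) (h (block_direction m j (\<lambda>i. - \<xi> i))) y =
      - (block_norm m j \<xi> powr (2 / p) * place p D s (b j) (h (block_direction m j \<xi>)) y)"
    by (intro AE_finite_allI) auto
  then show ?thesis
    by eventually_elim (simp add: placed_map_def sum_negf)
qed

text \<open>Where the block of \<xi> vanishes, the directions need not converge, but the coefficient
  tends to 0 and \<open>h\<close> is bounded. Elsewhere coefficient and direction are both
  continuous at \<xi>.\<close>

lemma piece_tendsto: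
  assumes j: "j < n"
  shows "((\<lambda>\<eta>. sobolev_modular p \<Omega> (\<lambda>y.
      block_norm m j \<eta> powr (2 / p) * place p D s (b j) (h (block_direction m j \<eta>)) y -
      block_norm m j \<xi> powr (2 / p) * place p D s (b j) (h (block_direction m j \<xi>)) y)) \<longlongrightarrow> 0)
      (at \<xi> within A)"
proof -
  interpret placement p s D \<Omega> "b j" by (rule pl[OF j])
  let ?t = "\<lambda>\<eta>. block_norm m j \<eta> powr (2 / p)"
  let ?d = "block_direction m j"
  let ?P = "place p D s (b j)"
  let ?c = "1 + s powr p"
  have dS: "?d \<eta> \<in> unit_sphere m" for \<eta> by (rule block_direction_in_sphere[OF m])
  have W: "?P (h (?d \<eta>)) \<in> W1p p \<Omega>" for \<eta> by (rule place_energy(2)[OF h_dir])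
  have r: "(block_norm m j \<longlongrightarrow> block_norm m j \<xi>) (at \<xi> within A)"
    using continuous_on_block_norm[of UNIV m j] by (auto simp: continuous_on_def intro: tendsto_within_subset)
  have t: "(?t \<longlongrightarrow> ?t \<xi>) (at \<xi> within A)"
    using p by (intro tendsto_powr'[OF r tendsto_const]) (auto simp: block_norm_nonneg)
  have tp: "((\<lambda>\<eta>. \<bar>?t \<eta> - ?t \<xi>\<bar> powr p) \<longlongrightarrow> 0) (at \<xi> within A)"
  proof (rule tendsto_zero_powrI[OF _ tendsto_const])
    show "((\<lambda>\<eta>. \<bar>?t \<eta> - ?t \<xi>\<bar>) \<longlongrightarrow> 0) (at \<xi> within A)"
      using tendsto_rabs[OF tendsto_diff[OF t tendsto_const[of "?t \<xi>"]]] by simp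
  qed (use p in auto)
  show ?thesis
  proof (cases "block_norm m j \<xi> = 0")
    case True
    obtain B where B: "B \<ge> 0" "\<And>\<zeta>. \<zeta> \<in> unit_sphere m \<Longrightarrow> sobolev_modular p D (h \<zeta>) \<le> B"
      using odd_sphere_map_bounded[OF p0(1) D(1) m h] by blast
    \<comment> \<open>Since \<open>?t \<xi>\<close> is 0 here, the coefficient may be written as a
      difference, to which \<open>tp\<close> applies. In the estimate below, the second summand with
      coefficient 0 only provides the shape of \<open>sobolev_modular_linear_le\<close>.\<close>
    have le: "sobolev_modular p \<Omega> (\<lambda>y. ?t \<eta> * ?P (h (?d \<eta>)) y - ?t \<xi> * ?P (h (?d \<xi>)) y) \<le>
        2 powr p * (\<bar>?t \<eta> - ?t \<xi>\<bar> powr p * (?c * B))" for \<eta>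
    proof -
      have "sobolev_modular p \<Omega> (\<lambda>y. ?t \<eta> * ?P (h (?d \<eta>)) y + 0 * ?P (h (?d \<eta>)) y) \<le>
        2 powr p * (\<bar>?t \<eta>\<bar> powr p * sobolev_modular p \<Omega> (?P (h (?d \<eta>))) + \<bar>0\<bar> powr p * sobolev_modular p \<Omega> (?P (h (?d \<eta>))))"
        by (rule sobolev_modular_linear_le[OF p0(2) \<Omega> W W])
      also have "\<dots> \<le> 2 powr p * (\<bar>?t \<eta>\<bar> powr p * (?c * B))"
      proof -
        have "sobolev_modular p \<Omega> (?P (h (?d \<eta>))) \<le> ?c * sobolev_modular p D (h (?d \<eta>))"
          by (rule place_sobolev_modular_le[OF h_dir])
        also have "\<dots> \<le> ?c * B" by (intro mult_left_mono B dS) (simp add: add_nonneg_nonneg)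
        finally have "sobolev_modular p \<Omega> (?P (h (?d \<eta>))) \<le> ?c * B" .
        then have "\<bar>?t \<eta>\<bar> powr p * sobolev_modular p \<Omega> (?P (h (?d \<eta>))) \<le> \<bar>?t \<eta>\<bar> powr p * (?c * B)"
          by (intro mult_left_mono) auto
        then show ?thesis by simp
      qed
      finally show ?thesis using True by simp
    qed
    have "((\<lambda>\<eta>. 2 powr p * (\<bar>?t \<eta> - ?t \<xi>\<bar> powr p * (?c * B))) \<longlongrightarrow> 2 powr p * (0 * (?c * B))) (at \<xi> within A)"
      by (intro tendsto_mult tendsto_const tp)
    then have l: "((\<lambda>\<eta>. 2 powr p * (\<bar>?t \<eta> - ?t \<xi>\<bar> powr p * (?c * B))) \<longlongrightarrow> 0) (at \<xi> within A)" by simp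
    show ?thesis
      by (rule tendsto_sandwich[OF _ _ tendsto_const l])
         (intro always_eventually allI le sobolev_modular_nonneg)+
  next
    case False
    let ?M = "\<lambda>\<zeta>. sobolev_modular p D (\<lambda>x. h \<zeta> x - h (?d \<xi>) x)"
    have "(?M \<longlongrightarrow> ?M (?d \<xi>)) (at (?d \<xi>) within unit_sphere m)"
      using h dS sobolev_modular_zero[OF p0(1) D(1)] unfolding odd_sphere_maps_iff[OF p0(1)] by auto
    then have lim: "(?M \<longlongrightarrow> ?M (?d \<xi>)) (inf (nhds (?d \<xi>)) (principal (unit_sphere m)))"
      by (rule tendsto_inf_nhds_principal)
    have "filterlim ?d (inf (nhds (?d \<xi>)) (principal (unit_sphere m))) (at \<xi> within A)"
      unfolding filterlim_inf filterlim_principal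
    proof
      have op: "open {\<xi>. block_norm m j \<xi> \<noteq> 0}"
        using open_Collect_neq[OF continuous_on_block_norm continuous_on_const] .
      have "(?d \<longlongrightarrow> ?d \<xi>) (at \<xi>)"
        using continuous_on_interior[OF continuous_on_block_direction[of m j], of \<xi>] False
        unfolding isCont_def interior_open[OF op] by blast
      then show "(?d \<longlongrightarrow> ?d \<xi>) (at \<xi> within A)" by (rule tendsto_within_subset) simp
      show "\<forall>\<^sub>F \<eta> in at \<xi> within A. ?d \<eta> \<in> unit_sphere m" by (intro always_eventually allI dS)
    qed
    from filterlim_compose[OF lim this]
    have "((\<lambda>\<eta>. ?M (?d \<eta>)) \<longlongrightarrow> ?M (?d \<xi>)) (at \<xi> within A)" .
    then have M: "((\<lambda>\<eta>. ?M (?d \<eta>)) \<longlongrightarrow> 0) (at \<xi> within A)"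
      using sobolev_modular_zero[OF p0(1) D(1)] by simp
    have Wd: "(\<lambda>x. h (?d \<eta>) x - h (?d \<xi>) x) \<in> W1p_0 p D" for \<eta>
      using W1p_0_linear[OF p0(1) D(1) h_dir h_dir, where a=1 and b="-1"] by simp
    let ?B = "\<lambda>\<eta>. 2 powr p * (\<bar>?t \<eta>\<bar> powr p * (?c * ?M (?d \<eta>)) +
        \<bar>?t \<eta> - ?t \<xi>\<bar> powr p * sobolev_modular p \<Omega> (?P (h (?d \<xi>))))"
    \<comment> \<open>Telescoping: the difference of the two products is \<open>?t \<eta>\<close>
      times the change of the function, plus the change of the coefficient times the fixed function
      at \<xi>.\<close>
    have le: "sobolev_modular p \<Omega> (\<lambda>y. ?t \<eta> * ?P (h (?d \<eta>)) y - ?t \<xi> * ?P (h (?d \<xi>)) y) \<le> ?B \<eta>" for \<eta>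
    proof -
      have eq: "?P (\<lambda>x. h (?d \<eta>) x - h (?d \<xi>) x) y = ?P (h (?d \<eta>)) y - ?P (h (?d \<xi>)) y" for y
        using place_linear[of p D s "b j" 1 "h (?d \<eta>)" "-1" "h (?d \<xi>)" y] by simp
      have "sobolev_modular p \<Omega> (\<lambda>y. ?t \<eta> * ?P (\<lambda>x. h (?d \<eta>) x - h (?d \<xi>) x) y + (?t \<eta> - ?t \<xi>) * ?P (h (?d \<xi>)) y) \<le>
        2 powr p * (\<bar>?t \<eta>\<bar> powr p * sobolev_modular p \<Omega> (?P (\<lambda>x. h (?d \<eta>) x - h (?d \<xi>) x)) +
          \<bar>?t \<eta> - ?t \<xi>\<bar> powr p * sobolev_modular p \<Omega> (?P (h (?d \<xi>))))"
        by (rule sobolev_modular_linear_le[OF p0(2) \<Omega> place_energy(2)[OF Wd] W])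
      also have "\<dots> \<le> ?B \<eta>"
        by (intro mult_left_mono add_right_mono place_sobolev_modular_le[OF Wd]) auto
      finally show ?thesis unfolding eq by (simp add: algebra_simps)
    qed
    have "((\<lambda>\<eta>. \<bar>?t \<eta>\<bar> powr p) \<longlongrightarrow> \<bar>?t \<xi>\<bar> powr p) (at \<xi> within A)"
      using p by (intro tendsto_powr'[OF tendsto_rabs[OF t] tendsto_const]) auto
    then have "(?B \<longlongrightarrow> 2 powr p * (\<bar>?t \<xi>\<bar> powr p * (?c * 0) + 0 * sobolev_modular p \<Omega> (?P (h (?d \<xi>))))) (at \<xi> within A)"
      by (intro tendsto_mult tendsto_add tendsto_const tp M)
    then have l: "(?B \<longlongrightarrow> 0) (at \<xi> within A)" by simp
    show ?thesis
      by (rule tendsto_sandwich[OF _ _ tendsto_const l])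
         (intro always_eventually allI le sobolev_modular_nonneg)+
  qed
qed

lemma placed_map_odd_sphere_map: "placed_map p D s m n b h \<in> odd_sphere_maps p \<Omega> (m * n)"
  unfolding odd_sphere_maps_iff[OF p0(1)]
proof (intro conjI ballI)
  fix \<xi> assume \<xi>: "\<xi> \<in> unit_sphere (m * n)"
  show "placed_map p D s m n b h \<xi> \<in> unit_Lp_sphere p \<Omega>"
    using placed_map_W1p_0 placed_map_integral[OF \<xi>] by (simp add: unit_Lp_sphere_def)
  show "AE y in lebesgue_on \<Omega>. placed_map p D s m n b h (\<lambda>i. - \<xi> i) y = - placed_map p D s m n b h \<xi> y"
    by (rule placed_map_odd)
  let ?f = "\<lambda>j \<eta> y. block_norm m j \<eta> powr (2 / p) * place p D s (b j) (h (block_direction m j \<eta>)) y -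
      block_norm m j \<xi> powr (2 / p) * place p D s (b j) (h (block_direction m j \<xi>)) y"
  have W: "place p D s (b j) (h (block_direction m j \<eta>)) \<in> W1p p \<Omega>" if "j < n" for j \<eta>
    by (rule placement.place_energy(2)[OF pl[OF that] h_dir])
  have "((\<lambda>\<eta>. sobolev_modular p \<Omega> (\<lambda>y. \<Sum>j<n. ?f j \<eta> y)) \<longlongrightarrow> 0) (at \<xi> within unit_sphere (m * n))"
  proof (rule sobolev_modular_sum_tendsto_0[OF p0(2,1) \<Omega> _ _ _, THEN conjunct2])
    show "?f j \<eta> \<in> W1p p \<Omega>" if "j \<in> {..<n}" for j \<eta>
      using W1p_linear[OF p0(2) \<Omega> W W, where a = "block_norm m j \<eta> powr (2 / p)"
        and b = "- (block_norm m j \<xi> powr (2 / p))"] that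
      by simp
    show "((\<lambda>\<eta>. sobolev_modular p \<Omega> (?f j \<eta>)) \<longlongrightarrow> 0) (at \<xi> within unit_sphere (m * n))" if "j \<in> {..<n}" for j
      using piece_tendsto that by simp
  qed simp
  then show "((\<lambda>\<eta>. sobolev_modular p \<Omega> (\<lambda>y. placed_map p D s m n b h \<eta> y - placed_map p D s m n b h \<xi> y)) \<longlongrightarrow> 0)
      (at \<xi> within unit_sphere (m * n))"
    by (simp add: placed_map_def sum_subtractf)
qed

end

section \<open>Comparison of cogenus eigenvalues\<close>

lemma odd_sphere_map_energy_bdd:
  assumes "p > 0" "open \<Omega>" "k \<ge> 1" "h \<in> odd_sphere_maps p \<Omega> k"
  shows "bdd_above ((\<lambda>\<xi>. energy p \<Omega> (h \<xi>)) ` unit_sphere k)"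
proof -
  obtain B where B: "\<And>\<xi>. \<xi> \<in> unit_sphere k \<Longrightarrow> sobolev_modular p \<Omega> (h \<xi>) \<le> B"
    using odd_sphere_map_bounded[OF assms] by blast
  show ?thesis
    by (rule bdd_aboveI2[where M = B]) (rule order_trans[OF energy_le_sobolev_modular B])
qed

lemma cogenus_eigenvalue_le:
  assumes "p > 0" "open \<Omega>" "k \<ge> 1" "h \<in> odd_sphere_maps p \<Omega> k"
    and E: "\<And>\<xi>. \<xi> \<in> unit_sphere k \<Longrightarrow> energy p \<Omega> (h \<xi>) \<le> E"
  shows "cogenus_eigenvalue p \<Omega> k \<le> E"
proof -
  have ne: "unit_sphere k \<noteq> {}" using in_topspace_nsphere unfolding unit_sphere_def by blast
  have "cogenus_eigenvalue p \<Omega> k \<le> (SUP \<xi>\<in>unit_sphere k. energy p \<Omega> (h \<xi>))"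
    unfolding cogenus_eigenvalue_def unit_sphere_def[symmetric]
  proof (rule cINF_lower[OF _ assms(4)])
    \<comment> \<open>A real infimum is a lower bound only for a family bounded below. Here 0 bounds
      it, because each supremum is over a bounded set and dominates a nonnegative energy.\<close>
    show "bdd_below ((\<lambda>h. SUP \<xi>\<in>unit_sphere k. energy p \<Omega> (h \<xi>)) ` odd_sphere_maps p \<Omega> k)"
    proof (rule bdd_belowI2[of _ 0])
      fix g assume g: "g \<in> odd_sphere_maps p \<Omega> k"
      obtain \<xi> where \<xi>: "\<xi> \<in> unit_sphere k" using ne by blast
      have "0 \<le> energy p \<Omega> (g \<xi>)" by (rule energy_nonneg)
      also have "\<dots> \<le> (SUP \<xi>\<in>unit_sphere k. energy p \<Omega> (g \<xi>))"
        by (rule cSUP_upper[OF \<xi> odd_sphere_map_energy_bdd[OF assms(1-3) g]])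
      finally show "0 \<le> (SUP \<xi>\<in>unit_sphere k. energy p \<Omega> (g \<xi>))" .
    qed
  qed
  also have "\<dots> \<le> E" using ne E by (rule cSUP_least)
  finally show ?thesis .
qed

text \<open>Each competitor on \<open>D\<close> yields one on \<open>\<Omega>\<close> whose maximal
  energy is at most \<open>s powr p\<close> times as large. The factor is divided out first, so that
  the left side becomes a lower bound of the family of competitors on \<open>D\<close>.\<close>

lemma cogenus_eigenvalue_tiles_le:
  assumes "\<And>j. j < n \<Longrightarrow> placement p s D \<Omega> (b j)"
    and "\<And>i j y. i < n \<Longrightarrow> j < n \<Longrightarrow> i \<noteq> j \<Longrightarrow> b i + s *\<^sub>R y \<in> D \<Longrightarrow> b j + s *\<^sub>R y \<notin> D"
    and p: "p > 1" and s: "s > 0" and D: "open D" and \<Omega>: "open \<Omega>" and m: "m \<ge> 1" and n: "n \<ge> 1"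
    and ne: "odd_sphere_maps p D m \<noteq> {}"
  shows "cogenus_eigenvalue p \<Omega> (m * n) \<le> s powr p * cogenus_eigenvalue p D m"
proof -
  have "cogenus_eigenvalue p \<Omega> (m * n) / s powr p \<le> cogenus_eigenvalue p D m"
    unfolding cogenus_eigenvalue_def[of p D] unit_sphere_def[symmetric]
  proof (rule cINF_greatest[OF ne])
    fix h assume h: "h \<in> odd_sphere_maps p D m"
    interpret placed_tiles p s D \<Omega> n b m h
      by (rule placed_tiles.intro) (fact assms h)+
    let ?E = "SUP \<zeta>\<in>unit_sphere m. energy p D (h \<zeta>)"
    have E: "energy p D (h \<zeta>) \<le> ?E" if "\<zeta> \<in> unit_sphere m" for \<zeta>
      using odd_sphere_map_energy_bdd[OF _ D m h] p that by (intro cSUP_upper) auto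
    have "cogenus_eigenvalue p \<Omega> (m * n) \<le> s powr p * ?E"
      using m n by (intro cogenus_eigenvalue_le[OF _ \<Omega> _ placed_map_odd_sphere_map] placed_map_energy E p0) auto
    then show "cogenus_eigenvalue p \<Omega> (m * n) / s powr p \<le> ?E"
      using s by (simp add: field_simps)
  qed
  then show ?thesis using s by (simp add: field_simps)
qed

text \<open>Points of spheres are sequences padded with zeros, so the smaller sphere is literally a
  subset of the larger one.\<close>

lemma odd_sphere_maps_restrict:
  assumes p: "p > 0" and mk: "1 \<le> m" "m \<le> k" and h: "h \<in> odd_sphere_maps p \<Omega> k"
  shows "h \<in> odd_sphere_maps p \<Omega> m"
proof -
  have "\<xi> \<in> unit_sphere k" if "\<xi> \<in> unit_sphere m" for \<xi>
  proof -
    have \<xi>: "(\<Sum>i<m. (\<xi> i)\<^sup>2) = 1" "\<forall>i\<ge>m. \<xi> i = 0" using that unit_sphere_iff[OF mk(1)] by auto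
    have "(\<Sum>i<k. (\<xi> i)\<^sup>2) = (\<Sum>i<m. (\<xi> i)\<^sup>2)"
      using mk \<xi> by (intro sum.mono_neutral_right) auto
    then show ?thesis using \<xi> mk by (subst unit_sphere_iff) auto
  qed
  then have sub: "unit_sphere m \<subseteq> unit_sphere k" by blast
  then show ?thesis
    using h unfolding odd_sphere_maps_iff[OF p] by (auto intro: tendsto_within_subset)
qed

lemma open_bounded_measure_pos:
  fixes S :: "(real^'n) set"
  assumes "open S" "bounded S" "S \<noteq> {}"
  shows "measure lebesgue S > 0"
proof -
  have "measure lebesgue S \<noteq> 0"
    using assms open_not_negligible negligible_iff_measure0 lmeasurable_open by metis
  then show ?thesis using measure_nonneg[of lebesgue S] by linarith
qed

text \<open>The infimum over an empty set would be a constant not depending on the index, contradicting the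
  growth of the eigenvalues. This spares constructing odd maps by hand.\<close>

lemma odd_sphere_maps_nonempty:
  fixes \<Omega> :: "(real^'n) set"
  assumes w: "is_weyl_constant TYPE('n) p C" and \<Omega>: "bounded_lipschitz_domain \<Omega>" and p: "p > 0" and m: "m \<ge> 1"
  shows "odd_sphere_maps p \<Omega> m \<noteq> {}"
proof
  assume empty: "odd_sphere_maps p \<Omega> m = {}"
  define c where "c = Inf ({} :: real set)"
  let ?a = "p / real CARD('n)"
  have a: "?a > 0" using p by simp
  have "\<forall>\<^sub>F k in sequentially. cogenus_eigenvalue p \<Omega> k = c"
  proof (rule eventually_sequentiallyI[of m])
    fix k assume "m \<le> k"
    \<comment> \<open>A map on the larger sphere would restrict to one on the smaller
      sphere.\<close>
    then have "odd_sphere_maps p \<Omega> k = {}"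
      using empty odd_sphere_maps_restrict[OF p m] by blast
    then show "cogenus_eigenvalue p \<Omega> k = c" by (simp add: cogenus_eigenvalue_def c_def)
  qed
  then have ev: "\<forall>\<^sub>F k in sequentially. c * real k powr (- ?a) = cogenus_eigenvalue p \<Omega> k * real k powr (- p / real CARD('n))"
    by (rule eventually_mono) simp
  have "(\<lambda>k. real k powr (- ?a)) \<longlonglongrightarrow> 0"
    using a by (intro tendsto_neg_powr filterlim_real_sequentially) auto
  from tendsto_mult_left[OF this, of c] have "(\<lambda>k. c * real k powr (- ?a)) \<longlonglongrightarrow> 0" by simp
  from Lim_transform_eventually[OF this ev]
  have "(\<lambda>k. cogenus_eigenvalue p \<Omega> k * real k powr (- p / real CARD('n))) \<longlonglongrightarrow> 0" .
  moreover have "(\<lambda>k. cogenus_eigenvalue p \<Omega> k * real k powr (- p / real CARD('n)))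
      \<longlonglongrightarrow> C * measure lebesgue \<Omega> powr (- p / real CARD('n))"
    using w \<Omega> by (simp add: is_weyl_constant_def)
  ultimately have "C * measure lebesgue \<Omega> powr (- p / real CARD('n)) = 0"
    using LIMSEQ_unique by blast
  moreover have "C > 0" using w by (simp add: is_weyl_constant_def)
  moreover have "measure lebesgue \<Omega> > 0"
    using \<Omega> by (intro open_bounded_measure_pos) (auto simp: bounded_lipschitz_domain_def is_domain_def)
  ultimately show False by simp
qed

section \<open>Counting tiles\<close>

text \<open>Near each of its points the frontier is contained in the graph of a Lipschitz function
  over a hyperplane, that is, in a Lipschitz image of a null set. By compactness finitely many such
  neighbourhoods cover it.\<close>

lemma negligible_lipschitz_frontier:
  fixes \<Omega> :: "(real^'n) set"
  assumes \<Omega>: "open \<Omega>" "bounded \<Omega>" and lip: "lipschitz_boundary \<Omega>"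
  shows "negligible (frontier \<Omega>)"
proof -
  have "\<exists>r>0. negligible (frontier \<Omega> \<inter> ball x r)" if x: "x \<in> frontier \<Omega>" for x
  proof -
    obtain r e \<gamma> L where r: "r > 0" "norm e = 1" and \<gamma>: "L-lipschitz_on {y. y \<bullet> e = 0} \<gamma>"
      and eq: "\<Omega> \<inter> ball x r = {y \<in> ball x r. \<gamma> (y - (y \<bullet> e) *\<^sub>R e) < y \<bullet> e}"
      using lip x unfolding lipschitz_boundary_def by blast
    have ee: "e \<bullet> e = 1" using r(2) by (simp add: norm_eq_1)
    define P where "P = (\<lambda>y. y - (y \<bullet> e) *\<^sub>R e)"
    have P0: "P y \<bullet> e = 0" for y by (simp add: P_def inner_diff_left ee)
    have cont: "continuous_on UNIV (\<lambda>y. \<gamma> (P y))"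
      by (rule continuous_on_compose2[OF lipschitz_on_continuous_on[OF \<gamma>]])
         (auto simp: P0, auto simp: P_def intro!: continuous_intros)
    \<comment> \<open>Parametrizes the graph of \<open>\<gamma>\<close> by the hyperplane orthogonal
      to \<open>e\<close>, where it is Lipschitz with constant \<open>1 + L\<close>.\<close>
    define F where "F = (\<lambda>z. z + \<gamma> z *\<^sub>R e)"
    have "frontier \<Omega> \<inter> ball x r \<subseteq> F ` {z. z \<bullet> e = 0}"
    proof
      fix y assume y: "y \<in> frontier \<Omega> \<inter> ball x r"
      then have "y \<notin> \<Omega>" "y \<in> closure \<Omega>" using \<Omega>(1) by (auto simp: frontier_def interior_open)
      have "\<not> \<gamma> (P y) < y \<bullet> e" using eq y \<open>y \<notin> \<Omega>\<close> unfolding P_def by blast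
      \<comment> \<open>A point strictly below the graph has a neighbourhood free of
        \<open>\<Omega>\<close>, whereas the frontier lies in the closure.\<close>
      moreover have "\<not> \<gamma> (P y) > y \<bullet> e"
      proof
        assume gt: "\<gamma> (P y) > y \<bullet> e"
        define U where "U = ball x r \<inter> {z. z \<bullet> e < \<gamma> (P z)}"
        have "open U" unfolding U_def
          by (intro open_Int open_ball open_Collect_less continuous_intros cont)
        moreover have "y \<in> U" using gt y by (auto simp: U_def)
        moreover have "\<Omega> \<inter> U = {}" using eq unfolding U_def P_def by force
        ultimately show False using \<open>y \<in> closure \<Omega>\<close> open_Int_closure_eq_empty[of U \<Omega>] by blast
      qed
      ultimately have "\<gamma> (P y) = y \<bullet> e" by simp
      then have "y = F (P y)" by (simp add: F_def P_def)
      then show "y \<in> F ` {z. z \<bullet> e = 0}" using P0 by blast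
    qed
    moreover have "negligible (F ` {z. z \<bullet> e = 0})"
    proof (rule negligible_locally_Lipschitz_image)
      have "e \<noteq> 0" using r(2) by auto
      then show "negligible {z. z \<bullet> e = 0}"
        using negligible_hyperplane[of e 0] by (simp add: inner_commute)
      fix a assume a: "a \<in> {z. z \<bullet> e = 0}"
      have "norm (F y - F a) \<le> (1 + L) * norm (y - a)" if "y \<in> {z. z \<bullet> e = 0}" for y
      proof -
        have "norm (F y - F a) = norm ((y - a) + (\<gamma> y - \<gamma> a) *\<^sub>R e)"
          by (simp add: F_def algebra_simps)
        also have "\<dots> \<le> norm (y - a) + \<bar>\<gamma> y - \<gamma> a\<bar>"
          using norm_triangle_ineq[of "y - a" "(\<gamma> y - \<gamma> a) *\<^sub>R e"] r(2) by simp
        also have "\<bar>\<gamma> y - \<gamma> a\<bar> \<le> L * norm (y - a)"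
          using lipschitz_onD[OF \<gamma> that a] by (simp add: dist_norm)
        finally show ?thesis by (simp add: algebra_simps)
      qed
      then show "\<exists>T B. open T \<and> a \<in> T \<and> (\<forall>y\<in>{z. z \<bullet> e = 0} \<inter> T. norm (F y - F a) \<le> B * norm (y - a))"
        by (intro exI[of _ UNIV] exI[of _ "1 + L"]) auto
    qed simp
    ultimately show ?thesis using r(1) negligible_subset by blast
  qed
  then obtain r where r: "\<And>x. x \<in> frontier \<Omega> \<Longrightarrow> r x > 0 \<and> negligible (frontier \<Omega> \<inter> ball x (r x))"
    by metis
  have "frontier \<Omega> \<subseteq> (\<Union>x\<in>frontier \<Omega>. ball x (r x))" using r by force
  then obtain C where C: "C \<subseteq> frontier \<Omega>" "finite C" "frontier \<Omega> \<subseteq> (\<Union>x\<in>C. ball x (r x))"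
    using compactE_image[OF compact_frontier_bounded[OF \<Omega>(2)], of "frontier \<Omega>" "\<lambda>x. ball x (r x)"] by auto
  then have "frontier \<Omega> = (\<Union>x\<in>C. frontier \<Omega> \<inter> ball x (r x))" by blast
  also have "negligible \<dots>" using C r by (intro negligible_Union finite_imageI) auto
  finally show ?thesis .
qed

text \<open>The scaled tiles that meet \<open>\<Sigma>\<close> without being contained in it lie near the frontier, hence
  do not affect the count to leading order.\<close>

lemma tile_count:
  fixes \<Lambda> \<Sigma> :: "(real^'n) set"
  assumes fd: "fundamental_domain \<Lambda> \<Sigma>" and \<Sigma>: "open \<Sigma>" "bounded \<Sigma>" "\<Sigma> \<noteq> {}"
    and neg: "negligible (frontier \<Sigma>)" and \<delta>: "\<delta> > 0"
  shows "\<forall>\<^sub>F K :: real in at_top. \<exists>G. finite G \<and> G \<subseteq> \<Lambda> \<and>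
    (\<forall>z\<in>G. \<forall>y. K *\<^sub>R y - z \<in> \<Sigma> \<longrightarrow> y \<in> \<Sigma>) \<and> (1 - \<delta>) * K ^ CARD('n) \<le> real (card G)"
proof -
  let ?N = "CARD('n)"
  have lm: "\<Sigma> \<in> lmeasurable" using \<Sigma> by (simp add: lmeasurable_open)
  define M where "M = measure lebesgue \<Sigma>"
  have M: "M > 0" unfolding M_def using \<Sigma> by (rule open_bounded_measure_pos)
  \<comment> \<open>Only the closed tiles cover the space, so the volume comparison at the end uses
    closures; these have the same measure because the frontier is null.\<close>
  have Mcl: "measure lebesgue (closure \<Sigma>) = M"
    unfolding M_def using measure_closure[OF \<Sigma>(2) neg] .
  obtain d where d: "d > 0" "\<And>a b. a \<in> closure \<Sigma> \<Longrightarrow> b \<in> closure \<Sigma> \<Longrightarrow> dist a b \<le> d"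
  proof -
    obtain d where "\<forall>a\<in>closure \<Sigma>. \<forall>b\<in>closure \<Sigma>. dist a b \<le> d"
      using bounded_two_points[of "closure \<Sigma>"] \<Sigma>(2) bounded_closure by blast
    then show thesis by (intro that[of "max 1 d"]) (auto intro: max.coboundedI2)
  qed
  have comp: "compact (frontier \<Sigma>)" using \<Sigma>(2) by (rule compact_frontier_bounded)
  \<comment> \<open>A neighbourhood of the frontier so small that the volume lost inside it is less
    than the fraction \<delta> of the total.\<close>
  obtain U where U: "open U" "frontier \<Sigma> \<subseteq> U" "U \<in> lmeasurable" "measure lebesgue U < \<delta> * M"
  proof -
    have fr: "frontier \<Sigma> \<in> lmeasurable" using comp by (rule lmeasurable_compact)
    obtain U where U: "open U" "frontier \<Sigma> \<subseteq> U" "U - frontier \<Sigma> \<in> lmeasurable"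
      "emeasure lebesgue (U - frontier \<Sigma>) < ennreal (\<delta> * M)"
      using sets_lebesgue_outer_open[OF fmeasurableD[OF fr], of "\<delta> * M"] \<delta> M by auto
    have eq: "U = (U - frontier \<Sigma>) \<union> frontier \<Sigma>" using U(2) by blast
    have "U \<in> lmeasurable" by (subst eq) (intro fmeasurable.Un U fr)
    moreover have "measure lebesgue U < \<delta> * M"
    proof -
      have "measure lebesgue U = measure lebesgue (U - frontier \<Sigma>)"
      proof (rule measure_negligible_symdiff[OF U(3)])
        show "negligible (U - frontier \<Sigma> - U \<union> (U - (U - frontier \<Sigma>)))"
          by (rule negligible_subset[OF neg]) blast
      qed
      also have "\<dots> < \<delta> * M"
        using U(3,4) \<delta> M by (simp add: emeasure_eq_measure2 ennreal_less_iff)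
      finally show ?thesis .
    qed
    ultimately show thesis using U that by blast
  qed
  obtain \<epsilon> where \<epsilon>: "\<epsilon> > 0" "(\<Union>x\<in>frontier \<Sigma>. ball x \<epsilon>) \<subseteq> U"
    using compact_subset_open_imp_ball_epsilon_subset[OF comp U(1,2)] by blast
  \<comment> \<open>For such \<open>K\<close> the scaled tiles have diameter less than
    \<epsilon>.\<close>
  have "\<forall>\<^sub>F K :: real in at_top. K > max 0 (d / \<epsilon>)" by (rule eventually_gt_at_top)
  then show ?thesis
  proof eventually_elim
    case (elim K)
    then have K: "K > 0" "d / K < \<epsilon>" using \<epsilon>(1) by (auto simp: field_simps)
    define T where "T = (\<lambda>(z :: real^'n) S. (\<lambda>x. (1 / K) *\<^sub>R x + (1 / K) *\<^sub>R z) ` S)"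
    have T_iff: "y \<in> T z S \<longleftrightarrow> K *\<^sub>R y - z \<in> S" for y z S
    proof
      assume "K *\<^sub>R y - z \<in> S"
      moreover have "y = (1 / K) *\<^sub>R (K *\<^sub>R y - z) + (1 / K) *\<^sub>R z" using K by (simp add: algebra_simps)
      ultimately show "y \<in> T z S" unfolding T_def by blast
    qed (use K in \<open>auto simp: T_def algebra_simps\<close>)
    have Tm: "measure lebesgue (T z S) = measure lebesgue S / K ^ ?N" for z S
      unfolding T_def using measure_lebesgue_affine[of "1 / K" "(1 / K) *\<^sub>R z" S] K
      by (simp add: power_divide)
    have T_cl: "compact (T z (closure \<Sigma>))" for z
      unfolding T_def using \<Sigma>(2) by (intro compact_continuous_image continuous_intros) (simp add: compact_closure)
    have T_open: "T z \<Sigma> \<in> lmeasurable" for z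
    proof (rule lmeasurable_open)
      have "T z \<Sigma> = (\<lambda>y. K *\<^sub>R y - z) -` \<Sigma>" using T_iff by blast
      then show "open (T z \<Sigma>)"
        using \<Sigma>(1) by (simp add: continuous_open_vimage continuous_intros)
      show "bounded (T z \<Sigma>)"
        by (rule bounded_subset[OF compact_imp_bounded[OF T_cl]]) (auto simp: T_def closure_subset[THEN subsetD])
    qed
    have disj: "T z \<Sigma> \<inter> T z' \<Sigma> = {}" if "z \<in> \<Lambda>" "z' \<in> \<Lambda>" "z \<noteq> z'" for z z'
    proof -
      have *: "(+) z ` \<Sigma> \<inter> (+) z' ` \<Sigma> = {}" using fd that unfolding fundamental_domain_def by blast
      have False if "y \<in> T z \<Sigma>" "y \<in> T z' \<Sigma>" for y
      proof -
        have "z + (K *\<^sub>R y - z) \<in> (+) z ` \<Sigma>" "z' + (K *\<^sub>R y - z') \<in> (+) z' ` \<Sigma>"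
          using that unfolding T_iff by blast+
        with * show False by auto
      qed
      then show ?thesis by blast
    qed
    define G where "G = {z \<in> \<Lambda>. T z \<Sigma> \<subseteq> \<Sigma>}"
    \<comment> \<open>The tiles contained in \<open>\<Sigma>\<close> are disjoint and of equal
      volume, so comparing volumes bounds the size of every finite subfamily of \<open>G\<close>;
      finiteness follows.\<close>
    have "finite G \<and> card G \<le> nat \<lfloor>K ^ ?N\<rfloor>"
    proof (rule finite_if_finite_subsets_card_bdd)
      fix F assume F: "F \<subseteq> G" "finite F"
      have "real (card F) * (M / K ^ ?N) = (\<Sum>z\<in>F. measure lebesgue (T z \<Sigma>))"
        by (simp add: Tm M_def)
      also have "\<dots> = measure lebesgue (\<Union>z\<in>F. T z \<Sigma>)"
        using F disj by (intro measure_negligible_finite_Union_image[symmetric] T_open)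
          (auto simp: pairwise_def G_def subset_iff)
      also have "\<dots> \<le> M" unfolding M_def
        using F by (intro measure_mono_fmeasurable lm) (auto simp: G_def intro!: fmeasurableD T_open)
      finally have "real (card F) \<le> K ^ ?N" using M K by (simp add: field_simps)
      then show "card F \<le> nat \<lfloor>K ^ ?N\<rfloor>" by (simp add: le_nat_floor)
    qed
    then have finG: "finite G" by blast
    \<comment> \<open>A point of \<open>\<Sigma>\<close> either lies in a closed tile counted by
      \<open>G\<close> or in one that sticks out, and then it is close to the frontier. Taking
      volumes gives the lower bound for \<open>card G\<close>.\<close>
    have "\<Sigma> \<subseteq> (\<Union>z\<in>G. T z (closure \<Sigma>)) \<union> U"
    proof
      fix y assume y: "y \<in> \<Sigma>"
      have "K *\<^sub>R y \<in> (\<Union>z\<in>\<Lambda>. closure ((+) z ` \<Sigma>))"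
        using fd by (simp add: fundamental_domain_def)
      then obtain z where z: "z \<in> \<Lambda>" "K *\<^sub>R y \<in> closure ((+) z ` \<Sigma>)" by blast
      then have "K *\<^sub>R y \<in> (+) z ` closure \<Sigma>" by (simp add: closure_translation)
      then have yT: "y \<in> T z (closure \<Sigma>)" unfolding T_iff by auto
      show "y \<in> (\<Union>z\<in>G. T z (closure \<Sigma>)) \<union> U"
      proof (cases "T z \<Sigma> \<subseteq> \<Sigma>")
        case True
        then show ?thesis using z(1) yT by (auto simp: G_def)
      next
        case False
        then obtain y' where y': "y' \<in> T z \<Sigma>" "y' \<notin> \<Sigma>" by blast
        \<comment> \<open>The segment from inside to outside crosses the frontier, and its length is
          at most the diameter of a tile.\<close>
        have "closed_segment y y' \<inter> frontier \<Sigma> \<noteq> {}"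
          using y y' by (intro connected_Int_frontier) auto
        then obtain f where f: "f \<in> closed_segment y y'" "f \<in> frontier \<Sigma>" by blast
        have "dist f y \<le> dist y y'" using f(1) by (metis dist_commute dist_in_closed_segment)
        also have "dist y y' = (1 / K) * dist (K *\<^sub>R y - z) (K *\<^sub>R y' - z)"
        proof -
          have "dist (K *\<^sub>R y - z) (K *\<^sub>R y' - z) = norm (K *\<^sub>R (y - y'))"
            by (simp add: dist_norm algebra_simps)
          then show ?thesis using K by (simp add: dist_norm)
        qed
        also have "\<dots> \<le> (1 / K) * d"
          using yT y' K closure_subset[of \<Sigma>] unfolding T_iff by (intro mult_left_mono d(2)) auto
        also have "\<dots> < \<epsilon>" using K by simp
        finally have "y \<in> ball f \<epsilon>" by simp
        then show ?thesis using f(2) \<epsilon>(2) by blast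
      qed
    qed
    then have "M \<le> measure lebesgue ((\<Union>z\<in>G. T z (closure \<Sigma>)) \<union> U)"
      unfolding M_def using lm U(3) finG T_cl
      by (intro measure_mono_fmeasurable fmeasurable.Un fmeasurable.finite_UN) (auto intro: lmeasurable_compact)
    also have "\<dots> \<le> measure lebesgue (\<Union>z\<in>G. T z (closure \<Sigma>)) + measure lebesgue U"
      using U(3) finG T_cl
      by (intro measure_Un_le fmeasurableD fmeasurable.finite_UN) (auto intro: lmeasurable_compact)
    also have "measure lebesgue (\<Union>z\<in>G. T z (closure \<Sigma>)) \<le> (\<Sum>z\<in>G. measure lebesgue (T z (closure \<Sigma>)))"
      using finG T_cl by (intro measure_UNION_le) (auto intro: fmeasurableD lmeasurable_compact)
    also have "\<dots> = real (card G) * (M / K ^ ?N)"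
      by (simp add: Tm Mcl)
    finally have "M \<le> real (card G) * (M / K ^ ?N) + \<delta> * M" using U(4) by linarith
    then have "(1 - \<delta>) * K ^ ?N * M \<le> real (card G) * M" using K by (simp add: field_simps)
    then have "(1 - \<delta>) * K ^ ?N \<le> real (card G)" using M by simp
    moreover have "\<forall>z\<in>G. \<forall>y. K *\<^sub>R y - z \<in> \<Sigma> \<longrightarrow> y \<in> \<Sigma>"
      unfolding G_def T_iff[symmetric] by blast
    moreover have "G \<subseteq> \<Lambda>" by (auto simp: G_def)
    ultimately show ?case using finG by blast
  qed
qed

section \<open>From the eigenvalue inequality to the Weyl constant\<close>

lemma cogenus_eigenvalue_nonneg:
  assumes "p > 0" "open \<Omega>" "k \<ge> 1" "odd_sphere_maps p \<Omega> k \<noteq> {}"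
  shows "cogenus_eigenvalue p \<Omega> k \<ge> 0"
  unfolding cogenus_eigenvalue_def unit_sphere_def[symmetric]
proof (rule cINF_greatest[OF assms(4)])
  fix g assume g: "g \<in> odd_sphere_maps p \<Omega> k"
  obtain \<xi> where \<xi>: "\<xi> \<in> unit_sphere k" using in_topspace_nsphere unfolding unit_sphere_def by blast
  have "0 \<le> energy p \<Omega> (g \<xi>)" by (rule energy_nonneg)
  also have "\<dots> \<le> (SUP \<xi>\<in>unit_sphere k. energy p \<Omega> (g \<xi>))"
    by (rule cSUP_upper[OF \<xi> odd_sphere_map_energy_bdd[OF assms(1-3) g]])
  finally show "0 \<le> (SUP \<xi>\<in>unit_sphere k. energy p \<Omega> (g \<xi>))" .
qed

text \<open>The tile of a lattice point z is z + \<open>\<Sigma>\<close> shrunk by \<open>K\<close>,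
  and sending y to \<open>K *\<^sub>R y - z\<close> maps it onto \<open>\<Sigma>\<close>; hence the
  offset -z and the dilation \<open>K\<close> in the placements.\<close>

lemma cogenus_eigenvalue_scaled_tiles_le:
  fixes \<Lambda> \<Sigma> :: "(real^'n) set"
  assumes fd: "fundamental_domain \<Lambda> \<Sigma>" and \<Sigma>: "open \<Sigma>" "bounded \<Sigma>"
    and G: "finite G" "G \<subseteq> \<Lambda>" "\<And>z y. z \<in> G \<Longrightarrow> K *\<^sub>R y - z \<in> \<Sigma> \<Longrightarrow> y \<in> \<Sigma>" "card G \<ge> 1"
    and p: "p > 1" and K: "K > 0" and m: "m \<ge> 1" and ne: "odd_sphere_maps p \<Sigma> m \<noteq> {}"
  shows "cogenus_eigenvalue p \<Sigma> (m * card G) \<le> K powr p * cogenus_eigenvalue p \<Sigma> m"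
proof -
  obtain g where g: "bij_betw g {0..<card G} G" using ex_bij_betw_nat_finite[OF G(1)] by blast
  have gG: "g j \<in> G" if "j < card G" for j using bij_betwE[OF g] that by auto
  have inj: "g i \<noteq> g j" if "i < card G" "j < card G" "i \<noteq> j" for i j
    using bij_betw_imp_inj_on[OF g] that by (auto simp: inj_on_def)
  show ?thesis
  proof (rule cogenus_eigenvalue_tiles_le[where b = "\<lambda>j. - g j"])
    show "placement p K \<Sigma> \<Sigma> (- g j)" if "j < card G" for j
    proof
      show "y \<in> \<Sigma>" if "- g j + K *\<^sub>R y \<in> \<Sigma>" for y
        using G(3)[OF gG[OF \<open>j < card G\<close>], of y] that by simp
    qed (use p K \<Sigma> in auto)
    fix i j y assume ij: "i < card G" "j < card G" "i \<noteq> j" and y: "- g i + K *\<^sub>R y \<in> \<Sigma>"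
    have "(+) (g i) ` \<Sigma> \<inter> (+) (g j) ` \<Sigma> = {}"
      using fd inj[OF ij] gG[OF ij(1)] gG[OF ij(2)] G(2) unfolding fundamental_domain_def by blast
    moreover have "g i + (- g i + K *\<^sub>R y) \<in> (+) (g i) ` \<Sigma>" using y by blast
    ultimately show "- g j + K *\<^sub>R y \<notin> \<Sigma>"
      using imageI[of "- g j + K *\<^sub>R y" \<Sigma> "(+) (g j)"] by auto
  qed (use p K \<Sigma> m G ne in auto)
qed

theorem proposition1p8:
  fixes p C\<^sub>W :: real and m :: nat and \<Lambda> \<Sigma> :: "(real^'n) set"
  assumes "CARD('n) \<ge> 2" and "p > 1" and "m \<ge> 1"
    and "full_rank_lattice \<Lambda>"
    and "fundamental_domain \<Lambda> \<Sigma>"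
    and "bounded_lipschitz_domain \<Sigma>"
    and "is_weyl_constant TYPE('n) p C\<^sub>W"
  shows "C\<^sub>W \<le> measure lebesgue \<Sigma> powr (p / real CARD('n)) *
               (cogenus_eigenvalue p \<Sigma> m / real m powr (p / real CARD('n)))"
proof -
  note p = \<open>p > 1\<close> and m = \<open>m \<ge> 1\<close> and fd = \<open>fundamental_domain \<Lambda> \<Sigma>\<close>
    and bl = \<open>bounded_lipschitz_domain \<Sigma>\<close> and w = \<open>is_weyl_constant TYPE('n) p C\<^sub>W\<close>
  have \<Sigma>: "open \<Sigma>" "bounded \<Sigma>" "\<Sigma> \<noteq> {}" "lipschitz_boundary \<Sigma>"
    using bl by (auto simp: bounded_lipschitz_domain_def is_domain_def)
  define a where "a = p / real CARD('n)"
  define M where "M = measure lebesgue \<Sigma>"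
  define E where "E = cogenus_eigenvalue p \<Sigma> m"
  have a: "a > 0" using p by (simp add: a_def)
  have M: "M > 0" unfolding M_def using \<Sigma>(1-3) by (rule open_bounded_measure_pos)
  have neg: "negligible (frontier \<Sigma>)" by (rule negligible_lipschitz_frontier[OF \<Sigma>(1,2,4)])
  have ne: "odd_sphere_maps p \<Sigma> m \<noteq> {}" using p by (intro odd_sphere_maps_nonempty[OF w bl _ m]) simp
  \<comment> \<open>The sign allows the estimate of the tile count to be multiplied by
    \<open>E\<close>.\<close>
  have E: "E \<ge> 0" unfolding E_def using p by (intro cogenus_eigenvalue_nonneg \<Sigma> m ne) simp
  have weyl: "(\<lambda>k. cogenus_eigenvalue p \<Sigma> k * real k powr (- a)) \<longlonglongrightarrow> C\<^sub>W * M powr (- a)"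
    using w bl by (simp add: is_weyl_constant_def a_def M_def)
  \<comment> \<open>\<delta> is the relative loss in the tile count; it is sent to 0 at the
    end.\<close>
  have bound: "C\<^sub>W * M powr (- a) \<le> E * real m powr (- a) * (1 - \<delta>) powr (- a)"
    if \<delta>: "0 < \<delta>" "\<delta> < 1" for \<delta>
  proof -
    let ?B = "E * real m powr (- a) * (1 - \<delta>) powr (- a)"
    have count: "\<forall>\<^sub>F K :: real in at_top. \<exists>G. finite G \<and> G \<subseteq> \<Lambda> \<and>
      (\<forall>z\<in>G. \<forall>y. K *\<^sub>R y - z \<in> \<Sigma> \<longrightarrow> y \<in> \<Sigma>) \<and> (1 - \<delta>) * K ^ CARD('n) \<le> real (card G)"
      by (rule tile_count[OF fd \<Sigma>(1-3) neg \<delta>(1)])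
    \<comment> \<open>Only multiples of m by tile counts are reached as indices. Arbitrarily large
      ones are enough, since the limit along all indices is known to exist.\<close>
    have large: "\<exists>k\<ge>k0. cogenus_eigenvalue p \<Sigma> k * real k powr (- a) \<le> ?B" for k0
    proof -
      have "filterlim (\<lambda>K. (1 - \<delta>) * K ^ CARD('n)) at_top (at_top :: real filter)"
        using \<delta> by (intro filterlim_tendsto_pos_mult_at_top[OF tendsto_const] filterlim_pow_at_top filterlim_ident) auto
      \<comment> \<open>The 1 in the maximum makes \<open>G\<close> nonempty, and \<open>k0\<close>
        makes the index large enough.\<close>
      then have "\<forall>\<^sub>F K :: real in at_top. (1 - \<delta>) * K ^ CARD('n) \<ge> real (max 1 k0)"
        by (simp add: filterlim_at_top)
      with count eventually_gt_at_top[of 0]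
      have ev: "\<forall>\<^sub>F K :: real in at_top. (\<exists>G. finite G \<and> G \<subseteq> \<Lambda> \<and>
        (\<forall>z\<in>G. \<forall>y. K *\<^sub>R y - z \<in> \<Sigma> \<longrightarrow> y \<in> \<Sigma>) \<and> (1 - \<delta>) * K ^ CARD('n) \<le> real (card G)) \<and>
        K > 0 \<and> (1 - \<delta>) * K ^ CARD('n) \<ge> real (max 1 k0)"
        by eventually_elim blast
      from eventually_happens'[OF trivial_limit_at_top_linorder ev]
      obtain K :: real and G where K: "K > 0" "(1 - \<delta>) * K ^ CARD('n) \<ge> real (max 1 k0)"
        and G: "finite G" "G \<subseteq> \<Lambda>" "\<forall>z\<in>G. \<forall>y. K *\<^sub>R y - z \<in> \<Sigma> \<longrightarrow> y \<in> \<Sigma>"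
          "(1 - \<delta>) * K ^ CARD('n) \<le> real (card G)"
        by blast
      have cG: "card G \<ge> 1" "card G \<ge> k0"
        using K(2) G(4) by linarith+
      let ?k = "m * card G"
      have "cogenus_eigenvalue p \<Sigma> ?k \<le> K powr p * E"
        unfolding E_def using G K p m ne cG
        by (intro cogenus_eigenvalue_scaled_tiles_le[OF fd \<Sigma>(1,2) G(1,2)]) auto
      then have "cogenus_eigenvalue p \<Sigma> ?k * real ?k powr (- a) \<le> K powr p * E * real ?k powr (- a)"
        by (intro mult_right_mono) auto
      also have "\<dots> = K powr p * E * (real m powr (- a) * real (card G) powr (- a))"
        by (simp add: powr_mult)
      \<comment> \<open>The negative exponent turns the lower bound for \<open>card G\<close> into
        an upper bound.\<close>
      also have "\<dots> \<le>
         K powr p * E * (real m powr (- a) * ((1 - \<delta>) * K ^ CARD('n)) powr (- a))"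
        using E a K \<delta> G(4) by (intro mult_left_mono powr_mono2') auto
      \<comment> \<open>As \<open>a\<close> is p/N, the volume factor contributes
        \<open>K powr (- p)\<close>, which cancels the scaling factor of the energy: the bound no
        longer depends on \<open>K\<close>.\<close>
      also have "((1 - \<delta>) * K ^ CARD('n)) powr (- a) = (1 - \<delta>) powr (- a) * K powr (- p)"
      proof -
        have "(K ^ CARD('n)) powr (- a) = K powr (- p)"
          using K(1) by (simp add: powr_realpow[symmetric] powr_powr a_def)
        then show ?thesis using \<delta> K by (simp add: powr_mult)
      qed
      also have "K powr p * E * (real m powr (- a) * ((1 - \<delta>) powr (- a) * K powr (- p))) = ?B"
        using K(1) by (simp add: powr_minus field_simps)
      finally have "cogenus_eigenvalue p \<Sigma> ?k * real ?k powr (- a) \<le> ?B" .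
      moreover have "?k \<ge> k0" using cG m by (metis le_trans mult_le_mono1 nat_mult_1)
      ultimately show ?thesis by blast
    qed
    \<comment> \<open>If the limit exceeded the bound, so would every quotient from some index on,
      contradicting \<open>large\<close>.\<close>
    show ?thesis
    proof (rule ccontr)
      assume "\<not> ?thesis"
      then have "\<forall>\<^sub>F k in sequentially. ?B < cogenus_eigenvalue p \<Sigma> k * real k powr (- a)"
        by (intro order_tendstoD(1)[OF weyl]) simp
      then obtain k0 where "\<And>k. k \<ge> k0 \<Longrightarrow> ?B < cogenus_eigenvalue p \<Sigma> k * real k powr (- a)"
        by (auto simp: eventually_sequentially)
      with large[of k0] show False by (meson not_le)
    qed
  qed
  have "C\<^sub>W * M powr (- a) \<le> E * real m powr (- a)"
  proof (rule tendsto_lowerbound)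
    have "((\<lambda>\<delta>. E * real m powr (- a) * (1 - \<delta>) powr (- a)) \<longlongrightarrow>
        E * real m powr (- a) * (1 - 0) powr (- a)) (at_right (0::real))"
      by (intro tendsto_intros) auto
    then show "((\<lambda>\<delta>. E * real m powr (- a) * (1 - \<delta>) powr (- a)) \<longlongrightarrow> E * real m powr (- a)) (at_right (0::real))"
      by simp
    show "\<forall>\<^sub>F \<delta> in at_right 0. C\<^sub>W * M powr (- a) \<le> E * real m powr (- a) * (1 - \<delta>) powr (- a)"
      unfolding eventually_at_right_field using bound by (intro exI[of _ 1]) auto
  qed simp
  then have "C\<^sub>W * M powr (- a) * M powr a \<le> E * real m powr (- a) * M powr a"
    by (intro mult_right_mono) auto
  then have "C\<^sub>W \<le> M powr a * (E / real m powr a)"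
    using M by (simp add: powr_minus field_simps)
  then show ?thesis by (simp add: a_def M_def E_def)
qed

end
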